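(* Let $\kappa,L,\mathfrak{n},p,q,r,s\in[0,\infty)$, $\lambda\in(L,\infty)$, $M\in\mathbb{N}\cap\big((\sqrt\lambda+\sqrt L)^2(\sqrt\lambda-\sqrt L)^{-2},\infty\big)$, $$\alpha=-\ln(3M)\Big[\ln\Big(\tfrac{1}{\sqrt M}+\big(1+\tfrac{1}{\sqrt M}\big)\sqrt{\tfrac{L}{\lambda}}\Big)\Big]^{-1},$$ $\Theta=\cup_{n\in\mathbb{N}}\mathbb{Z}^n$, let $u_d\in C(\mathbb{R}^d,\mathbb{R})$, $B_d\in\mathbb{R}^{d\times d}$, $f_d\in C(\mathbb{R}^d\times\mathbb{R},\mathbb{R})$, $d\in\mathbb{N}$, and assume for every $d\in\mathbb{N}$ that $u_d$ is a viscosity solution of $$\tfrac12\operatorname{Trace}\big(B_d(B_d)^*(\operatorname{Hess}u_d)(x)\big)=f_d(x,u_d(x))$$ for $x\in\mathbb{R}^d$. Let $(\Omega,\mathcal{F},\mathbb{P})$ be a probability space, let $W^{d,\theta}\colon[0,\infty)\times\Omega\to\mathbb{R}^d$, $\theta\in\Theta$, $d\in\mathbb{N}$, be independent standard Brownian motions, let $R^\theta\colon\Omega\to[0,\infty)$, $\theta\in\Theta$, be i.i.d. random variables, and assume that $(R^\theta)_{\theta\in\Theta}$ and $(W^{d,\theta})_{(d,\theta)\in\mathbb{N}\times\Theta}$ are independent. Let $\|\cdot\|\colon(\cup_{d\in\mathbb{N}}\mathbb{R}^d)\to[0,\infty)$ satisfy for all $d\in\mathbb{N}$, $x=(x_1,\ldots,x_d)\in\mathbb{R}^d$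 that $\|x\|=[\sum_{i=1}^d|x_i|^2]^{1/2}$. Assume for all $d\in\mathbb{N}$, $\varepsilon\in(0,\infty)$, $x\in\mathbb{R}^d$, $v,w\in\mathbb{R}$ that $\|B_dx\|\le\kappa d^r\|x\|$, $|f_d(x,0)|\le\kappa d^s(1+\|x\|^p)$, $|f_d(x,v)-f_d(x,w)-\lambda(v-w)|\le L|v-w|$, $\sup_{y\in\mathbb{R}^d}[|u_d(y)|\exp(-\varepsilon\|y\|)]<\infty$, and $\mathbb{P}(R^0\ge\varepsilon)=e^{-\lambda\varepsilon}$. Let $U^{d,\theta}_n=(U^{d,\theta}_n(x))_{x\in\mathbb{R}^d}\colon\mathbb{R}^d\times\Omega\to\mathbb{R}$, $\theta\in\Theta$, $d,n\in\mathbb{N}_0$, satisfy for all $d,n\in\mathbb{N}$, $\theta\in\Theta$, $x\in\mathbb{R}^d$ that $U^{d,\theta}_0(x)=0$ and $$\begin{aligned} U^{d,\theta}_n(x)={}&\frac{-1}{\lambda M^n}\left[\sum_{m=1}^{M^n}f_d\big(x+B_dW^{d,(\theta,0,m)}_{R^{(\theta,0,m)}},0\big)\right]\\ &+\sum_{k=1}^{n-1}\frac{1}{\lambda M^{(n-k)}}\Bigg[\sum_{m=1}^{M^{(n-k)}}\bigg(\lambda\Big[U^{d,(\theta,k,m)}_k\big(x+B_dW^{d,(\theta,k,m)}_{R^{(\theta,k,m)}}\big)-U^{d,(\theta,k,-m)}_{k-1}\big(x+B_dW^{d,(\theta,k,m)}_{R^{(\theta,k,m)}}\big)\Big]\\ &\qquad-\Big[f_d\Big(x+B_dW^{d,(\theta,k,m)}_{R^{(\theta,k,m)}},U^{d,(\theta,k,m)}_k\big(x+B_dW^{d,(\theta,k,m)}_{R^{(\theta,k,m)}}\big)\Big)\\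 &\qquad\quad-f_d\Big(x+B_dW^{d,(\theta,k,m)}_{R^{(\theta,k,m)}},U^{d,(\theta,k,-m)}_{k-1}\big(x+B_dW^{d,(\theta,k,m)}_{R^{(\theta,k,m)}}\big)\Big)\Big]\bigg)\Bigg], \end{aligned}$$ and let $\mathfrak{C}_{d,n}\in\mathbb{R}$, $d,n\in\mathbb{N}_0$, satisfy for all $d,n\in\mathbb{N}_0$ that $\mathfrak{C}_{d,n}\le(d+1)M^n+\sum_{k=1}^{n-1}M^{(n-k)}(d+1+\mathfrak{C}_{d,k}+\mathfrak{C}_{d,k-1})$. Then there exist $c\in\mathbb{R}$ and $\mathfrak{N}\colon(0,1]\times\mathbb{N}\to(\mathbb{Z}\cap[\mathfrak{n},\infty))$ such that for all $\varepsilon\in(0,1]$, $d\in\mathbb{N}$ it holds that $$\mathfrak{C}_{d,\mathfrak{N}_{\varepsilon,d}}\le c\,d^{1+\alpha(s+p\max\{q,2r+1\})}\varepsilon^{-\alpha}\quad\text{and}\quad\sup_{x\in\mathbb{R}^d,\|x\|\le\kappa d^q}\Big(\mathbb{E}\big[|u_d(x)-U^{d,0}_{\mathfrak{N}_{\varepsilon,d}}(x)|^2\big]\Big)^{1/2}\le\varepsilon.$$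
   Context: $\mathbb{N}=\{1,2,3,\ldots\}$ and $\mathbb{N}_0=\mathbb{N}\cup\{0\}$. $B^*$ is the transpose. $\Theta$ is an index set of finite integer tuples (with $0\in\mathbb{Z}^1\subseteq\Theta$); for $\theta=(\theta_1,\ldots,\theta_j)\in\Theta$ and integers $k,m$, $(\theta,k,m)=(\theta_1,\ldots,\theta_j,k,m)\in\Theta$ denotes concatenation. $W^{d,\theta}_{R^{\theta}}$ denotes $\omega\mapsto W^{d,\theta}_{R^\theta(\omega)}(\omega)$, and $U(Y)$ for a random field $U$ and a random variable $Y$ denotes $\omega\mapsto U(Y(\omega),\omega)$. Empty sums are zero. $\mathfrak{N}_{\varepsilon,d}=\mathfrak{N}(\varepsilon,d)$. Viscosity solution convention: $u\in C(\mathbb{R}^d,\mathbb{R})$ is a viscosity solution of $\frac12\operatorname{Trace}(BB^*(\operatorname{Hess}u)(x))=f(x,u(x))$ for $x\in\mathbb{R}^d$ if for all $x\in\mathbb{R}^d$, $\varphi\in C^2(\mathbb{R}^d,\mathbb{R})$ with $\varphi(x)=u(x)$: (a) if $\varphi\ge u$ then $\frac12\operatorname{Trace}(BB^*(\operatorname{Hess}\varphi)(x))\ge f(x,\varphi(x))$; (b) if $\varphi\le u$ then $\frac12\operatorname{Trace}(BB^*(\operatorname{Hess}\varphi)(x))\le f(x,\varphi(x))$. *)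

theory Defs
  imports "HOL-Probability.Probability"
begin

text \<open>
  The dimension varies inside the statement, so \<open>\<real>\<^sup>d\<close> is the library space
  \<^const>\<open>Euclidean_space\<close>: functions \<open>x :: nat \<Rightarrow> real\<close> with \<open>x i = 0\<close> for \<open>i \<ge> d\<close>, coordinates being
  numbered from \<open>0\<close>, with the subspace topology of the product topology. Accordingly, the
  Borel \<open>\<sigma>\<close>-algebra used is that of the type \<open>nat \<Rightarrow> real\<close> (which is the product \<open>\<sigma>\<close>-algebra).
  A \<open>d \<times> d\<close> matrix is a function \<open>nat \<Rightarrow> nat \<Rightarrow> real\<close> of which only the entries with both
  indices below \<open>d\<close> are ever used.
\<close>

abbreviation Rd :: "nat \<Rightarrow> (nat \<Rightarrow> real) set" where
  "Rd d \<equiv> topspace (Euclidean_space d)"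

abbreviation enorm :: "nat \<Rightarrow> (nat \<Rightarrow> real) \<Rightarrow> real" where
  "enorm d x \<equiv> L2_set x {..<d}"

definition mat_vec :: "nat \<Rightarrow> (nat \<Rightarrow> nat \<Rightarrow> real) \<Rightarrow> (nat \<Rightarrow> real) \<Rightarrow> nat \<Rightarrow> real" where
  "mat_vec d A x = (\<lambda>i. if i < d then (\<Sum>j<d. A i j * x j) else 0)"

definition mat_mult ::
  "nat \<Rightarrow> (nat \<Rightarrow> nat \<Rightarrow> real) \<Rightarrow> (nat \<Rightarrow> nat \<Rightarrow> real) \<Rightarrow> nat \<Rightarrow> nat \<Rightarrow> real" where
  "mat_mult d A B = (\<lambda>i j. \<Sum>k<d. A i k * B k j)"

definition mat_transpose :: "(nat \<Rightarrow> nat \<Rightarrow> real) \<Rightarrow> nat \<Rightarrow> nat \<Rightarrow> real" where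
  "mat_transpose A = (\<lambda>i j. A j i)"

definition mat_trace :: "nat \<Rightarrow> (nat \<Rightarrow> nat \<Rightarrow> real) \<Rightarrow> real" where
  "mat_trace d A = (\<Sum>i<d. A i i)"

text \<open>Nonnegative reals to nonnegative real powers with \<open>0\<^sup>0 = 1\<close>
  (whereas \<open>0 powr 0 = 0\<close>).\<close>

definition rpow :: "real \<Rightarrow> real \<Rightarrow> real" where
  "rpow x p = (if p = 0 then 1 else x powr p)"


definition partial_deriv :: "nat \<Rightarrow> ((nat \<Rightarrow> real) \<Rightarrow> real) \<Rightarrow> (nat \<Rightarrow> real) \<Rightarrow> real" where
  "partial_deriv i \<phi> x = deriv (\<lambda>t. \<phi> (x(i := t))) (x i)"

definition C1 :: "nat \<Rightarrow> ((nat \<Rightarrow> real) \<Rightarrow> real) \<Rightarrow> bool" where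
  "C1 d \<phi> \<longleftrightarrow>
     continuous_map (Euclidean_space d) euclideanreal \<phi> \<and>
     (\<forall>i<d. (\<forall>x\<in>Rd d. (\<lambda>t. \<phi> (x(i := t))) differentiable (at (x i))) \<and>
            continuous_map (Euclidean_space d) euclideanreal (partial_deriv i \<phi>))"

definition C2 :: "nat \<Rightarrow> ((nat \<Rightarrow> real) \<Rightarrow> real) \<Rightarrow> bool" where
  "C2 d \<phi> \<longleftrightarrow> C1 d \<phi> \<and> (\<forall>i<d. C1 d (partial_deriv i \<phi>))"

definition Hess :: "((nat \<Rightarrow> real) \<Rightarrow> real) \<Rightarrow> (nat \<Rightarrow> real) \<Rightarrow> nat \<Rightarrow> nat \<Rightarrow> real" where
  "Hess \<phi> x = (\<lambda>i j. partial_deriv i (partial_deriv j \<phi>) x)"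

definition half_trace ::
  "nat \<Rightarrow> (nat \<Rightarrow> nat \<Rightarrow> real) \<Rightarrow> ((nat \<Rightarrow> real) \<Rightarrow> real) \<Rightarrow> (nat \<Rightarrow> real) \<Rightarrow> real" where
  "half_trace d B \<phi> x =
     1 / 2 * mat_trace d (mat_mult d (mat_mult d B (mat_transpose B)) (Hess \<phi> x))"

text \<open>Viscosity solutions of \<open>\<onehalf> Trace(B B\<^sup>* (Hess u)(x)) = f(x, u(x))\<close>, \<open>x \<in> \<real>\<^sup>d\<close>; the test
  functions touch \<open>u\<close> at \<open>x\<close> globally from above resp. below.\<close>

definition viscosity_solution ::
  "nat \<Rightarrow> (nat \<Rightarrow> nat \<Rightarrow> real) \<Rightarrow> ((nat \<Rightarrow> real) \<Rightarrow> real \<Rightarrow> real) \<Rightarrow> ((nat \<Rightarrow> real) \<Rightarrow> real) \<Rightarrow> bool" where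
  "viscosity_solution d B f u \<longleftrightarrow>
     continuous_map (Euclidean_space d) euclideanreal u \<and>
     (\<forall>x\<in>Rd d. \<forall>\<phi>. C2 d \<phi> \<and> \<phi> x = u x \<longrightarrow>
        ((\<forall>y\<in>Rd d. \<phi> y \<ge> u y) \<longrightarrow> half_trace d B \<phi> x \<ge> f x (\<phi> x)) \<and>
        ((\<forall>y\<in>Rd d. \<phi> y \<le> u y) \<longrightarrow> half_trace d B \<phi> x \<le> f x (\<phi> x)))"

text \<open>All sample paths on \<open>[0, \<infinity>)\<close> are continuous, so that evaluating at a random time is
  measurable; starting at \<open>0\<close> is only required almost surely.\<close>

definition standard_brownian_motion ::
  "'w measure \<Rightarrow> nat \<Rightarrow> (real \<Rightarrow> 'w \<Rightarrow> nat \<Rightarrow> real) \<Rightarrow> bool" where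
  "standard_brownian_motion P d W \<longleftrightarrow>
     (\<forall>t\<ge>0. W t \<in> borel_measurable P) \<and>
     (\<forall>\<omega>\<in>space P. continuous_map (top_of_set {0..}) (Euclidean_space d) (\<lambda>t. W t \<omega>)) \<and>
     (AE \<omega> in P. W 0 \<omega> = (\<lambda>i. 0)) \<and>
     (\<forall>(t :: nat \<Rightarrow> real) n. 0 \<le> t 0 \<and> (\<forall>k<n. t k \<le> t (Suc k)) \<longrightarrow>
        prob_space.indep_vars P (\<lambda>_. borel)
          (\<lambda>k \<omega> i. W (t (Suc k)) \<omega> i - W (t k) \<omega> i) {..<n}) \<and>
     (\<forall>t1 t2. 0 \<le> t1 \<and> t1 < t2 \<longrightarrow>
        prob_space.indep_vars P (\<lambda>_. borel) (\<lambda>i \<omega>. W t2 \<omega> i - W t1 \<omega> i) {..<d} \<and>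
        (\<forall>i<d. distributed P lborel (\<lambda>\<omega>. W t2 \<omega> i - W t1 \<omega> i)
                 (normal_density 0 (sqrt (t2 - t1)))))"

text \<open>Independence of two random variables with values in different types; the library's
  \<open>indep_var\<close> forces a common value type.\<close>

definition indep_rvs ::
  "'w measure \<Rightarrow> 'a measure \<Rightarrow> ('w \<Rightarrow> 'a) \<Rightarrow> 'b measure \<Rightarrow> ('w \<Rightarrow> 'b) \<Rightarrow> bool" where
  "indep_rvs P N X N' Y \<longleftrightarrow>
     X \<in> measurable P N \<and> Y \<in> measurable P N' \<and>
     prob_space.indep_set P
       {X -` A \<inter> space P | A. A \<in> sets N} {Y -` A \<inter> space P | A. A \<in> sets N'}"

text \<open>Processes indexed by \<open>[0, \<infinity>)\<close> are random variables in the path space with the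
  product \<open>\<sigma>\<close>-algebra.\<close>

definition path_space :: "(real \<Rightarrow> nat \<Rightarrow> real) measure" where
  "path_space = Pi\<^sub>M {0..} (\<lambda>_. borel)"

definition sample_path :: "(real \<Rightarrow> 'w \<Rightarrow> nat \<Rightarrow> real) \<Rightarrow> 'w \<Rightarrow> real \<Rightarrow> nat \<Rightarrow> real" where
  "sample_path W \<omega> = (\<lambda>t\<in>{0..}. W t \<omega>)"

text \<open>The index set \<open>\<Theta> = \<Union>\<^bsub>n\<ge>1\<^esub> \<int>\<^sup>n\<close>; the tuple \<open>(\<theta>,k,m)\<close> is \<open>\<theta> @ [k, m]\<close> and
  \<open>0 \<in> \<int>\<^sup>1\<close> is \<open>[0]\<close>.\<close>

definition Theta :: "int list set" where
  "Theta = {\<theta>. \<theta> \<noteq> []}"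

text \<open>\<open>shift_pt d B W R x\<close> is the random point \<open>x + B W\<^sub>R\<close>, that is
  \<open>\<omega> \<mapsto> x + B W\<^bsub>R(\<omega>)\<^esub>(\<omega>)\<close>.\<close>

definition shift_pt ::
  "nat \<Rightarrow> (nat \<Rightarrow> nat \<Rightarrow> real) \<Rightarrow> (real \<Rightarrow> 'w \<Rightarrow> nat \<Rightarrow> real) \<Rightarrow> ('w \<Rightarrow> real)
     \<Rightarrow> (nat \<Rightarrow> real) \<Rightarrow> 'w \<Rightarrow> nat \<Rightarrow> real" where
  "shift_pt d B W R x \<omega> = (\<lambda>i. x i + mat_vec d B (W (R \<omega>) \<omega>) i)"

end

theory Submission
  imports Defs
begin

text \<open>
  Put \<open>g(x, v) = v - f(x, v) / \<lambda>\<close>, which is \<open>(L / \<lambda>)\<close>-Lipschitz in \<open>v\<close>, and \<open>Y = x + B W\<^sub>R\<close>.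
  With \<open>h = \<lambda> u - f(\<cdot>, u)\<close> frozen, \<open>u\<close> is a viscosity solution of a linear equation with constant
  coefficients. Approximating \<open>h\<close> by trigonometric polynomials, for which the equation is solved
  explicitly, turns explicit smooth functions into test functions, and the maximum principle gives
  \<open>u(x) = \<bbbE>[g(Y, u(Y))]\<close>; no doubling of variables is needed.

  The scheme involves the Brownian motions and random times only through the i.i.d. variables
  \<open>W\<^sup>\<theta>\<^sub>R\<close>, so that it may be studied on an infinite product space, on which \<open>U\<^sup>\<theta>\<^sub>n\<close> is a fixed functional of
  the variables indexed by the proper extensions of \<open>\<theta>\<close>. The weight \<open>w(x) = (K + \<parallel>x\<parallel>)\<^sup>p\<close> with
  \<open>K\<close> of order \<open>d\<^sup>r\<^sup>+\<^sup>1\<close> satisfies \<open>\<bbbE>[w(Y)\<^sup>2] \<le> (\<lambda> / L) w(x)\<^sup>2\<close>, whence \<open>v \<mapsto> \<bbbE>[g(Y, v(Y))]\<close> contracts by the factor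
  \<open>a = (L / \<lambda>)\<^sup>1\<^sup>/\<^sup>2\<close> in the corresponding weighted norm, and the error \<open>e\<^sub>n\<close> in that norm satisfies, with \<open>b = M\<^sup>-\<^sup>1\<^sup>/\<^sup>2\<close>,
  \<open>e\<^sub>n \<le> b\<^sup>n C + \<Sum>\<^sub>k b\<^sup>n\<^sup>-\<^sup>k a (e\<^sub>k + e\<^sub>k\<^sub>-\<^sub>1) + a e\<^sub>n\<^sub>-\<^sub>1\<close>. Hence \<open>e\<^sub>n = O((b + a (1 + b))\<^sup>n)\<close>, while the cost
  is \<open>O(d (3 M)\<^sup>n)\<close>.
\<close>

subsection \<open>Ridge functions and the second order operator\<close>

text \<open>The hypotheses bound u only by exponentials of every positive rate, with constants
  depending on d in an unknown way. Such growth suffices for a barrier growing like exp(c |x| / d)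
  to enforce the maximum principle, hence the fixed point equation; only that equation then yields
  |u| <= N w with N explicit. Since h is frozen, f is read only along the graph of u and the linear
  operator has constant coefficients, so plane waves diagonalise both this operator and the average
  over the noise; comparing the multipliers links the equation to Brownian motion. The Lipschitz
  constant L / \<lambda> = a^2 is spent in two halves: one factor a pays for the growth of the
  weight in a random step, the other is the contraction. The condition on M amounts to \<delta> = b
  + a (1 + b) < 1, and \<alpha> = ln(3 M) / (- ln \<delta>) converts accuracy \<delta>^n into cost
  (3 M)^n. On the ball of radius \<kappa> d^q the weight has order d^(p max(q, r + 1)), and r + 1 <=
  2 r + 1 gives the stated exponent.\<close>

lemma Euclidean_space_eq: "Euclidean_space d = top_of_set (Rd d)"
  unfolding topspace_Euclidean_space unfolding Euclidean_space_def euclidean_product_topology ..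

lemma Rd_iff: "x \<in> Rd d \<longleftrightarrow> (\<forall>i\<ge>d. x i = 0)"
  by (simp add: topspace_Euclidean_space)

lemma continuous_map_Euclidean_space_iff:
  "continuous_map (Euclidean_space d) euclideanreal \<phi> \<longleftrightarrow> continuous_on (Rd d) \<phi>"
  by (subst Euclidean_space_eq) (rule continuous_map_iff_continuous)

definition dotd :: "nat \<Rightarrow> (nat \<Rightarrow> real) \<Rightarrow> (nat \<Rightarrow> real) \<Rightarrow> real" where
  "dotd d k x = (\<Sum>i<d. k i * x i)"

lemma continuous_on_coordinate: "continuous_on S (\<lambda>x :: nat \<Rightarrow> real. x i)"
  by (rule continuous_on_subset[OF continuous_on_product_coordinates]) simp

lemma continuous_on_dotd: "continuous_on S (dotd d k)"
  unfolding dotd_def[abs_def]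
  by (intro continuous_on_sum continuous_on_mult continuous_on_const continuous_on_coordinate)

lemma measurable_dotd [measurable]: "dotd d k \<in> borel_measurable borel"
  by (intro borel_measurable_continuous_onI continuous_on_dotd)

text \<open>Test functions are coded as finite lists of profiles with directions: barrier, plane
  waves and constants all have this form, lists can be concatenated and scaled, and derivatives in
  several variables reduce to derivatives of the profiles.\<close>

definition ridge :: "nat \<Rightarrow> ((real \<Rightarrow> real) \<times> (nat \<Rightarrow> real)) list \<Rightarrow> (nat \<Rightarrow> real) \<Rightarrow> real" where
  "ridge d ps x = (\<Sum>(F, k)\<leftarrow>ps. F (dotd d k x))"

lemma ridge_Nil [simp]: "ridge d [] x = 0"
  and ridge_Cons [simp]: "ridge d ((F, k) # ps) x = F (dotd d k x) + ridge d ps x"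
  and ridge_append [simp]: "ridge d (ps @ qs) x = ridge d ps x + ridge d qs x"
  by (simp_all add: ridge_def)

definition twice_differentiable :: "(real \<Rightarrow> real) \<Rightarrow> bool" where
  "twice_differentiable F \<longleftrightarrow> (\<forall>t. F differentiable at t) \<and> (\<forall>t. deriv F differentiable at t)
     \<and> continuous_on UNIV (deriv (deriv F))"

definition smooth :: "((real \<Rightarrow> real) \<times> (nat \<Rightarrow> real)) list \<Rightarrow> bool" where
  "smooth ps \<longleftrightarrow> (\<forall>(F, k)\<in>set ps. twice_differentiable F)"

lemma twice_differentiableI:
  assumes "\<And>t. (F has_field_derivative F' t) (at t)" "\<And>t. (F' has_field_derivative F'' t) (at t)"
    "continuous_on UNIV F''"
  shows "twice_differentiable F" "deriv (deriv F) = F''"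
proof -
  have 1: "deriv F = F'" using assms(1) by (intro ext DERIV_imp_deriv)
  have 2: "deriv F' = F''" using assms(2) by (intro ext DERIV_imp_deriv)
  show "twice_differentiable F" "deriv (deriv F) = F''"
    using assms by (auto simp: twice_differentiable_def 1 2 real_differentiable_def)
qed

text \<open>Chain rule on the list: the factor \<open>k i\<close> goes into the profile, so that the
  result is again a ridge list and differentiation can be repeated.\<close>

definition pd_ridge :: "nat \<Rightarrow> ((real \<Rightarrow> real) \<times> (nat \<Rightarrow> real)) list \<Rightarrow> ((real \<Rightarrow> real) \<times> (nat \<Rightarrow> real)) list" where
  "pd_ridge i ps = map (\<lambda>(F, k). (\<lambda>t. k i * deriv F t, k)) ps"

lemma dotd_upd_deriv:
  assumes "i < d" shows "((\<lambda>t. dotd d k (x(i := t))) has_field_derivative k i) (at t0)"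
proof -
  have "dotd d k (x(i := t)) = k i * t + (\<Sum>j\<in>{..<d} - {i}. k j * x j)" for t
    using assms by (simp add: dotd_def sum.remove[of "{..<d}" i])
  then show ?thesis by (auto intro!: derivative_eq_intros)
qed

lemma ridge_upd_deriv:
  assumes "i < d" and "\<forall>(F, k)\<in>set ps. \<forall>t. F differentiable at t"
  shows "((\<lambda>t. ridge d ps (x(i := t))) has_field_derivative ridge d (pd_ridge i ps) (x(i := t0))) (at t0)"
  using assms(2)
proof (induction ps)
  case Nil
  then show ?case by (simp add: pd_ridge_def)
next
  case (Cons p ps)
  obtain F k where p: "p = (F, k)" by (cases p)
  have F: "(F has_field_derivative deriv F (dotd d k (x(i := t0)))) (at (dotd d k (x(i := t0))))"
    using Cons.prems by (auto simp: p DERIV_deriv_iff_real_differentiable)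
  have "((\<lambda>t. F (dotd d k (x(i := t)))) has_field_derivative deriv F (dotd d k (x(i := t0))) * k i) (at t0)"
    by (rule DERIV_chain2[OF F dotd_upd_deriv[OF assms(1)]])
  from DERIV_add[OF this Cons.IH] show ?case
    using Cons.prems by (simp add: p pd_ridge_def mult.commute fun_upd_def)
qed

lemma partial_deriv_ridge:
  assumes "i < d" and "\<forall>(F, k)\<in>set ps. \<forall>t. F differentiable at t"
  shows "partial_deriv i (ridge d ps) = ridge d (pd_ridge i ps)"
proof
  fix x
  show "partial_deriv i (ridge d ps) x = ridge d (pd_ridge i ps) x"
    using DERIV_imp_deriv[OF ridge_upd_deriv[OF assms, of x "x i"]] by (simp add: partial_deriv_def)
qed

lemma continuous_ridge:
  assumes "\<forall>(F, k)\<in>set ps. continuous_on UNIV F"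
  shows "continuous_on S (ridge d ps)"
  using assms
proof (induction ps)
  case (Cons p ps)
  obtain F k where p: "p = (F, k)" by (cases p)
  have "continuous_on S (\<lambda>x. F (dotd d k x))"
    using Cons.prems by (intro continuous_on_compose2[OF _ continuous_on_dotd subset_UNIV]) (simp add: p)
  then show ?case using Cons by (auto simp: p intro!: continuous_on_add)
qed simp

lemma C1_ridge:
  assumes "\<forall>(F, k)\<in>set ps. (\<forall>t. F differentiable at t) \<and> continuous_on UNIV (deriv F)"
  shows "C1 d (ridge d ps)"
proof -
  have d: "\<forall>(F, k)\<in>set ps. \<forall>t. F differentiable at t" using assms by auto
  have "\<forall>(F, k)\<in>set ps. continuous_on UNIV F"
    using assms by (auto intro!: continuous_at_imp_continuous_on differentiable_imp_continuous_within)
  moreover have "\<forall>(F, k)\<in>set (pd_ridge i ps). continuous_on UNIV F" for i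
    using assms by (auto simp: pd_ridge_def intro!: continuous_intros)
  moreover have "(\<lambda>t. ridge d ps (x(i := t))) differentiable at (x i)" if "i < d" for i x
    using ridge_upd_deriv[OF that d] real_differentiable_def by blast
  ultimately show ?thesis
    unfolding C1_def continuous_map_Euclidean_space_iff
    by (metis continuous_ridge partial_deriv_ridge[OF _ d])
qed

lemma deriv_cmult': "F differentiable at t \<Longrightarrow> deriv (\<lambda>s. c * F s) t = c * deriv F t" for F :: "real \<Rightarrow> real"
  by (intro DERIV_imp_deriv DERIV_cmult) (simp add: DERIV_deriv_iff_real_differentiable)

text \<open>One derivative is used up: what \<open>smooth\<close> says of second derivatives is what
  \<open>C1_ridge\<close> asks of the differentiated list.\<close>

lemma smooth_pd_ridge:
  assumes "smooth ps"
  shows "\<forall>(F, k)\<in>set (pd_ridge i ps). (\<forall>t. F differentiable at t) \<and> continuous_on UNIV (deriv F)"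
proof -
  have *: "(\<forall>t. (\<lambda>t. k i * deriv F t) differentiable at t) \<and> continuous_on UNIV (deriv (\<lambda>t. k i * deriv F t))"
    if "(F, k) \<in> set ps" for F k
  proof -
    have F: "\<And>t. deriv F differentiable at t" "continuous_on UNIV (deriv (deriv F))"
      using assms that by (auto simp: smooth_def twice_differentiable_def)
    have "deriv (\<lambda>t. k i * deriv F t) = (\<lambda>t. k i * deriv (deriv F) t)"
      using F by (intro ext deriv_cmult')
    then show ?thesis
      using F by (auto intro!: continuous_intros derivative_intros)
  qed
  show ?thesis
  proof
    fix q assume "q \<in> set (pd_ridge i ps)"
    then obtain F k where "(F, k) \<in> set ps" "q = (\<lambda>t. k i * deriv F t, k)" by (auto simp: pd_ridge_def)
    then show "case q of (F, k) \<Rightarrow> (\<forall>t. F differentiable at t) \<and> continuous_on UNIV (deriv F)"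
      using *[of F k] by simp
  qed
qed

lemma smooth_differentiable: "smooth ps \<Longrightarrow> \<forall>(F, k)\<in>set ps. \<forall>t. F differentiable at t"
  by (auto simp: smooth_def twice_differentiable_def)

lemma C2_ridge:
  assumes "smooth ps" shows "C2 d (ridge d ps)"
proof -
  have "\<forall>(F, k)\<in>set ps. (\<forall>t. F differentiable at t) \<and> continuous_on UNIV (deriv F)"
    using assms by (auto simp: smooth_def twice_differentiable_def
      intro!: continuous_at_imp_continuous_on differentiable_imp_continuous_within)
  then have 1: "C1 d (ridge d ps)" by (rule C1_ridge)
  have 2: "C1 d (partial_deriv i (ridge d ps))" if "i < d" for i
    unfolding partial_deriv_ridge[OF that smooth_differentiable[OF assms]]
    by (rule C1_ridge[OF smooth_pd_ridge[OF assms]])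
  show ?thesis unfolding C2_def using 1 2 by blast
qed

text \<open>The squared length of B^T k, that is, the quadratic form of B B^T at k.\<close>

definition qform :: "nat \<Rightarrow> (nat \<Rightarrow> nat \<Rightarrow> real) \<Rightarrow> (nat \<Rightarrow> real) \<Rightarrow> real" where
  "qform d B k = (\<Sum>l<d. (\<Sum>i<d. B i l * k i)\<^sup>2)"

lemma Hess_ridge:
  assumes "smooth ps" "i < d" "j < d"
  shows "Hess (ridge d ps) x i j = (\<Sum>(F, k)\<leftarrow>ps. k i * k j * deriv (deriv F) (dotd d k x))"
proof -
  have "\<forall>(F, k)\<in>set (pd_ridge j ps). \<forall>t. F differentiable at t"
    using smooth_pd_ridge[OF assms(1), of j] by blast
  then have "Hess (ridge d ps) x i j = ridge d (pd_ridge i (pd_ridge j ps)) x"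
    unfolding Hess_def partial_deriv_ridge[OF assms(3) smooth_differentiable[OF assms(1)]]
    by (rule fun_cong[OF partial_deriv_ridge[OF assms(2)]])
  also have "\<dots> = (\<Sum>(F, k)\<leftarrow>ps. k i * k j * deriv (deriv F) (dotd d k x))"
    using assms(1)
  proof (induction ps)
    case (Cons p ps)
    obtain F k where p: "p = (F, k)" by (cases p)
    have "deriv (\<lambda>t. k j * deriv F t) s = k j * deriv (deriv F) s" for s
      using Cons.prems by (intro deriv_cmult') (auto simp: p smooth_def twice_differentiable_def)
    then show ?case using Cons by (auto simp: p pd_ridge_def smooth_def)
  qed (simp add: pd_ridge_def)
  finally show ?thesis .
qed

text \<open>The Hessian of F(k . x) is F'' times the rank one matrix k k^T, and the trace of B B^T k
  k^T is \<open>qform d B k\<close>; the sums are interchanged until the sum over \<open>l\<close>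
  stands outside and the inner double sum is a square.\<close>

lemma half_trace_ridge:
  assumes "smooth ps"
  shows "half_trace d B (ridge d ps) x = (\<Sum>(F, k)\<leftarrow>ps. qform d B k / 2 * deriv (deriv F) (dotd d k x))"
proof -
  define H where "H qs i j = (\<Sum>(F, k)\<leftarrow>qs. k i * k j * deriv (deriv F) (dotd d k x))"
    for qs :: "((real \<Rightarrow> real) \<times> (nat \<Rightarrow> real)) list" and i j
  have "half_trace d B (ridge d ps) x =
      1 / 2 * (\<Sum>i<d. \<Sum>j<d. (\<Sum>l<d. B i l * B j l) * H ps j i)"
    using Hess_ridge[OF assms]
    by (simp add: half_trace_def mat_trace_def mat_mult_def mat_transpose_def H_def)
  also have "\<dots> = (\<Sum>(F, k)\<leftarrow>ps. qform d B k / 2 * deriv (deriv F) (dotd d k x))"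
  proof (induction ps)
    case (Cons p ps)
    obtain F k where p: "p = (F, k)" by (cases p)
    let ?D = "deriv (deriv F) (dotd d k x)"
    have "(\<Sum>i<d. \<Sum>j<d. (\<Sum>l<d. B i l * B j l) * (k j * k i * ?D)) =
        (\<Sum>i<d. \<Sum>j<d. \<Sum>l<d. ?D * ((B i l * k i) * (B j l * k j)))"
      by (intro sum.cong refl) (simp add: sum_distrib_left sum_distrib_right mult_ac)
    also have "\<dots> = (\<Sum>i<d. \<Sum>l<d. \<Sum>j<d. ?D * ((B i l * k i) * (B j l * k j)))"
      by (intro sum.cong refl sum.swap)
    also have "\<dots> = (\<Sum>l<d. \<Sum>i<d. \<Sum>j<d. ?D * ((B i l * k i) * (B j l * k j)))"
      by (rule sum.swap)
    also have "\<dots> = ?D * qform d B k"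
      unfolding qform_def power2_eq_square unfolding sum_product unfolding sum_distrib_left by (rule refl)
    finally have "(\<Sum>i<d. \<Sum>j<d. (\<Sum>l<d. B i l * B j l) * (k j * k i * ?D)) = ?D * qform d B k" .
    moreover have "(\<Sum>i<d. \<Sum>j<d. (\<Sum>l<d. B i l * B j l) * H (p # ps) j i) =
       (\<Sum>i<d. \<Sum>j<d. (\<Sum>l<d. B i l * B j l) * (k j * k i * ?D)) + (\<Sum>i<d. \<Sum>j<d. (\<Sum>l<d. B i l * B j l) * H ps j i)"
      by (simp add: H_def p distrib_left sum.distrib)
    ultimately show ?case using Cons by (simp add: p)
  qed (simp add: H_def)
  finally show ?thesis .
qed

lemma smooth_append [simp]: "smooth (ps @ qs) \<longleftrightarrow> smooth ps \<and> smooth qs"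
  and smooth_Cons [simp]: "smooth ((F, k) # ps) \<longleftrightarrow> twice_differentiable F \<and> smooth ps"
  and smooth_Nil [simp]: "smooth []"
  by (auto simp: smooth_def)

definition scale_ridge :: "real \<Rightarrow> ((real \<Rightarrow> real) \<times> (nat \<Rightarrow> real)) list \<Rightarrow> ((real \<Rightarrow> real) \<times> (nat \<Rightarrow> real)) list" where
  "scale_ridge c ps = map (\<lambda>(F, k). (\<lambda>t. c * F t, k)) ps"

lemma ridge_scale [simp]: "ridge d (scale_ridge c ps) x = c * ridge d ps x"
  by (induction ps) (auto simp: scale_ridge_def distrib_left)

lemma twice_differentiable_scale:
  assumes "twice_differentiable F"
  shows "twice_differentiable (\<lambda>t. c * F t)" "deriv (deriv (\<lambda>t. c * F t)) = (\<lambda>t. c * deriv (deriv F) t)"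
proof -
  have F: "(F has_field_derivative deriv F t) (at t)" "(deriv F has_field_derivative deriv (deriv F) t) (at t)"
    "continuous_on UNIV (deriv (deriv F))" for t
    using assms by (auto simp: twice_differentiable_def DERIV_deriv_iff_real_differentiable)
  note T = twice_differentiableI[OF DERIV_cmult[OF F(1)] DERIV_cmult[OF F(2)] continuous_on_mult_left[OF F(3)]]
  show "twice_differentiable (\<lambda>t. c * F t)" "deriv (deriv (\<lambda>t. c * F t)) = (\<lambda>t. c * deriv (deriv F) t)"
    by (rule T)+
qed

lemma smooth_scale [simp]: "smooth ps \<Longrightarrow> smooth (scale_ridge c ps)"
  by (auto simp: smooth_def scale_ridge_def intro!: twice_differentiable_scale)

lemma half_trace_scale:
  assumes "smooth ps"
  shows "half_trace d B (ridge d (scale_ridge c ps)) x = c * half_trace d B (ridge d ps) x"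
proof -
  have "(\<Sum>(F, k)\<leftarrow>scale_ridge c ps. qform d B k / 2 * deriv (deriv F) (dotd d k x)) =
     c * (\<Sum>(F, k)\<leftarrow>ps. qform d B k / 2 * deriv (deriv F) (dotd d k x))"
    using assms
    by (induction ps) (auto simp: scale_ridge_def twice_differentiable_scale(2) algebra_simps)
  then show ?thesis using assms by (simp add: half_trace_ridge)
qed

lemma half_trace_append:
  assumes "smooth ps" "smooth qs"
  shows "half_trace d B (ridge d (ps @ qs)) x = half_trace d B (ridge d ps) x + half_trace d B (ridge d qs) x"
  using assms by (simp add: half_trace_ridge)

text \<open>Constants count as ridge functions with an arbitrary direction; adding one shifts a test
  function until it touches u.\<close>

lemma half_trace_const: "half_trace d B (ridge d [(\<lambda>_. c, k)]) x = 0" "smooth [(\<lambda>_. c, k)]"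
proof -
  note D = twice_differentiableI[of "\<lambda>_. c" "\<lambda>_. 0" "\<lambda>_. 0"]
  have "twice_differentiable (\<lambda>_. c)" "deriv (deriv (\<lambda>_::real. c)) = (\<lambda>_. 0)"
    by (rule D; simp)+
  then show "half_trace d B (ridge d [(\<lambda>_. c, k)]) x = 0" "smooth [(\<lambda>_. c, k)]"
    by (simp_all add: half_trace_ridge)
qed

subsection \<open>A comparison principle for the linear equation\<close>

lemma enorm_le_sum_abs: "enorm d x \<le> (\<Sum>i<d. \<bar>x i\<bar>)"
  by (rule L2_set_le_sum_abs)

lemma coord_le_enorm: "i < d \<Longrightarrow> \<bar>x i\<bar> \<le> enorm d x"
  using member_le_L2_set[of "{..<d}" i "\<lambda>i. \<bar>x i\<bar>"] by (simp add: L2_set_def)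

lemma enorm_le_dim:
  assumes "\<And>i. i < d \<Longrightarrow> \<bar>x i\<bar> \<le> c" shows "enorm d x \<le> real d * c"
  using order_trans[OF enorm_le_sum_abs sum_bounded_above[of "{..<d}" "\<lambda>i. \<bar>x i\<bar>" c]] assms by simp

definition unitv :: "nat \<Rightarrow> nat \<Rightarrow> real" where "unitv i = (\<lambda>j. if j = i then 1 else 0)"

lemma dotd_unitv [simp]: "i < d \<Longrightarrow> dotd d (unitv i) x = x i"
  by (simp add: dotd_def unitv_def if_distrib[of "\<lambda>c. c * _"] cong: if_cong)

lemma dotd_scale: "dotd d (\<lambda>j. c * k j) x = c * dotd d k x"
  by (simp add: dotd_def sum_distrib_left mult.assoc)

lemma dotd_add: "dotd d (\<lambda>j. k j + l j) x = dotd d k x + dotd d l x"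
  by (simp add: dotd_def sum.distrib distrib_right)

lemma dotd_diff: "dotd d (\<lambda>j. k j - l j) x = dotd d k x - dotd d l x"
  by (simp add: dotd_def sum_subtractf left_diff_distrib)

text \<open>A smooth barrier: it grows exponentially in every direction, and each summand is an
  eigenfunction of the operator, with an eigenvalue that is small for small
  \<open>c\<close>.\<close>

definition psi :: "nat \<Rightarrow> real \<Rightarrow> (nat \<Rightarrow> real) \<Rightarrow> real" where
  "psi d c x = (\<Sum>i<d. cosh (c * x i))"

definition psi_list :: "nat \<Rightarrow> real \<Rightarrow> ((real \<Rightarrow> real) \<times> (nat \<Rightarrow> real)) list" where
  "psi_list d c = map (\<lambda>i. (\<lambda>t. cosh (c * t), unitv i)) [0..<d]"

lemma psi_ridge: "ridge d (psi_list d c) x = psi d c x"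
  by (simp add: ridge_def psi_list_def psi_def comp_def interv_sum_list_conv_sum_set_nat atLeast0LessThan)

lemma cosh_twice: "twice_differentiable (\<lambda>t. cosh (c * t :: real))" "deriv (deriv (\<lambda>t. cosh (c * t :: real))) = (\<lambda>t. c\<^sup>2 * cosh (c * t))"
proof -
  have 1: "((\<lambda>t. cosh (c * t)) has_field_derivative c * sinh (c * t)) (at t)" for t :: real
    by (auto intro!: derivative_eq_intros)
  have 2: "((\<lambda>t. c * sinh (c * t)) has_field_derivative c\<^sup>2 * cosh (c * t)) (at t)" for t :: real
    by (auto intro!: derivative_eq_intros simp: power2_eq_square)
  have 3: "continuous_on UNIV (\<lambda>t. c\<^sup>2 * cosh (c * t) :: real)"
    by (intro continuous_intros)
  show "twice_differentiable (\<lambda>t. cosh (c * t :: real))" "deriv (deriv (\<lambda>t. cosh (c * t :: real))) = (\<lambda>t. c\<^sup>2 * cosh (c * t))"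
    using twice_differentiableI[OF 1 2 3] by auto
qed

lemma smooth_psi: "smooth (psi_list d c)"
  by (auto simp: smooth_def psi_list_def intro: cosh_twice)

lemma qform_nonneg: "0 \<le> qform d B k" by (simp add: qform_def sum_nonneg)

lemma half_trace_psi:
  assumes "\<And>i. i < d \<Longrightarrow> c\<^sup>2 * qform d B (unitv i) \<le> lam"
  shows "half_trace d B (ridge d (psi_list d c)) x \<le> lam / 2 * psi d c x"
proof -
  have "half_trace d B (ridge d (psi_list d c)) x = (\<Sum>i<d. qform d B (unitv i) / 2 * (c\<^sup>2 * cosh (c * x i)))"
    unfolding half_trace_ridge[OF smooth_psi]
    by (simp add: psi_list_def comp_def cosh_twice interv_sum_list_conv_sum_set_nat atLeast0LessThan)
  also have "\<dots> \<le> (\<Sum>i<d. lam / 2 * cosh (c * x i))"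
  proof (intro sum_mono)
    fix i assume "i \<in> {..<d}"
    then have "(c\<^sup>2 * qform d B (unitv i)) * (cosh (c * x i) / 2) \<le> lam * (cosh (c * x i) / 2)"
      using assms by (intro mult_right_mono) (auto intro: order_trans[OF zero_le_one cosh_real_ge_1])
    then show "qform d B (unitv i) / 2 * (c\<^sup>2 * cosh (c * x i)) \<le> lam / 2 * cosh (c * x i)"
      by (simp add: algebra_simps)
  qed
  finally show ?thesis by (simp add: psi_def sum_distrib_left)
qed

lemma psi_ge_1: "d \<ge> 1 \<Longrightarrow> 1 \<le> psi d c x"
proof -
  assume "d \<ge> 1"
  then have "1 \<le> (\<Sum>i<d. 1::real)" by simp
  also have "\<dots> \<le> psi d c x" unfolding psi_def by (intro sum_mono cosh_real_ge_1)
  finally show ?thesis .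
qed

text \<open>Only the coordinate of largest modulus is kept: it is at least |x| / d, and 2 cosh t >=
  exp |t|. The factor d lost in the rate is harmless, since subexponential functions are beaten at
  every rate.\<close>

lemma psi_lower:
  assumes d: "d \<ge> 1" and c: "c > 0" shows "exp (c * enorm d x / real d) / 2 \<le> psi d c x"
proof -
  obtain i where i: "i < d" "enorm d x \<le> real d * \<bar>x i\<bar>"
  proof -
    have "finite ((\<lambda>i. \<bar>x i\<bar>) ` {..<d})" "(\<lambda>i. \<bar>x i\<bar>) ` {..<d} \<noteq> {}" using d by (auto simp: lessThan_empty_iff)
    from Max_in[OF this] obtain i where i: "i < d" "Max ((\<lambda>i. \<bar>x i\<bar>) ` {..<d}) = \<bar>x i\<bar>" by auto
    have "\<bar>x j\<bar> \<le> \<bar>x i\<bar>" if "j < d" for j using that by (subst i(2)[symmetric]) (intro Max_ge, auto)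
    from enorm_le_dim[OF this] i(1) show ?thesis by (intro that) auto
  qed
  have "exp (c * enorm d x / real d) \<le> exp (c * \<bar>x i\<bar>)"
    using i(2) d c by (simp add: divide_simps mult.left_commute mult.commute)
  also have "\<dots> \<le> exp (c * x i) + exp (- (c * x i))" by (simp add: abs_if)
  also have "\<dots> = 2 * cosh (c * x i)" by (simp add: cosh_def)
  also have "\<dots> \<le> 2 * psi d c x"
    unfolding psi_def using i(1) by (intro mult_left_mono member_le_sum) (auto intro: order_trans[OF zero_le_one cosh_real_ge_1])
  finally show ?thesis by simp
qed

text \<open>All rates \<eta> are required because the rate \<open>c\<close> of the barrier depends
  on the matrix, on the dimension and on \<open>lam\<close>.\<close>

definition subexp :: "nat \<Rightarrow> ((nat \<Rightarrow> real) \<Rightarrow> real) \<Rightarrow> bool" where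
  "subexp d h \<longleftrightarrow> (\<forall>\<eta>>0. \<exists>C. \<forall>x\<in>Rd d. \<bar>h x\<bar> \<le> C * exp (\<eta> * enorm d x))"

text \<open>The bound on h has half the rate of the barrier: with E = exp(\<eta> |x|) the barrier is
  at least E^2 / 2, while h and the constant \<open>D\<close> together are at most a multiple of
  E.\<close>

lemma exp_psi:
  assumes h: "\<And>x. x \<in> Rd d \<Longrightarrow> \<bar>h x\<bar> \<le> C * exp (c / (2 * real d) * enorm d x)" and d: "d \<ge> 1" and c: "c > 0" and \<epsilon>: "\<epsilon> > 0"
  obtains N where "N > 0" "\<And>x. x \<in> Rd d \<Longrightarrow> N < enorm d x \<Longrightarrow> \<bar>h x\<bar> + D \<le> \<epsilon> * psi d c x"
proof -
  define \<eta> where "\<eta> = c / (2 * real d)"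
  have \<eta>: "\<eta> > 0" using c d by (simp add: \<eta>_def)
  have C: "\<bar>h x\<bar> \<le> C * exp (\<eta> * enorm d x)" if "x \<in> Rd d" for x
    using h[OF that] by (simp add: \<eta>_def)
  \<comment> \<open>Chosen such that \<eta> N = 2 (|C| + |D| + 1) / \<epsilon>; since E >= \<eta>
    |x|, one factor E absorbs the constants beyond radius N.\<close>
  define N where "N = 2 * (\<bar>C\<bar> + \<bar>D\<bar> + 1) / (\<epsilon> * \<eta>)"
  have N: "N > 0" using \<epsilon> \<eta> by (simp add: N_def)
  have "\<bar>h x\<bar> + D \<le> \<epsilon> * psi d c x" if x: "x \<in> Rd d" "N < enorm d x" for x
  proof -
    define E where "E = exp (\<eta> * enorm d x)"
    have "\<eta> * N \<le> \<eta> * enorm d x" using x \<eta> by simp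
    also have "\<dots> \<le> E" unfolding E_def using exp_ge_add_one_self[of "\<eta> * enorm d x"] by linarith
    finally have "\<eta> * N \<le> E" .
    moreover have "\<eta> * N = 2 * (\<bar>C\<bar> + \<bar>D\<bar> + 1) / \<epsilon>" using \<eta> by (simp add: N_def)
    ultimately have "2 * (\<bar>C\<bar> + \<bar>D\<bar> + 1) \<le> E * \<epsilon>" using \<epsilon> by (simp add: pos_divide_le_eq)
    then have "\<bar>C\<bar> + \<bar>D\<bar> \<le> \<epsilon> / 2 * E" by (simp add: mult.commute)
    moreover have E1: "1 \<le> E" using \<eta> by (simp add: E_def)
    ultimately have "(\<bar>C\<bar> + \<bar>D\<bar>) * E \<le> \<epsilon> / 2 * E * E" by (intro mult_right_mono) auto
    moreover have "\<bar>h x\<bar> + D \<le> (\<bar>C\<bar> + \<bar>D\<bar>) * E"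
    proof -
      have "C * E \<le> \<bar>C\<bar> * E" using E1 by (intro mult_right_mono) auto
      then have "\<bar>h x\<bar> \<le> \<bar>C\<bar> * E" using C[OF x(1)] unfolding E_def by linarith
      moreover have "D \<le> \<bar>D\<bar> * E" using mult_left_mono[OF E1, of "\<bar>D\<bar>"] by simp
      ultimately show ?thesis by (simp add: distrib_right)
    qed
    moreover have "\<epsilon> / 2 * E * E \<le> \<epsilon> * psi d c x"
    proof -
      have "E * E = exp (c * enorm d x / real d)" using d by (simp add: E_def \<eta>_def exp_add[symmetric] field_simps)
      then have "E * E / 2 \<le> psi d c x" using psi_lower[OF d c, of x] by simp
      from mult_left_mono[OF this, of \<epsilon>] \<epsilon> show ?thesis by simp
    qed
    ultimately show ?thesis by linarith
  qed
  with N show ?thesis by (rule that)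
qed

lemma subexp_psi:
  assumes h: "subexp d h" and d: "d \<ge> 1" and c: "c > 0" and \<epsilon>: "\<epsilon> > 0"
  obtains N where "N > 0" "\<And>x. x \<in> Rd d \<Longrightarrow> N < enorm d x \<Longrightarrow> \<bar>h x\<bar> + D \<le> \<epsilon> * psi d c x"
proof -
  have "c / (2 * real d) > 0" using c d by simp
  then obtain C where "\<And>x. x \<in> Rd d \<Longrightarrow> \<bar>h x\<bar> \<le> C * exp (c / (2 * real d) * enorm d x)"
    using h unfolding subexp_def by blast
  from exp_psi[OF this d c \<epsilon>] that show ?thesis by blast
qed

text \<open>In the ambient product the box is a product of intervals and, from index d on, of
  singletons {0}, so Tychonoff's theorem applies.\<close>

lemma compact_box: "compact {x \<in> Rd d. \<forall>i<d. \<bar>x i\<bar> \<le> N}"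
proof -
  have "compact (PiE UNIV (\<lambda>i. if i < d then {-N..N} else {0::real}))"
    using compactin_PiE[of "\<lambda>_. euclidean" UNIV "\<lambda>i. if i < d then {-N..N} else {0::real}"]
    by (auto simp: euclidean_product_topology)
  moreover have "x \<in> PiE UNIV (\<lambda>i. if i < d then {-N..N} else {0::real}) \<longleftrightarrow> x \<in> {x \<in> Rd d. \<forall>i<d. \<bar>x i\<bar> \<le> N}" for x
  proof
    assume "x \<in> PiE UNIV (\<lambda>i. if i < d then {-N..N} else {0::real})"
    then have x: "x i \<in> (if i < d then {-N..N} else {0})" for i
      by (rule PiE_mem[OF _ UNIV_I])
    have "x i = 0" if "i \<ge> d" for i using x[of i] that by simp
    moreover have "\<bar>x i\<bar> \<le> N" if "i < d" for i using x[of i] that by (simp add: abs_le_iff)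
    ultimately show "x \<in> {x \<in> Rd d. \<forall>i<d. \<bar>x i\<bar> \<le> N}" by (simp add: Rd_iff)
  next
    assume "x \<in> {x \<in> Rd d. \<forall>i<d. \<bar>x i\<bar> \<le> N}"
    then show "x \<in> PiE UNIV (\<lambda>i. if i < d then {-N..N} else {0::real})"
      by (auto simp: Rd_iff abs_le_iff minus_le_iff)
  qed
  ultimately show ?thesis by (metis (no_types, lifting) set_eqI)
qed

text \<open>Compactness gives a maximum on the box; beyond it the value at the origin, itself a
  point of the box, dominates.\<close>

lemma attains_max:
  fixes F :: "(nat \<Rightarrow> real) \<Rightarrow> real"
  assumes F: "continuous_on (Rd d) F" and N: "0 \<le> N"
    and out: "\<And>x. x \<in> Rd d \<Longrightarrow> N < enorm d x \<Longrightarrow> F x \<le> F (\<lambda>_. 0)"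
  obtains x0 where "x0 \<in> Rd d" "\<And>y. y \<in> Rd d \<Longrightarrow> F y \<le> F x0"
proof -
  let ?Q = "{x \<in> Rd d. \<forall>i<d. \<bar>x i\<bar> \<le> N}"
  have 0: "(\<lambda>_. 0) \<in> ?Q" using N by (simp add: Rd_iff)
  have "continuous_on ?Q F" by (rule continuous_on_subset[OF F]) auto
  from continuous_attains_sup[OF compact_box _ this] 0
  obtain x0 where x0: "x0 \<in> ?Q" "\<forall>y\<in>?Q. F y \<le> F x0" by blast
  have "F y \<le> F x0" if y: "y \<in> Rd d" for y
  proof (cases "\<forall>i<d. \<bar>y i\<bar> \<le> N")
    case False
    then obtain i where "i < d" "N < \<bar>y i\<bar>" by auto
    then have "N < enorm d y" using coord_le_enorm[of i d y] by simp
    then have "F y \<le> F (\<lambda>_. 0)" by (rule out[OF y])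
    also have "\<dots> \<le> F x0" using x0 0 by blast
    finally show ?thesis .
  qed (use x0 y in blast)
  then show ?thesis using x0(1) that by blast
qed

section \<open>Plane waves and the comparison argument\<close>

definition wave :: "real \<times> (nat \<Rightarrow> real) \<times> real \<Rightarrow> (real \<Rightarrow> real) \<times> (nat \<Rightarrow> real)" where
  "wave = (\<lambda>(c, k, \<theta>). (\<lambda>t. c * cos (t + \<theta>), k))"

abbreviation tpoly :: "nat \<Rightarrow> (real \<times> (nat \<Rightarrow> real) \<times> real) list \<Rightarrow> (nat \<Rightarrow> real) \<Rightarrow> real" where
  "tpoly d ps \<equiv> ridge d (map wave ps)"

lemma ridge_wave_Cons [simp]: "ridge d (wave (c, k, \<theta>) # qs) x = c * cos (dotd d k x + \<theta>) + ridge d qs x"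
  by (simp add: wave_def)

lemma wave_twice: "twice_differentiable (\<lambda>t. c * cos (t + \<theta>))" "deriv (deriv (\<lambda>t. c * cos (t + \<theta>))) = (\<lambda>t. - (c * cos (t + \<theta>)))"
proof -
  have 1: "((\<lambda>t. c * cos (t + \<theta>)) has_field_derivative - (c * sin (t + \<theta>))) (at t)" for t :: real
    by (auto intro!: derivative_eq_intros)
  have 2: "((\<lambda>t. - (c * sin (t + \<theta>))) has_field_derivative - (c * cos (t + \<theta>))) (at t)" for t :: real
    by (auto intro!: derivative_eq_intros)
  have 3: "continuous_on UNIV (\<lambda>t. - (c * cos (t + \<theta>)))"
    by (intro continuous_intros)
  show "twice_differentiable (\<lambda>t. c * cos (t + \<theta>))" "deriv (deriv (\<lambda>t. c * cos (t + \<theta>))) = (\<lambda>t. - (c * cos (t + \<theta>)))"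
    using twice_differentiableI[OF 1 2 3] by auto
qed

lemma smooth_waves: "smooth (map wave ps)"
  by (auto simp: smooth_def wave_def intro: wave_twice)

lemma tpoly_bounded: "\<bar>tpoly d ps x\<bar> \<le> (\<Sum>(c, k, \<theta>)\<leftarrow>ps. \<bar>c\<bar>)"
proof (induction ps)
  case (Cons p ps)
  obtain c k \<theta> where p: "p = (c, k, \<theta>)" by (cases p)
  have "\<bar>c * cos (dotd d k x + \<theta>)\<bar> \<le> \<bar>c\<bar>" using mult_left_mono[OF abs_cos_le_one, of "\<bar>c\<bar>"] by (simp add: abs_mult)
  with Cons show ?case using abs_triangle_ineq[of "c * cos (dotd d k x + \<theta>)" "tpoly d ps x"] by (simp add: p)
qed simp

text \<open>Inverts \<open>\<lambda> - \<onehalf> Trace(B B\<^sup>* Hess)\<close> on plane waves, coefficient by coefficient.\<close>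

definition resolve :: "nat \<Rightarrow> (nat \<Rightarrow> nat \<Rightarrow> real) \<Rightarrow> real \<Rightarrow> (real \<times> (nat \<Rightarrow> real) \<times> real) list \<Rightarrow> (real \<times> (nat \<Rightarrow> real) \<times> real) list" where
  "resolve d B lam ps = map (\<lambda>(c, k, \<theta>). (c / (lam + qform d B k / 2), k, \<theta>)) ps"

lemma half_trace_resolve:
  assumes "lam > 0"
  shows "half_trace d B (tpoly d (resolve d B lam ps)) x = lam * tpoly d (resolve d B lam ps) x - tpoly d ps x"
  unfolding half_trace_ridge[OF smooth_waves]
proof (induction ps)
  case (Cons p ps)
  obtain c k \<theta> where p: "p = (c, k, \<theta>)" by (cases p)
  define c' where "c' = c / (lam + qform d B k / 2)"
  have "lam + qform d B k / 2 > 0" using assms qform_nonneg[of d B k] by simp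
  then have c: "c = c' * (lam + qform d B k / 2)" by (simp add: c'_def)
  have r: "resolve d B lam (p # ps) = (c', k, \<theta>) # resolve d B lam ps" by (simp add: resolve_def p c'_def)
  show ?case unfolding r using Cons
    by (simp add: p wave_def wave_twice) (subst c, simp add: algebra_simps)
qed (simp add: resolve_def)

text \<open>\<open>psi\<close> is a strict supersolution that outgrows subexponential functions, so that the difference of \<open>u\<close>
  and the test function attains its maximum.\<close>

lemma comparison:
  assumes d: "d \<ge> 1" and lam: "lam > 0" and c: "c > 0" and \<epsilon>: "\<epsilon> > 0"
    and cB: "\<And>i. i < d \<Longrightarrow> c\<^sup>2 * qform d B (unitv i) \<le> lam"
    and ucont: "continuous_on (Rd d) u" and u: "subexp d u"
    and sub: "\<And>x qs. x \<in> Rd d \<Longrightarrow> smooth qs \<Longrightarrow> ridge d qs x = u x \<Longrightarrow> (\<forall>y\<in>Rd d. u y \<le> ridge d qs y) \<Longrightarrow>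
        lam * u x - h x \<le> half_trace d B (ridge d qs) x"
    and approx: "\<And>x. x \<in> Rd d \<Longrightarrow> \<bar>h x - tpoly d ps x\<bar> \<le> \<epsilon> * psi d c x"
    and x: "x \<in> Rd d"
  shows "u x \<le> tpoly d (resolve d B lam ps) x + 2 / lam * \<epsilon> * psi d c x"
proof -
  let ?vs = "map wave (resolve d B lam ps)"
  let ?v = "ridge d ?vs"
  \<comment> \<open>The operator applied to the barrier costs only \<open>lam / 2\<close> times the
    barrier, so half of \<open>lam * K\<close> is left over; this half equals the approximation
    error \<epsilon>.\<close>
  define K where "K = 2 / lam * \<epsilon>"
  have K: "K > 0" using lam \<epsilon> by (simp add: K_def)
  define F where "F y = u y - ?v y - K * psi d c y" for y
  define C where "C = (\<Sum>(c, k, \<theta>)\<leftarrow>resolve d B lam ps. \<bar>c\<bar>)"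
  have C: "\<bar>?v y\<bar> \<le> C" for y unfolding C_def by (rule tpoly_bounded)
  have cont_ridge: "continuous_on (Rd d) (ridge d qs)" if "smooth qs" for qs
    using C2_ridge[OF that, of d] by (simp add: C2_def C1_def continuous_map_Euclidean_space_iff)
  have "continuous_on (Rd d) (\<lambda>y. u y - ?v y - K * ridge d (psi_list d c) y)"
    by (intro continuous_on_diff ucont continuous_on_mult continuous_on_const cont_ridge smooth_waves smooth_psi)
  then have Fc: "continuous_on (Rd d) F" by (simp add: F_def[abs_def] psi_ridge)
  obtain N where N: "N > 0" "\<And>x. x \<in> Rd d \<Longrightarrow> N < enorm d x \<Longrightarrow> \<bar>u x\<bar> + (C - F (\<lambda>_. 0)) \<le> K * psi d c x"
    using subexp_psi[OF u d c K, of "C - F (\<lambda>_. 0)"] by metis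
  have "F y \<le> F (\<lambda>_. 0)" if "y \<in> Rd d" "N < enorm d y" for y
    using N(2)[OF that] C[of y] unfolding F_def[of y] by linarith
  with attains_max[OF Fc, of N] N(1) obtain x0 where x0: "x0 \<in> Rd d" "\<And>y. y \<in> Rd d \<Longrightarrow> F y \<le> F x0"
    by (metis less_imp_le)
  have "F x0 \<le> 0"
  proof -
    let ?ps = "scale_ridge K (psi_list d c)"
    \<comment> \<open>The constant \<open>F x0\<close> shifts the function so that it touches u at
      \<open>x0\<close>; maximality of \<open>F\<close> at \<open>x0\<close> keeps it above u
      elsewhere.\<close>
    let ?qs = "(?vs @ ?ps) @ [(\<lambda>_. F x0, \<lambda>_. 0)]"
    have s: "smooth ?vs" "smooth ?ps" "smooth [(\<lambda>_. F x0, \<lambda>_. 0)]" by (rule smooth_waves, rule smooth_scale[OF smooth_psi], rule half_trace_const)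
    have q: "ridge d ?qs y = ?v y + K * psi d c y + F x0" for y by (simp add: psi_ridge)
    have "lam * u x0 - h x0 \<le> half_trace d B (ridge d ?qs) x0"
    proof (rule sub[OF x0(1)])
      show "smooth ?qs" using s by simp
      show "ridge d ?qs x0 = u x0" unfolding q by (simp add: F_def)
      show "\<forall>y\<in>Rd d. u y \<le> ridge d ?qs y"
      proof
        fix y assume "y \<in> Rd d"
        from x0(2)[OF this] show "u y \<le> ridge d ?qs y" unfolding q by (simp add: F_def)
      qed
    qed
    also have "half_trace d B (ridge d ?qs) x0 = half_trace d B ?v x0 + K * half_trace d B (ridge d (psi_list d c)) x0"
      using s by (simp only: half_trace_append half_trace_scale[OF smooth_psi] half_trace_const smooth_append)
    also have "\<dots> \<le> lam * ?v x0 - tpoly d ps x0 + K * (lam / 2 * psi d c x0)"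
      using K unfolding half_trace_resolve[OF lam] by (intro add_left_mono mult_left_mono half_trace_psi cB) auto
    finally have "lam * u x0 - lam * ?v x0 \<le> h x0 - tpoly d ps x0 + K * (lam / 2 * psi d c x0)" by simp
    also have "\<dots> \<le> \<epsilon> * psi d c x0 + K * (lam / 2 * psi d c x0)" using approx[OF x0(1)] by simp
    also have "\<dots> = lam * (K * psi d c x0)" using lam by (simp add: K_def)
    finally have "lam * F x0 \<le> 0" by (simp add: F_def algebra_simps)
    then show ?thesis using lam by (simp add: mult_le_0_iff)
  qed
  with x0(2)[OF x] show ?thesis by (simp add: F_def K_def)
qed

text \<open>The product formula for cosines. Thanks to the phases, cosines alone include the sines,
  and trigonometric polynomials form an algebra, as the Stone-Weierstrass theorem asks.\<close>

definition wave_mult :: "real \<times> (nat \<Rightarrow> real) \<times> real \<Rightarrow> (real \<times> (nat \<Rightarrow> real) \<times> real) list \<Rightarrow> (real \<times> (nat \<Rightarrow> real) \<times> real) list" where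
  "wave_mult = (\<lambda>(c, k, \<theta>) qs. concat (map (\<lambda>(c', k', \<theta>').
     [(c * c' / 2, \<lambda>j. k j + k' j, \<theta> + \<theta>'), (c * c' / 2, \<lambda>j. k j - k' j, \<theta> - \<theta>')]) qs))"

lemma tpoly_wave_mult: "tpoly d (wave_mult (c, k, \<theta>) qs) x = c * cos (dotd d k x + \<theta>) * tpoly d qs x"
proof (induction qs)
  case (Cons q qs)
  obtain c' k' \<theta>' where q: "q = (c', k', \<theta>')" by (cases q)
  let ?a = "dotd d k x + \<theta>" and ?b = "dotd d k' x + \<theta>'"
  have gen: "c * c' / 2 * S + c * c' / 2 * D = c * c' * ((D + S) / 2)" for S D by (simp add: field_simps)
  have *: "c * c' / 2 * cos (?a + ?b) + c * c' / 2 * cos (?a - ?b) = (c * cos ?a) * (c' * cos ?b)"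
    unfolding gen cos_times_cos[symmetric] by (simp only: mult_ac)
  have "tpoly d (wave_mult (c, k, \<theta>) (q # qs)) x =
      c * c' / 2 * cos (?a + ?b) + c * c' / 2 * cos (?a - ?b) + tpoly d (wave_mult (c, k, \<theta>) qs) x"
    by (simp add: wave_mult_def q dotd_add dotd_diff add.assoc add.left_commute[of \<theta>] add_diff_add)
  also have "\<dots> = c * cos ?a * tpoly d (q # qs) x"
    unfolding * Cons.IH by (simp add: q distrib_left)
  finally show ?case .
qed (simp add: wave_mult_def)

definition tmult :: "(real \<times> (nat \<Rightarrow> real) \<times> real) list \<Rightarrow> (real \<times> (nat \<Rightarrow> real) \<times> real) list \<Rightarrow> (real \<times> (nat \<Rightarrow> real) \<times> real) list" where
  "tmult ps qs = concat (map (\<lambda>p. wave_mult p qs) ps)"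

lemma tpoly_tmult: "tpoly d (tmult ps qs) x = tpoly d ps x * tpoly d qs x"
proof (induction ps)
  case (Cons p ps)
  obtain c k \<theta> where p: "p = (c, k, \<theta>)" by (cases p)
  show ?case using Cons tpoly_wave_mult[of d c k \<theta> qs x] by (simp add: tmult_def p distrib_right)
qed (simp add: tmult_def)

text \<open>Reflecting \<open>\<real>\<^sup>d\<close> into the box \<open>[-N, N]\<^sup>d\<close>: a trigonometric polynomial that is invariant under the
  reflection takes outside of the box only values that it takes inside.\<close>

definition fold_box :: "nat \<Rightarrow> real \<Rightarrow> (nat \<Rightarrow> real) \<Rightarrow> nat \<Rightarrow> real" where
  "fold_box d N x = (\<lambda>i. if i < d then arccos (cos (pi / (2 * N) * (x i + N))) / (pi / (2 * N)) - N else 0)"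

lemma fold_box_in:
  assumes "N > 0" shows "fold_box d N x \<in> {x \<in> Rd d. \<forall>i<d. \<bar>x i\<bar> \<le> N}"
proof -
  have "\<bar>arccos (cos t) / (pi / (2 * N)) - N\<bar> \<le> N" for t
  proof -
    have "arccos (cos t) / (pi / (2 * N)) \<le> pi / (pi / (2 * N))"
      using assms arccos_ubound[of "cos t"] by (intro divide_right_mono) auto
    moreover have "pi / (pi / (2 * N)) = 2 * N" using assms by simp
    moreover have "0 \<le> arccos (cos t) / (pi / (2 * N))" using assms arccos_lbound[of "cos t"] by simp
    ultimately show ?thesis by (simp only: abs_le_iff) linarith
  qed
  then show ?thesis by (simp add: fold_box_def Rd_iff)
qed

text \<open>Stone-Weierstrass on a box gives accuracy \<epsilon> there. Outside, the polynomial
  repeats a value from the box, so it is of the size of h at the folded point; a box large enough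
  makes \<epsilon> \<open>psi\<close> exceed both contributions.\<close>

lemma trig_approx:
  assumes d: "d \<ge> 1" and c: "c > 0" and \<epsilon>: "\<epsilon> > 0" and h: "continuous_on (Rd d) h" "subexp d h"
  shows "\<exists>ps. \<forall>x\<in>Rd d. \<bar>h x - tpoly d ps x\<bar> \<le> \<epsilon> * psi d c x"
proof -
  \<comment> \<open>Folding may lead to a point of norm up to d N, hence up to d |x|; the second
    factor d in the denominator makes \<eta> d the rate c / (2 d) that \<open>exp_psi\<close> can
    handle.\<close>
  define \<eta> where "\<eta> = c / (2 * real d * real d)"
  have \<eta>: "\<eta> > 0" using c d by (simp add: \<eta>_def)
  have \<eta>d: "\<eta> * real d = c / (2 * real d)" using d by (simp add: \<eta>_def)
  obtain C0 where C0: "\<And>x. x \<in> Rd d \<Longrightarrow> \<bar>h x\<bar> \<le> C0 * exp (\<eta> * enorm d x)"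
    using h(2) \<eta> unfolding subexp_def by blast
  define C where "C = \<bar>C0\<bar>"
  have C: "\<bar>h x\<bar> \<le> C * exp (\<eta> * enorm d x)" "C \<ge> 0" if "x \<in> Rd d" for x
  proof -
    have "C0 * exp (\<eta> * enorm d x) \<le> C * exp (\<eta> * enorm d x)" by (intro mult_right_mono) (auto simp: C_def)
    then show "\<bar>h x\<bar> \<le> C * exp (\<eta> * enorm d x)" using C0[OF that] by linarith
    show "C \<ge> 0" by (simp add: C_def)
  qed
  \<comment> \<open>Dominates |h| at x plus |h| at the folded point; the additive \<epsilon> below
    accounts for the approximation error inside the box.\<close>
  define H where "H x = 2 * C * exp (c / (2 * real d) * enorm d x)" for x
  have "\<bar>H x\<bar> \<le> (2 * C) * exp (c / (2 * real d) * enorm d x)" for x by (simp add: H_def C_def)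
  from exp_psi[where D=\<epsilon>, OF this d c \<epsilon>]
  obtain N where N: "N > 0" "\<And>x. x \<in> Rd d \<Longrightarrow> N < enorm d x \<Longrightarrow> \<bar>H x\<bar> + \<epsilon> \<le> \<epsilon> * psi d c x"
    by blast
  define \<omega> where "\<omega> = pi / (2 * N)"
  have \<omega>: "\<omega> > 0" using N by (simp add: \<omega>_def)
  let ?Q = "{x \<in> Rd d. \<forall>i<d. \<bar>x i\<bar> \<le> N}"
  define P where "P r \<longleftrightarrow> (\<exists>ps. \<forall>x. r x = tpoly d ps x) \<and> (\<forall>x. r (fold_box d N x) = r x)" for r :: "(nat \<Rightarrow> real) \<Rightarrow> real"
  have "\<exists>r. P r \<and> (\<forall>x\<in>?Q. \<bar>h x - r x\<bar> < \<epsilon>)"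
  proof (rule Stone_Weierstrass_HOL[OF compact_box])
    show "P (\<lambda>x. a)" for a
    proof -
      have "tpoly d [(a, \<lambda>_. 0, 0)] x = a" for x by (simp add: dotd_def)
      then show ?thesis unfolding P_def by metis
    qed
    show "continuous_on ?Q r" if r: "P r" for r
    proof -
      obtain ps where "\<forall>x. r x = tpoly d ps x" using r unfolding P_def by blast
      then have "r = tpoly d ps" by auto
      moreover have "continuous_on (Rd d) (tpoly d ps)"
        using C2_ridge[OF smooth_waves, of d ps] by (simp add: C2_def C1_def continuous_map_Euclidean_space_iff)
      ultimately show ?thesis by (auto intro: continuous_on_subset)
    qed
    show "P (\<lambda>x. r1 x + r2 x)" if r: "P r1 \<and> P r2" for r1 r2
    proof -
      obtain ps qs where "\<And>x. r1 x = tpoly d ps x" "\<And>x. r2 x = tpoly d qs x" using r unfolding P_def by blast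
      then have "\<forall>x. r1 x + r2 x = tpoly d (ps @ qs) x" by simp
      then show ?thesis using r unfolding P_def by (metis (no_types))
    qed
    show "P (\<lambda>x. r1 x * r2 x)" if r: "P r1 \<and> P r2" for r1 r2
    proof -
      obtain ps qs where "\<And>x. r1 x = tpoly d ps x" "\<And>x. r2 x = tpoly d qs x" using r unfolding P_def by blast
      then have "\<forall>x. r1 x * r2 x = tpoly d (tmult ps qs) x" by (simp add: tpoly_tmult)
      then show ?thesis using r unfolding P_def by (metis (no_types))
    qed
    show "\<exists>r. P r \<and> r x \<noteq> r y" if xy: "x \<in> ?Q \<and> y \<in> ?Q \<and> x \<noteq> y" for x y
    proof -
      obtain i where i: "x i \<noteq> y i" using xy ext[of x y] by blast
      have id: "i < d"
      proof (rule ccontr)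
        assume "\<not> i < d"
        then have "x i = 0" "y i = 0" using xy by (auto simp: Rd_iff)
        then show False using i by simp
      qed
      \<comment> \<open>On [-N, N] the argument of the cosine runs through [0, pi], where the cosine
        is injective, so these waves separate points. They are invariant because folding applies
        \<open>arccos\<close> to this very cosine.\<close>
      let ?r = "\<lambda>x :: nat \<Rightarrow> real. cos (\<omega> * (x i + N))"
      have "\<forall>x. ?r x = tpoly d [(1, \<lambda>j. \<omega> * unitv i j, \<omega> * N)] x"
        using id by (simp add: dotd_scale distrib_left)
      moreover have "?r (fold_box d N x) = ?r x" for x
        using id \<omega> by (simp add: fold_box_def \<omega>_def[symmetric])
      ultimately have "P ?r" unfolding P_def by blast
      moreover have "?r x \<noteq> ?r y"
      proof
        assume eq: "?r x = ?r y"
        have b: "0 \<le> \<omega> * (z i + N)" "\<omega> * (z i + N) \<le> pi" if "z \<in> ?Q" for z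
        proof -
          have z: "- N \<le> z i" "z i \<le> N" using that id by (auto simp: abs_le_iff)
          show "0 \<le> \<omega> * (z i + N)" using z \<omega> by simp
          have "\<omega> * (z i + N) \<le> \<omega> * (2 * N)" using z \<omega> by (intro mult_left_mono) auto
          then show "\<omega> * (z i + N) \<le> pi" using N by (simp add: \<omega>_def)
        qed
        have "\<omega> * (x i + N) = \<omega> * (y i + N)"
          by (rule cos_inj_pi[OF b(1)[of x] b(2)[of x] b(1)[of y] b(2)[of y] eq]) (use xy in blast)+
        then show False using i \<omega> by simp
      qed
      ultimately show ?thesis by blast
    qed
    show "continuous_on ?Q h" by (rule continuous_on_subset[OF h(1)]) auto
  qed (rule \<epsilon>)
  then obtain r where r: "P r" "\<And>x. x \<in> ?Q \<Longrightarrow> \<bar>h x - r x\<bar> < \<epsilon>" by blast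
  then obtain ps where ps: "\<And>x. r x = tpoly d ps x" unfolding P_def by blast
  have "\<bar>h x - r x\<bar> \<le> \<epsilon> * psi d c x" if x: "x \<in> Rd d" for x
  proof (cases "x \<in> ?Q")
    case True
    have "\<epsilon> \<le> \<epsilon> * psi d c x" using mult_left_mono[OF psi_ge_1[OF d, of c x], of \<epsilon>] \<epsilon> by simp
    with r(2)[OF True] show ?thesis by linarith
  next
    case False
    then obtain i where "i < d" "N < \<bar>x i\<bar>" using x by auto
    then have Nx: "N < enorm d x" using coord_le_enorm[of i d x] by simp
    let ?y = "fold_box d N x"
    have y: "?y \<in> ?Q" by (rule fold_box_in[OF N(1)])
    have "enorm d ?y \<le> real d * N" using y by (intro enorm_le_dim) auto
    also have "\<dots> \<le> real d * enorm d x" using Nx by (intro mult_left_mono) auto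
    finally have "\<eta> * enorm d ?y \<le> \<eta> * (real d * enorm d x)" using \<eta> by simp
    also have "\<dots> = c / (2 * real d) * enorm d x" unfolding mult.assoc[symmetric] \<eta>d ..
    finally have ny: "exp (\<eta> * enorm d ?y) \<le> exp (c / (2 * real d) * enorm d x)" by simp
    have "\<eta> * enorm d x * 1 \<le> \<eta> * enorm d x * real d" using \<eta> d by (intro mult_left_mono) auto
    also have "\<dots> = c / (2 * real d) * enorm d x" unfolding \<eta>d[symmetric] by (simp only: mult_ac)
    finally have nx: "exp (\<eta> * enorm d x) \<le> exp (c / (2 * real d) * enorm d x)" by simp
    have "\<bar>h x\<bar> \<le> C * exp (c / (2 * real d) * enorm d x)"
      using C[OF x] mult_left_mono[OF nx, of C] by linarith
    moreover have "\<bar>h ?y\<bar> \<le> C * exp (c / (2 * real d) * enorm d x)"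
      using C[of ?y] y mult_left_mono[OF ny, of C] by fastforce
    moreover have "r x = r ?y" using r(1) unfolding P_def by simp
    moreover have "\<bar>h ?y - r ?y\<bar> < \<epsilon>" by (rule r(2)[OF y])
    ultimately have "\<bar>h x - r x\<bar> \<le> H x + \<epsilon>" unfolding H_def by linarith
    also have "\<dots> \<le> \<epsilon> * psi d c x" using N(2)[OF x Nx] by linarith
    finally show ?thesis .
  qed
  then show ?thesis unfolding ps by blast
qed

subsection \<open>The Feynman-Kac representation\<close>

definition sqd :: "nat \<Rightarrow> (nat \<Rightarrow> real) \<Rightarrow> real" where "sqd d \<kappa> = (\<Sum>l<d. (\<kappa> l)\<^sup>2)"

definition matT :: "nat \<Rightarrow> (nat \<Rightarrow> nat \<Rightarrow> real) \<Rightarrow> (nat \<Rightarrow> real) \<Rightarrow> nat \<Rightarrow> real" where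
  "matT d B k l = (\<Sum>i<d. B i l * k i)"

lemma qform_sqd: "qform d B k = sqd d (matT d B k)"
  by (simp add: qform_def sqd_def matT_def)

text \<open>The point \<open>shift_pt\<close> with the random Brownian value replaced by a variable
  \<open>z\<close>: the step becomes a deterministic map of two arguments.\<close>

definition move :: "nat \<Rightarrow> (nat \<Rightarrow> nat \<Rightarrow> real) \<Rightarrow> (nat \<Rightarrow> real) \<Rightarrow> (nat \<Rightarrow> real) \<Rightarrow> nat \<Rightarrow> real" where
  "move d B x z = (\<lambda>i. x i + mat_vec d B z i)"

lemma move_Rd: "x \<in> Rd d \<Longrightarrow> move d B x z \<in> Rd d"
  by (simp add: Rd_iff move_def mat_vec_def)

text \<open>A ridge function along the step sees the noise only through its scalar product with B^T
  k; this is why transforms of scalar products determine all averages below.\<close>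

lemma dotd_move: "dotd d k (move d B x z) = dotd d k x + dotd d (matT d B k) z"
proof -
  have "(\<Sum>i<d. k i * mat_vec d B z i) = (\<Sum>i<d. \<Sum>l<d. k i * (B i l * z l))"
    by (simp add: mat_vec_def sum_distrib_left)
  also have "\<dots> = (\<Sum>l<d. \<Sum>i<d. k i * (B i l * z l))" by (rule sum.swap)
  also have "\<dots> = dotd d (matT d B k) z"
    unfolding dotd_def matT_def sum_distrib_right by (intro sum.cong refl) (simp only: mult_ac)
  finally show ?thesis by (simp add: dotd_def move_def distrib_left sum.distrib)
qed

lemma continuous_on_move: "continuous_on UNIV (\<lambda>(x, z). move d B x z)"
proof (rule continuous_on_coordinatewise_then_product)
  fix i
  have c: "continuous_on UNIV (\<lambda>p :: (nat \<Rightarrow> real) \<times> (nat \<Rightarrow> real). fst p j)"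
    "continuous_on UNIV (\<lambda>p :: (nat \<Rightarrow> real) \<times> (nat \<Rightarrow> real). snd p j)" for j
    by (rule continuous_on_compose2[OF continuous_on_coordinate[of UNIV] _ subset_UNIV],
        intro continuous_intros)+
  have "continuous_on UNIV (\<lambda>p :: (nat \<Rightarrow> real) \<times> (nat \<Rightarrow> real). fst p i + (if i < d then \<Sum>j<d. B i j * snd p j else 0))"
    by (cases "i < d") (auto intro!: continuous_on_add continuous_on_sum continuous_on_mult continuous_on_const c)
  then show "continuous_on UNIV (\<lambda>p. (case p of (x, z) \<Rightarrow> move d B x z) i)"
    by (simp add: move_def mat_vec_def case_prod_beta')
qed

lemma move_measurable: "(\<lambda>(x, z). move d B x z) \<in> borel \<Otimes>\<^sub>M borel \<rightarrow>\<^sub>M borel"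
  using borel_measurable_continuous_onI[OF continuous_on_move] by (simp add: borel_prod)

text \<open>The law of a standard Brownian motion in \<open>\<real>\<^sup>d\<close> at an independent exponential time, characterised
  by its characteristic function and its exponential moments.\<close>

locale exp_gauss = prob_space \<nu> for \<nu> :: "(nat \<Rightarrow> real) measure" +
  fixes d :: nat and lam :: real
  assumes sets_nu [measurable_cong]: "sets \<nu> = sets borel"
    and lam_pos: "lam > 0" and d_pos: "d \<ge> 1"
    and cosE: "expectation (\<lambda>z. cos (dotd d \<kappa> z)) = lam / (lam + sqd d \<kappa> / 2)"
    and sinE: "expectation (\<lambda>z. sin (dotd d \<kappa> z)) = 0"
    and expI: "sqd d \<kappa> / 2 < lam \<Longrightarrow> integrable \<nu> (\<lambda>z. exp (dotd d \<kappa> z))"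
    and expE: "sqd d \<kappa> / 2 < lam \<Longrightarrow> expectation (\<lambda>z. exp (dotd d \<kappa> z)) = lam / (lam - sqd d \<kappa> / 2)"
begin

lemma trig_integrable: "integrable \<nu> (\<lambda>z. cos (dotd d \<kappa> z))" "integrable \<nu> (\<lambda>z. sin (dotd d \<kappa> z))"
  by (rule integrable_const_bound[of _ 1]; simp)+

lemma move_meas [measurable]: "move d B x \<in> \<nu> \<rightarrow>\<^sub>M borel"
  using measurable_compose[OF measurable_Pair1'[of x borel borel] move_measurable, of d B]
  by (simp add: measurable_cong_sets[OF sets_nu refl])

text \<open>By the addition theorem; the sine term vanishes through \<open>sinE\<close>, so
  averaging over the noise merely multiplies a plane wave by a number.\<close>

lemma cos_move:
  "integrable \<nu> (\<lambda>z. cos (dotd d k (move d B x z) + \<theta>))"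
  "expectation (\<lambda>z. cos (dotd d k (move d B x z) + \<theta>)) = lam / (lam + qform d B k / 2) * cos (dotd d k x + \<theta>)"
proof -
  have eq: "cos (dotd d k (move d B x z) + \<theta>) =
    cos (dotd d k x + \<theta>) * cos (dotd d (matT d B k) z) - sin (dotd d k x + \<theta>) * sin (dotd d (matT d B k) z)" for z
    unfolding dotd_move cos_add[symmetric] by (simp add: algebra_simps)
  show "integrable \<nu> (\<lambda>z. cos (dotd d k (move d B x z) + \<theta>))"
    unfolding eq by (intro Bochner_Integration.integrable_diff integrable_mult_right trig_integrable)
  have "expectation (\<lambda>z. cos (dotd d k (move d B x z) + \<theta>)) =
    cos (dotd d k x + \<theta>) * expectation (\<lambda>z. cos (dotd d (matT d B k) z)) - sin (dotd d k x + \<theta>) * expectation (\<lambda>z. sin (dotd d (matT d B k) z))"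
    unfolding eq by (simp add: trig_integrable)
  then show "expectation (\<lambda>z. cos (dotd d k (move d B x z) + \<theta>)) = lam / (lam + qform d B k / 2) * cos (dotd d k x + \<theta>)"
    by (simp add: cosE sinE qform_sqd)
qed

text \<open>The multiplier in \<open>cos_move\<close> is \<open>lam\<close> times the factor applied
  by \<open>resolve\<close>: for trigonometric polynomials the stochastic representation is a
  comparison of coefficients.\<close>

lemma tpoly_move:
  "integrable \<nu> (\<lambda>z. tpoly d ps (move d B x z)) \<and>
   expectation (\<lambda>z. tpoly d ps (move d B x z)) = lam * tpoly d (resolve d B lam ps) x"
proof (induction ps)
  case (Cons p ps)
  obtain c k \<theta> where p: "p = (c, k, \<theta>)" by (cases p)
  show ?case using Cons cos_move[of k B x \<theta>]
    by (simp add: p resolve_def distrib_left)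
qed (simp add: resolve_def)

lemma cosh_move:
  assumes q: "c\<^sup>2 * qform d B (unitv i) / 2 < lam" and i: "i < d"
  shows "integrable \<nu> (\<lambda>z. cosh (c * move d B x z i))"
    "expectation (\<lambda>z. cosh (c * move d B x z i)) = lam / (lam - c\<^sup>2 * qform d B (unitv i) / 2) * cosh (c * x i)"
proof -
  define \<kappa> where "\<kappa> s = (\<lambda>l. s * matT d B (unitv i) l)" for s
  have sq: "sqd d (\<kappa> s) = s\<^sup>2 * qform d B (unitv i)" for s
    by (simp add: \<kappa>_def sqd_def qform_sqd power_mult_distrib sum_distrib_left)
  have l: "sqd d (\<kappa> c) / 2 < lam" "sqd d (\<kappa> (- c)) / 2 < lam" using q by (simp_all add: sq)
  have m: "move d B x z i = x i + dotd d (matT d B (unitv i)) z" for z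
    using dotd_move[of d "unitv i" B x z] i by simp
  have dk: "dotd d (\<kappa> s) z = s * dotd d (matT d B (unitv i)) z" for s z
    unfolding \<kappa>_def by (rule dotd_scale)
  have eq: "cosh (c * move d B x z i) = exp (c * x i) / 2 * exp (dotd d (\<kappa> c) z) + exp (- (c * x i)) / 2 * exp (dotd d (\<kappa> (- c)) z)" for z
    unfolding m dk by (simp add: cosh_def exp_add[symmetric] distrib_left add_divide_distrib)
  show "integrable \<nu> (\<lambda>z. cosh (c * move d B x z i))"
    unfolding eq by (intro Bochner_Integration.integrable_add integrable_mult_right expI l)
  have "expectation (\<lambda>z. cosh (c * move d B x z i)) =
     exp (c * x i) / 2 * expectation (\<lambda>z. exp (dotd d (\<kappa> c) z)) + exp (- (c * x i)) / 2 * expectation (\<lambda>z. exp (dotd d (\<kappa> (- c)) z))"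
    unfolding eq by (subst Bochner_Integration.integral_add, (intro integrable_mult_right expI l)+, simp)
  also have "\<dots> = lam / (lam - c\<^sup>2 * qform d B (unitv i) / 2) * ((exp (c * x i) + exp (- (c * x i))) / 2)"
    unfolding expE[OF l(1)] expE[OF l(2)] sq by (simp add: algebra_simps add_divide_distrib)
  finally show "expectation (\<lambda>z. cosh (c * move d B x z i)) = lam / (lam - c\<^sup>2 * qform d B (unitv i) / 2) * cosh (c * x i)"
    by (simp only: cosh_field_def)
qed

lemma psi_move_integrable:
  assumes q: "\<And>i. i < d \<Longrightarrow> c\<^sup>2 * qform d B (unitv i) / 2 < lam"
  shows "integrable \<nu> (\<lambda>z. psi d c (move d B x z))"
  unfolding psi_def by (intro Bochner_Integration.integrable_sum cosh_move q) auto

lemma psi_move: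
  assumes q: "\<And>i. i < d \<Longrightarrow> c\<^sup>2 * qform d B (unitv i) / 2 < lam"
    and \<rho>: "\<And>i. i < d \<Longrightarrow> lam / (lam - c\<^sup>2 * qform d B (unitv i) / 2) \<le> \<rho>"
  shows "expectation (\<lambda>z. psi d c (move d B x z)) \<le> \<rho> * psi d c x"
proof -
  have "expectation (\<lambda>z. psi d c (move d B x z)) = (\<Sum>i<d. expectation (\<lambda>z. cosh (c * move d B x z i)))"
    unfolding psi_def by (intro Bochner_Integration.integral_sum cosh_move q) auto
  also have "\<dots> = (\<Sum>i<d. lam / (lam - c\<^sup>2 * qform d B (unitv i) / 2) * cosh (c * x i))"
    by (intro sum.cong refl cosh_move q) auto
  also have "\<dots> \<le> (\<Sum>i<d. \<rho> * cosh (c * x i))"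
    using \<rho> by (intro sum_mono mult_right_mono) (auto intro: order_trans[OF zero_le_one cosh_real_ge_1])
  finally show ?thesis
    by (simp add: psi_def sum_distrib_left)
qed

lemma small_c:
  assumes "b > 0" obtains c where "c > 0" "\<And>i. i < d \<Longrightarrow> c\<^sup>2 * qform d B (unitv i) \<le> b"
proof -
  \<comment> \<open>The summand 1 keeps \<open>S\<close> positive when the matrix vanishes.\<close>
  define S where "S = (\<Sum>i<d. qform d B (unitv i)) + 1"
  have S: "S > 0" unfolding S_def by (intro add_nonneg_pos sum_nonneg qform_nonneg) simp
  show ?thesis
  proof (rule that[of "sqrt (b / S)"])
    show "sqrt (b / S) > 0" using assms S by simp
    fix i assume i: "i < d"
    have "qform d B (unitv i) \<le> (\<Sum>i<d. qform d B (unitv i))"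
      using i by (intro member_le_sum qform_nonneg) auto
    then have "qform d B (unitv i) \<le> S" by (simp add: S_def)
    then have "b * qform d B (unitv i) \<le> b * S" using assms by simp
    then show "(sqrt (b / S))\<^sup>2 * qform d B (unitv i) \<le> b" using assms S by (simp add: divide_simps)
  qed
qed

text \<open>Replacing h by a trigonometric polynomial costs a multiple of \<epsilon>
  \<open>psi\<close> in the comparison and \<epsilon> times the mean of \<open>psi\<close> in the
  average; both vanish as \<epsilon> tends to 0, because \<open>psi\<close> is integrable along the
  step.\<close>

lemma feynman_kac_le:
  assumes u: "continuous_on (Rd d) u" "subexp d u"
    and h: "continuous_on (Rd d) h" "subexp d h" "h \<in> borel_measurable borel"
    and sub: "\<And>x qs. x \<in> Rd d \<Longrightarrow> smooth qs \<Longrightarrow> ridge d qs x = u x \<Longrightarrow> (\<forall>y\<in>Rd d. u y \<le> ridge d qs y) \<Longrightarrow>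
        lam * u x - h x \<le> half_trace d B (ridge d qs) x"
    and x: "x \<in> Rd d"
  shows "integrable \<nu> (\<lambda>z. h (move d B x z))" "lam * u x \<le> expectation (\<lambda>z. h (move d B x z))"
proof -
  obtain c where c: "c > 0" "\<And>i. i < d \<Longrightarrow> c\<^sup>2 * qform d B (unitv i) \<le> lam" using small_c[OF lam_pos] by metis
  have q: "c\<^sup>2 * qform d B (unitv i) / 2 < lam" if "i < d" for i using c(2)[OF that] lam_pos by simp
  have psi_int: "integrable \<nu> (\<lambda>z. psi d c (move d B x z))" by (rule psi_move_integrable[OF q])
  note mm [measurable] = measurable_compose[OF move_meas h(3), of B x]
  define E where "E = expectation (\<lambda>z. psi d c (move d B x z))"
  have bd: "integrable \<nu> (\<lambda>z. h (move d B x z)) \<and>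
     lam * u x \<le> expectation (\<lambda>z. h (move d B x z)) + \<epsilon> * (E + 2 * psi d c x)" if \<epsilon>: "\<epsilon> > 0" for \<epsilon>
  proof -
    obtain ps where ps: "\<And>y. y \<in> Rd d \<Longrightarrow> \<bar>h y - tpoly d ps y\<bar> \<le> \<epsilon> * psi d c y"
      using trig_approx[OF d_pos c(1) \<epsilon> h(1,2)] by blast
    have app: "\<bar>h (move d B x z) - tpoly d ps (move d B x z)\<bar> \<le> \<epsilon> * psi d c (move d B x z)" for z
      by (rule ps[OF move_Rd[OF x]])
    have ti: "integrable \<nu> (\<lambda>z. tpoly d ps (move d B x z))"
      and te: "expectation (\<lambda>z. tpoly d ps (move d B x z)) = lam * tpoly d (resolve d B lam ps) x"
      using tpoly_move[of ps B x] by auto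
    have di: "integrable \<nu> (\<lambda>z. h (move d B x z) - tpoly d ps (move d B x z))"
    proof (rule Bochner_Integration.integrable_bound)
      show "integrable \<nu> (\<lambda>z. \<epsilon> * psi d c (move d B x z))" using psi_int by simp
      show "(\<lambda>z. h (move d B x z) - tpoly d ps (move d B x z)) \<in> borel_measurable \<nu>"
        using ti by (intro borel_measurable_diff mm) auto
      show "AE z in \<nu>. norm (h (move d B x z) - tpoly d ps (move d B x z)) \<le> norm (\<epsilon> * psi d c (move d B x z))"
        using app by (auto intro!: AE_I2 order_trans[OF app])
    qed
    have hi: "integrable \<nu> (\<lambda>z. h (move d B x z))"
      using Bochner_Integration.integrable_add[OF di ti] by simp
    have "expectation (\<lambda>z. tpoly d ps (move d B x z)) - expectation (\<lambda>z. h (move d B x z)) =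
       expectation (\<lambda>z. tpoly d ps (move d B x z) - h (move d B x z))" using hi ti by simp
    also have "\<dots> \<le> expectation (\<lambda>z. \<epsilon> * psi d c (move d B x z))"
    proof (intro integral_mono Bochner_Integration.integrable_diff ti hi)
      show "integrable \<nu> (\<lambda>z. \<epsilon> * psi d c (move d B x z))" using psi_int by simp
      show "tpoly d ps (move d B x z) - h (move d B x z) \<le> \<epsilon> * psi d c (move d B x z)" for z
        using app[of z] by linarith
    qed
    also have "\<dots> = \<epsilon> * E" by (simp add: E_def)
    finally have "lam * tpoly d (resolve d B lam ps) x \<le> expectation (\<lambda>z. h (move d B x z)) + \<epsilon> * E"
      unfolding te by linarith
    moreover have "u x \<le> tpoly d (resolve d B lam ps) x + 2 / lam * \<epsilon> * psi d c x"
      by (rule comparison[OF d_pos lam_pos c(1) \<epsilon> c(2) u sub ps x])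
    then have "lam * u x \<le> lam * (tpoly d (resolve d B lam ps) x + 2 / lam * \<epsilon> * psi d c x)"
      using lam_pos by simp
    moreover have "\<dots> = lam * tpoly d (resolve d B lam ps) x + \<epsilon> * (2 * psi d c x)"
      using lam_pos by (simp add: field_simps)
    ultimately show ?thesis using hi by (simp add: distrib_left)
  qed
  show "integrable \<nu> (\<lambda>z. h (move d B x z))" using bd[of 1] by simp
  have lim: "((\<lambda>\<epsilon>. expectation (\<lambda>z. h (move d B x z)) + \<epsilon> * (E + 2 * psi d c x)) \<longlongrightarrow>
      expectation (\<lambda>z. h (move d B x z)) + 0 * (E + 2 * psi d c x)) (at_right 0)"
    by (intro tendsto_intros)
  have ev: "\<forall>\<^sub>F \<epsilon> in at_right 0. lam * u x \<le> expectation (\<lambda>z. h (move d B x z)) + \<epsilon> * (E + 2 * psi d c x)"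
    using bd by (simp add: eventually_at_filter)
  show "lam * u x \<le> expectation (\<lambda>z. h (move d B x z))"
    using tendsto_lowerbound[OF lim ev trivial_limit_at_right_real] by simp
qed

text \<open>The one-sided estimate is applied to u and to -u. Freezing h is legitimate since a test
  function agrees with u where it touches, so f enters only through its values on the graph of
  u.\<close>

theorem feynman_kac:
  assumes u: "subexp d u" and visc: "viscosity_solution d B f u"
    and h: "continuous_on (Rd d) h" "subexp d h" "h \<in> borel_measurable borel"
    and fh: "\<And>x. x \<in> Rd d \<Longrightarrow> f x (u x) = lam * u x - h x"
    and x: "x \<in> Rd d"
  shows "integrable \<nu> (\<lambda>z. h (move d B x z))" "lam * u x = expectation (\<lambda>z. h (move d B x z))"
proof -
  have uc: "continuous_on (Rd d) u"
    using visc by (simp add: viscosity_solution_def continuous_map_Euclidean_space_iff)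
  have sub: "lam * u y - h y \<le> half_trace d B (ridge d qs) y"
    if "y \<in> Rd d" "smooth qs" "ridge d qs y = u y" "\<forall>w\<in>Rd d. u w \<le> ridge d qs w" for y qs
  proof -
    have "f y (ridge d qs y) \<le> half_trace d B (ridge d qs) y"
      using visc C2_ridge[OF that(2), of d] that unfolding viscosity_solution_def by blast
    then show ?thesis using fh[OF that(1)] that(3) by simp
  qed
  note le = feynman_kac_le[OF uc u h sub x]
  have "lam * - u x \<le> expectation (\<lambda>z. - h (move d B x z))"
  proof (rule feynman_kac_le(2)[of "\<lambda>x. - u x" "\<lambda>x. - h x" B x])
    show "subexp d (\<lambda>x. - u x)" "subexp d (\<lambda>x. - h x)" using u h(2) by (simp_all add: subexp_def)
    show "continuous_on (Rd d) (\<lambda>x. - u x)" "continuous_on (Rd d) (\<lambda>x. - h x)"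
      using uc h(1) by (auto intro: continuous_on_minus)
    show "(\<lambda>x. - h x) \<in> borel_measurable borel" using h(3) by simp
    fix y qs assume y: "y \<in> Rd d" and qs: "smooth qs" "ridge d qs y = - u y" "\<forall>w\<in>Rd d. - u w \<le> ridge d qs w"
    \<comment> \<open>Negation turns a function above -u into a test function below u.\<close>
    let ?rs = "scale_ridge (- 1) qs"
    have "C2 d (ridge d ?rs)" using qs(1) by (intro C2_ridge smooth_scale)
    moreover have "ridge d ?rs y = u y" using qs(2) by simp
    moreover have "\<forall>w\<in>Rd d. ridge d ?rs w \<le> u w" using qs(3) by (auto simp: minus_le_iff)
    ultimately have "half_trace d B (ridge d ?rs) y \<le> f y (ridge d ?rs y)"
      using visc y unfolding viscosity_solution_def by blast
    then show "lam * - u y - - h y \<le> half_trace d B (ridge d qs) y"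
      using fh[OF y] \<open>ridge d ?rs y = u y\<close> by (simp add: half_trace_scale[OF qs(1)])
  qed (rule x)
  then have "expectation (\<lambda>z. h (move d B x z)) \<le> lam * u x" by simp
  with le(2) show "lam * u x = expectation (\<lambda>z. h (move d B x z))" by (rule antisym)
  show "integrable \<nu> (\<lambda>z. h (move d B x z))" by (rule le(1))
qed

end

subsection \<open>Brownian motion at an independent exponential time\<close>

text \<open>Completing the square turns the integrand into a constant times a shifted normal
  density.\<close>

lemma nn_integral_exp_normal:
  assumes "\<sigma> > 0"
  shows "(\<integral>\<^sup>+x. ennreal (normal_density 0 \<sigma> x) * ennreal (exp (\<kappa> * x)) \<partial>lborel) = ennreal (exp (\<sigma>\<^sup>2 * \<kappa>\<^sup>2 / 2))"
proof -
  have eq: "normal_density 0 \<sigma> x * exp (\<kappa> * x) = exp (\<sigma>\<^sup>2 * \<kappa>\<^sup>2 / 2) * normal_density (\<sigma>\<^sup>2 * \<kappa>) \<sigma> x" for x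
  proof -
    have "- x\<^sup>2 / (2 * \<sigma>\<^sup>2) + \<kappa> * x = \<sigma>\<^sup>2 * \<kappa>\<^sup>2 / 2 - (x - \<sigma>\<^sup>2 * \<kappa>)\<^sup>2 / (2 * \<sigma>\<^sup>2)"
      using assms by (simp add: field_simps power2_eq_square)
    then have "exp (- x\<^sup>2 / (2 * \<sigma>\<^sup>2)) * exp (\<kappa> * x) = exp (\<sigma>\<^sup>2 * \<kappa>\<^sup>2 / 2) * exp (- (x - \<sigma>\<^sup>2 * \<kappa>)\<^sup>2 / (2 * \<sigma>\<^sup>2))"
      by (simp add: exp_add[symmetric])
    then show ?thesis by (simp add: normal_density_def)
  qed
  have "(\<integral>\<^sup>+x. ennreal (normal_density 0 \<sigma> x) * ennreal (exp (\<kappa> * x)) \<partial>lborel)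
     = (\<integral>\<^sup>+x. ennreal (exp (\<sigma>\<^sup>2 * \<kappa>\<^sup>2 / 2)) * ennreal (normal_density (\<sigma>\<^sup>2 * \<kappa>) \<sigma> x) \<partial>lborel)"
    by (intro nn_integral_cong) (simp add: ennreal_mult[symmetric] eq)
  also have "\<dots> = ennreal (exp (\<sigma>\<^sup>2 * \<kappa>\<^sup>2 / 2)) * (\<integral>\<^sup>+x. ennreal (normal_density (\<sigma>\<^sup>2 * \<kappa>) \<sigma> x) \<partial>lborel)"
    by (rule nn_integral_cmult) simp
  also have "(\<integral>\<^sup>+x. ennreal (normal_density (\<sigma>\<^sup>2 * \<kappa>) \<sigma> x) \<partial>lborel) = 1"
    using prob_space.emeasure_space_1[OF prob_space_normal_density[OF assms, of "\<sigma>\<^sup>2 * \<kappa>"]]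
    by (simp add: emeasure_density)
  finally show ?thesis by simp
qed

lemma measurable_coordinate: "(\<lambda>x :: nat \<Rightarrow> real. x i) \<in> borel_measurable borel"
  by (rule borel_measurable_continuous_onI[OF continuous_on_coordinate])

section \<open>Transforms of Brownian values at a fixed time\<close>

context prob_space begin

lemma normal_exp:
  assumes X: "distributed M lborel X (normal_density 0 \<sigma>)" and \<sigma>: "\<sigma> > 0"
  shows "(\<integral>\<^sup>+\<omega>. ennreal (exp (\<kappa> * X \<omega>)) \<partial>M) = ennreal (exp (\<sigma>\<^sup>2 * \<kappa>\<^sup>2 / 2))"
  using distributed_nn_integral[OF X, of "\<lambda>x. ennreal (exp (\<kappa> * x))"] nn_integral_exp_normal[OF \<sigma>] by simp

lemma normal_iexp:
  assumes X: "distributed M lborel X (normal_density 0 \<sigma>)" and \<sigma>: "\<sigma> > 0"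
  shows "(CLINT \<omega>|M. iexp (\<kappa> * X \<omega>)) = complex_of_real (exp (- (\<sigma>\<^sup>2 * \<kappa>\<^sup>2 / 2)))"
proof -
  have Y: "distributed M lborel (\<lambda>\<omega>. (X \<omega> - 0) / \<sigma>) std_normal_density"
    using X normal_standard_normal_convert[OF \<sigma>, of X 0] by simp
  have m: "(\<lambda>\<omega>. (X \<omega> - 0) / \<sigma>) \<in> measurable M lborel" using Y by (rule distributed_measurable)
  have "(CLINT \<omega>|M. iexp (\<kappa> * X \<omega>)) = (CLINT \<omega>|M. iexp ((\<kappa> * \<sigma>) * ((X \<omega> - 0) / \<sigma>)))"
    using \<sigma> by (intro Bochner_Integration.integral_cong) auto
  also have "\<dots> = (CLINT x|distr M lborel (\<lambda>\<omega>. (X \<omega> - 0) / \<sigma>). iexp ((\<kappa> * \<sigma>) * x))"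
    by (rule integral_distr[symmetric, OF m]) measurable
  also have "distr M lborel (\<lambda>\<omega>. (X \<omega> - 0) / \<sigma>) = std_normal_distribution"
    by (rule distributed_distr_eq_density[OF Y])
  also have "(CLINT x|std_normal_distribution. iexp ((\<kappa> * \<sigma>) * x)) = char std_normal_distribution (\<kappa> * \<sigma>)"
    by (simp add: char_def)
  also have "\<dots> = complex_of_real (exp (- (\<sigma>\<^sup>2 * \<kappa>\<^sup>2 / 2)))"
    by (simp add: char_std_normal_distribution power_mult_distrib mult.commute)
  finally show ?thesis .
qed

lemma prod_exp_dotd:
  "(\<Prod>i<d. ennreal (exp (\<kappa> i * y i))) = ennreal (exp (dotd d \<kappa> y))"
  "(\<Prod>i<d. iexp (\<kappa> i * y i)) = iexp (dotd d \<kappa> y)"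
  unfolding dotd_def exp_sum[OF finite_lessThan] of_real_sum sum_distrib_left
  by (rule prod_ennreal, simp, rule refl)

text \<open>The definition describes the laws of increments and fixes the start only almost surely,
  so values at time t are traded for increments from 0 almost everywhere.\<close>

lemma brownian_zero:
  assumes "standard_brownian_motion M d W"
  shows "AE \<omega> in M. dotd d \<kappa> (W t \<omega>) = dotd d \<kappa> (\<lambda>i. W t \<omega> i - W 0 \<omega> i)" "AE \<omega> in M. dotd d \<kappa> (W 0 \<omega>) = 0"
proof -
  have 0: "AE \<omega> in M. W 0 \<omega> = (\<lambda>i. 0)" using assms by (simp add: standard_brownian_motion_def)
  show "AE \<omega> in M. dotd d \<kappa> (W t \<omega>) = dotd d \<kappa> (\<lambda>i. W t \<omega> i - W 0 \<omega> i)" "AE \<omega> in M. dotd d \<kappa> (W 0 \<omega>) = 0"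
    using 0 by (auto elim!: eventually_mono simp: dotd_def)
qed

lemma brownian_increment:
  assumes "standard_brownian_motion M d W" "t > 0"
  shows "indep_vars (\<lambda>_. borel) (\<lambda>i \<omega>. W t \<omega> i - W 0 \<omega> i) {..<d}"
    "\<And>i. i < d \<Longrightarrow> distributed M lborel (\<lambda>\<omega>. W t \<omega> i - W 0 \<omega> i) (normal_density 0 (sqrt t))"
proof -
  have "\<forall>t1 t2. 0 \<le> t1 \<and> t1 < t2 \<longrightarrow>
      indep_vars (\<lambda>_. borel) (\<lambda>i \<omega>. W t2 \<omega> i - W t1 \<omega> i) {..<d} \<and>
      (\<forall>i<d. distributed M lborel (\<lambda>\<omega>. W t2 \<omega> i - W t1 \<omega> i) (normal_density 0 (sqrt (t2 - t1))))"
    using assms(1) unfolding standard_brownian_motion_def by (elim conjE)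
  from this[rule_format, of 0 t] assms(2)
  show "indep_vars (\<lambda>_. borel) (\<lambda>i \<omega>. W t \<omega> i - W 0 \<omega> i) {..<d}"
    "\<And>i. i < d \<Longrightarrow> distributed M lborel (\<lambda>\<omega>. W t \<omega> i - W 0 \<omega> i) (normal_density 0 (sqrt t))"
    by simp_all
qed

lemma brownian_measurable:
  assumes "standard_brownian_motion M d W" "t \<ge> 0"
  shows "W t \<in> borel_measurable M"
  using assms by (simp add: standard_brownian_motion_def)

text \<open>Independent coordinates make the exponential a product of one-dimensional factors. Time
  0 is treated apart because increments have a density only over intervals of positive
  length.\<close>

lemma brownian_exp:
  assumes W: "standard_brownian_motion M d W" and t: "t \<ge> 0"
  shows "(\<integral>\<^sup>+\<omega>. ennreal (exp (dotd d \<kappa> (W t \<omega>))) \<partial>M) = ennreal (exp (t * sqd d \<kappa> / 2))"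
proof (cases "t = 0")
  case True
  have "(\<integral>\<^sup>+\<omega>. ennreal (exp (dotd d \<kappa> (W t \<omega>))) \<partial>M) = (\<integral>\<^sup>+\<omega>. 1 \<partial>M)"
    using brownian_zero(2)[OF W, of \<kappa>] True by (intro nn_integral_cong_AE) (auto elim!: eventually_mono)
  then show ?thesis using True by (simp add: emeasure_space_1)
next
  case False
  then have t': "t > 0" using t by simp
  let ?D = "\<lambda>i \<omega>. W t \<omega> i - W 0 \<omega> i"
  have ind: "indep_vars (\<lambda>_. borel) (\<lambda>i \<omega>. ennreal (exp (\<kappa> i * ?D i \<omega>))) {..<d}"
    by (rule indep_vars_compose2[OF brownian_increment(1)[OF W t']]) measurable
  have "(\<integral>\<^sup>+\<omega>. ennreal (exp (dotd d \<kappa> (W t \<omega>))) \<partial>M) = (\<integral>\<^sup>+\<omega>. (\<Prod>i<d. ennreal (exp (\<kappa> i * ?D i \<omega>))) \<partial>M)"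
    unfolding prod_exp_dotd
    by (intro nn_integral_cong_AE) (use brownian_zero(1)[OF W, of \<kappa> t] in eventually_elim, simp only:)
  also have "\<dots> = (\<Prod>i<d. \<integral>\<^sup>+\<omega>. ennreal (exp (\<kappa> i * ?D i \<omega>)) \<partial>M)"
    by (rule indep_vars_nn_integral[OF _ ind]) auto
  also have "\<dots> = (\<Prod>i<d. ennreal (exp (t * (\<kappa> i)\<^sup>2 / 2)))"
  proof (intro prod.cong refl)
    fix i assume "i \<in> {..<d}"
    then show "(\<integral>\<^sup>+\<omega>. ennreal (exp (\<kappa> i * ?D i \<omega>)) \<partial>M) = ennreal (exp (t * (\<kappa> i)\<^sup>2 / 2))"
      using normal_exp[OF brownian_increment(2)[OF W t', of i], of "\<kappa> i"] t' by simp
  qed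
  also have "\<dots> = ennreal (exp (t * sqd d \<kappa> / 2))"
    by (simp add: prod_ennreal exp_sum[symmetric] sqd_def sum_distrib_left sum_divide_distrib)
  finally show ?thesis .
qed

lemma brownian_iexp:
  assumes W: "standard_brownian_motion M d W" and t: "t \<ge> 0"
  shows "(CLINT \<omega>|M. iexp (dotd d \<kappa> (W t \<omega>))) = complex_of_real (exp (- (t * sqd d \<kappa> / 2)))"
proof (cases "t = 0")
  case True
  have [measurable]: "W t \<in> borel_measurable M" by (rule brownian_measurable[OF W t])
  have "(CLINT \<omega>|M. iexp (dotd d \<kappa> (W t \<omega>))) = (CLINT \<omega>|M. 1)"
    by (intro integral_cong_AE) (measurable, use brownian_zero(2)[OF W, of \<kappa>] True in \<open>auto elim!: eventually_mono\<close>)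
  then show ?thesis using True by (simp add: prob_space)
next
  case False
  then have t': "t > 0" using t by simp
  have [measurable]: "W t \<in> borel_measurable M" by (rule brownian_measurable[OF W t])
  let ?D = "\<lambda>i \<omega>. W t \<omega> i - W 0 \<omega> i"
  have ind: "indep_vars (\<lambda>_. borel) (\<lambda>i \<omega>. iexp (\<kappa> i * ?D i \<omega>)) {..<d}"
    by (rule indep_vars_compose2[OF brownian_increment(1)[OF W t']]) measurable
  have [measurable]: "(\<lambda>\<omega>. W s \<omega> i) \<in> borel_measurable M" if "s \<ge> 0" for s i
    by (rule measurable_compose[OF brownian_measurable[OF W that] measurable_coordinate])
  have rv: "(\<lambda>\<omega>. iexp (\<kappa> i * ?D i \<omega>)) \<in> borel_measurable M" for i using t by measurable
  have eq: "AE \<omega> in M. iexp (dotd d \<kappa> (W t \<omega>)) = (\<Prod>i<d. iexp (\<kappa> i * ?D i \<omega>))"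
    unfolding prod_exp_dotd using brownian_zero(1)[OF W, of \<kappa> t] by eventually_elim (simp only:)
  have "(CLINT \<omega>|M. iexp (dotd d \<kappa> (W t \<omega>))) = (CLINT \<omega>|M. (\<Prod>i<d. iexp (\<kappa> i * ?D i \<omega>)))"
    using t by (intro integral_cong_AE eq) measurable
  also have "\<dots> = (\<Prod>i<d. CLINT \<omega>|M. iexp (\<kappa> i * ?D i \<omega>))"
  proof (rule indep_vars_lebesgue_integral[OF _ ind])
    fix i assume "i \<in> {..<d}"
    show "integrable M (\<lambda>\<omega>. iexp (\<kappa> i * ?D i \<omega>))"
      by (rule integrable_const_bound[of _ 1, OF _ rv]) simp
  qed auto
  also have "\<dots> = (\<Prod>i<d. complex_of_real (exp (- (t * (\<kappa> i)\<^sup>2 / 2))))"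
  proof (intro prod.cong refl)
    fix i assume "i \<in> {..<d}"
    then have i: "i < d" and sq: "sqrt t > 0" using t' by auto
    show "(CLINT \<omega>|M. iexp (\<kappa> i * ?D i \<omega>)) = complex_of_real (exp (- (t * (\<kappa> i)\<^sup>2 / 2)))"
      by (rule normal_iexp[OF brownian_increment(2)[OF W t' i] sq, of "\<kappa> i", unfolded real_sqrt_pow2[OF t]])
  qed
  also have "\<dots> = complex_of_real (exp (- (t * sqd d \<kappa> / 2)))"
    by (simp only: of_real_prod[symmetric] exp_sum[symmetric] finite_lessThan)
       (simp add: sqd_def sum_distrib_left sum_divide_distrib sum_negf)
  finally show ?thesis .
qed

end

lemma nn_integral_exponential_exp:
  assumes "lam > 0" "- lam < c"
  shows "(\<integral>\<^sup>+t. ennreal (exp (- c * t)) \<partial>density lborel (exponential_density lam)) = ennreal (lam / (lam + c))"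
proof -
  have eq: "exponential_density lam t * exp (- c * t) = lam / (lam + c) * exponential_density (lam + c) t" for t
  proof -
    have "exp (- t * lam) * exp (- c * t) = exp (- t * (lam + c))"
      by (simp add: exp_add[symmetric] algebra_simps)
    then show ?thesis using assms by (simp add: exponential_density_def mult.assoc)
  qed
  have "(\<integral>\<^sup>+t. ennreal (exp (- c * t)) \<partial>density lborel (exponential_density lam)) =
     (\<integral>\<^sup>+t. ennreal (exponential_density lam t) * ennreal (exp (- c * t)) \<partial>lborel)"
    by (rule nn_integral_density) auto
  also have "\<dots> = (\<integral>\<^sup>+t. ennreal (lam / (lam + c)) * ennreal (exponential_density (lam + c) t) \<partial>lborel)"
  proof (intro nn_integral_cong)
    show "ennreal (exponential_density lam t) * ennreal (exp (- c * t)) =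
        ennreal (lam / (lam + c)) * ennreal (exponential_density (lam + c) t)" for t
      using eq[of t] assms by (simp add: ennreal_mult[symmetric] exponential_density_nonneg)
  qed
  also have "\<dots> = ennreal (lam / (lam + c)) * (\<integral>\<^sup>+t. ennreal (exponential_density (lam + c) t) \<partial>lborel)"
    by (rule nn_integral_cmult) simp
  also have "(\<integral>\<^sup>+t. ennreal (exponential_density (lam + c) t) \<partial>lborel) = 1"
    using prob_space.emeasure_space_1[OF prob_space_exponential_density[of "lam + c"]] assms
    by (simp add: emeasure_density)
  finally show ?thesis by simp
qed

text \<open>The hypothesis gives P(X >= a) for a > 0, while the distribution function needs P(X > a)
  for a >= 0; the gap is closed by letting thresholds decrease to a.\<close>

lemma (in prob_space) exponential_law:
  assumes X: "X \<in> borel_measurable M" and lam: "lam > 0" and pos: "\<And>\<omega>. \<omega> \<in> space M \<Longrightarrow> 0 \<le> X \<omega>"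
    and tail: "\<And>\<epsilon>. \<epsilon> > 0 \<Longrightarrow> prob {\<omega> \<in> space M. X \<omega> \<ge> \<epsilon>} = exp (- lam * \<epsilon>)"
  shows "distr M borel X = density lborel (exponential_density lam)"
proof -
  note X [measurable]
  have gt: "prob {\<omega> \<in> space M. X \<omega> > a} = exp (- lam * a)" if a: "a \<ge> 0" for a
  proof (rule antisym)
    show "exp (- lam * a) \<ge> prob {\<omega> \<in> space M. X \<omega> > a}"
    proof (cases "a = 0")
      case False
      have "prob {\<omega> \<in> space M. X \<omega> > a} \<le> prob {\<omega> \<in> space M. X \<omega> \<ge> a}"
        by (intro finite_measure_mono) auto
      then show ?thesis using tail[of a] a False by simp
    qed simp
    have "prob {\<omega> \<in> space M. X \<omega> > a} \<ge> exp (- lam * (a + e))" if "e > 0" for e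
    proof -
      have "prob {\<omega> \<in> space M. X \<omega> \<ge> a + e} \<le> prob {\<omega> \<in> space M. X \<omega> > a}"
        using that by (intro finite_measure_mono) auto
      then show ?thesis using tail[of "a + e"] a that by simp
    qed
    then have ev: "\<forall>\<^sub>F e in at_right 0. exp (- lam * (a + e)) \<le> prob {\<omega> \<in> space M. X \<omega> > a}"
      by (simp add: eventually_at_filter)
    have "((\<lambda>e. exp (- lam * (a + e))) \<longlongrightarrow> exp (- lam * (a + 0))) (at_right 0)"
      by (intro tendsto_intros)
    from tendsto_upperbound[OF this ev trivial_limit_at_right_real]
    show "exp (- lam * a) \<le> prob {\<omega> \<in> space M. X \<omega> > a}" by simp
  qed
  have "distributed M lborel X (exponential_density lam)"
  proof (rule exponential_distributedI)
    fix a :: real assume a: "0 \<le> a"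
    have "{x \<in> space M. X x \<le> a} = space M - {\<omega> \<in> space M. X \<omega> > a}" by auto
    then have "prob {x \<in> space M. X x \<le> a} = 1 - exp (- lam * a)"
      using prob_compl[of "{\<omega> \<in> space M. X \<omega> > a}"] gt[OF a] by simp
    then show "emeasure M {x \<in> space M. X x \<le> a} = 1 - ennreal (exp (- a * lam))"
      using lam a by (simp add: emeasure_eq_measure ennreal_minus[symmetric] mult.commute)
  qed (use lam in auto)
  from distributed_distr_eq_density[OF this] show ?thesis
    by (metis (no_types, lifting) distr_cong sets_lborel)
qed

text \<open>Evaluation of a path at a time is not measurable for the product \<open>\<sigma>\<close>-algebra on the path space;
  on continuous paths it agrees with the following limit along a grid, which is.\<close>

definition grid_time :: "nat \<Rightarrow> int \<Rightarrow> real" where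
  "grid_time n k = max 0 ((of_int k + 1) / real (Suc n))"

definition eval_path :: "real \<times> (real \<Rightarrow> nat \<Rightarrow> real) \<Rightarrow> nat \<Rightarrow> real" where
  "eval_path = (\<lambda>(t, w) i. lim (\<lambda>n. w (grid_time n \<lfloor>t * real (Suc n)\<rfloor>) i))"

text \<open>For fixed n the grid index takes countably many values, and for each of them a single
  coordinate of the path is read; \<open>max 0\<close> in \<open>grid_time\<close> keeps it in the
  index set also for negative indices.\<close>

lemma eval_path_measurable: "eval_path \<in> borel \<Otimes>\<^sub>M path_space \<rightarrow>\<^sub>M borel"
proof -
  have "(\<lambda>p. eval_path p i) \<in> borel_measurable (borel \<Otimes>\<^sub>M path_space)" for i
  proof -
    have "(\<lambda>p. snd p (grid_time n \<lfloor>fst p * real (Suc n)\<rfloor>) i) \<in> borel_measurable (borel \<Otimes>\<^sub>M path_space)" for n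
    proof (rule measurable_compose_countable[where g="\<lambda>p. \<lfloor>fst p * real (Suc n)\<rfloor>"])
      show "(\<lambda>p. snd p (grid_time n k) i) \<in> borel_measurable (borel \<Otimes>\<^sub>M path_space)" for k
      proof -
        have "(\<lambda>w. w (grid_time n k)) \<in> path_space \<rightarrow>\<^sub>M borel"
          unfolding path_space_def by (rule measurable_component_singleton) (simp add: grid_time_def)
        from measurable_compose[OF measurable_snd measurable_compose[OF this measurable_coordinate[of i]]]
        show ?thesis .
      qed
    qed measurable
    from borel_measurable_lim_metric[OF this] show ?thesis by (simp add: eval_path_def case_prod_beta')
  qed
  then show ?thesis by (intro measurable_coordinatewise_then_product)
qed

lemma eval_path_continuous:
  assumes w: "continuous_on {0..} w" and t: "t \<ge> 0"
  shows "eval_path (t, restrict w {0..}) = w t"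
proof
  fix i
  let ?s = "\<lambda>n. grid_time n \<lfloor>t * real (Suc n)\<rfloor>"
  have s0: "?s n \<in> {0..}" for n by (simp add: grid_time_def)
  have s: "\<bar>?s n - t\<bar> \<le> 1 / real (Suc n)" for n
  proof -
    let ?k = "\<lfloor>t * real (Suc n)\<rfloor>"
    have k: "of_int ?k \<le> t * real (Suc n)" "t * real (Suc n) < of_int ?k + 1" by linarith+
    have "0 \<le> t * real (Suc n)" using t by simp
    then have "0 \<le> ?k" by simp
    then have "?s n = (of_int ?k + 1) / real (Suc n)" by (simp add: grid_time_def)
    moreover have "t \<le> (of_int ?k + 1) / real (Suc n)" using k by (simp add: pos_le_divide_eq)
    moreover have "(of_int ?k + 1) / real (Suc n) \<le> t + 1 / real (Suc n)"
      using k by (simp add: divide_simps distrib_right)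
    ultimately show ?thesis by linarith
  qed
  have "?s \<longlonglongrightarrow> t"
  proof (rule Lim_null_comparison[where g="\<lambda>n. 1 / real (Suc n)", THEN LIM_zero_cancel])
    show "\<forall>\<^sub>F n in sequentially. norm (?s n - t) \<le> 1 / real (Suc n)" using s by simp
    show "(\<lambda>n. 1 / real (Suc n)) \<longlonglongrightarrow> 0" by (rule LIMSEQ_Suc[OF lim_1_over_n])
  qed
  moreover have "continuous_on {0..} (\<lambda>t. w t i)"
    by (rule continuous_on_product_then_coordinatewise[OF w])
  ultimately have "(\<lambda>n. w (?s n) i) \<longlonglongrightarrow> w t i"
    using t s0 by (auto intro: continuous_on_tendsto_compose)
  then have "(\<lambda>n. restrict w {0..} (?s n) i) \<longlonglongrightarrow> w t i" using s0 by simp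
  then show "eval_path (t, restrict w {0..}) i = w t i" by (simp add: eval_path_def limI)
qed

lemma brownian_continuous:
  assumes "standard_brownian_motion M d W" "\<omega> \<in> space M"
  shows "continuous_on {0..} (\<lambda>t. W t \<omega>)" "t \<ge> 0 \<Longrightarrow> W t \<omega> \<in> Rd d"
proof -
  have "continuous_map (top_of_set {0..}) (Euclidean_space d) (\<lambda>t. W t \<omega>)"
    using assms by (simp add: standard_brownian_motion_def)
  then show "continuous_on {0..} (\<lambda>t. W t \<omega>)" "t \<ge> 0 \<Longrightarrow> W t \<omega> \<in> Rd d"
    by (subst (asm) Euclidean_space_eq, auto simp: continuous_map_in_subtopology image_subset_iff)+
qed

section \<open>Independence of paired families\<close>

context prob_space begin

lemma indep_vars_of_finite:
  assumes rv: "\<And>i. i \<in> I \<Longrightarrow> X i \<in> M \<rightarrow>\<^sub>M M' i"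
    and fin: "\<And>J. finite J \<Longrightarrow> J \<subseteq> I \<Longrightarrow> J \<noteq> {} \<Longrightarrow> indep_vars M' X J"
  shows "indep_vars M' X I"
  unfolding indep_vars_def2
proof (intro conjI ballI rv)
  show "indep_sets (\<lambda>i. {X i -` A \<inter> space M |A. A \<in> sets (M' i)}) I"
  proof (rule indep_setsI)
    fix i assume "i \<in> I"
    with rv show "{X i -` A \<inter> space M |A. A \<in> sets (M' i)} \<subseteq> events" by (auto intro: measurable_sets)
  next
    fix A J assume "J \<noteq> {}" "J \<subseteq> I" "finite J" "\<forall>j\<in>J. A j \<in> {X j -` A \<inter> space M |A. A \<in> sets (M' j)}"
    moreover then have "indep_sets (\<lambda>i. {X i -` A \<inter> space M |A. A \<in> sets (M' i)}) J"
      using fin[of J] by (simp add: indep_vars_def2)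
    ultimately show "prob (\<Inter>j\<in>J. A j) = (\<Prod>j\<in>J. prob (A j))"
      using indep_setsD[of _ J J A] by blast
  qed
qed

lemma vimage_prod_emb:
  assumes "\<And>i \<omega>. i \<in> I \<Longrightarrow> \<omega> \<in> space M \<Longrightarrow> X i \<omega> \<in> space N" and J: "J \<subseteq> I" "J \<noteq> {}"
  shows "(\<lambda>\<omega>. \<lambda>i\<in>I. X i \<omega>) -` prod_emb I (\<lambda>_. N) J (Pi\<^sub>E J A) \<inter> space M = (\<Inter>j\<in>J. X j -` A j \<inter> space M)"
  using J by (auto simp: prod_emb_def PiE_iff assms(1) subsetD[OF J(1)])

text \<open>Pairs are tested on rectangles, a generator stable under intersections. There the
  probability splits first between the two families and then within each; injectivity of
  \<open>\<phi>\<close> lets distinct pairs use distinct members of the second family.\<close>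

lemma indep_vars_pair:
  fixes X :: "'i \<Rightarrow> 'a \<Rightarrow> 'b" and Y :: "'k \<Rightarrow> 'a \<Rightarrow> 'c"
  assumes X: "indep_vars (\<lambda>_. N) X I" and Y: "indep_vars (\<lambda>_. N') Y K"
    and XY: "indep_rvs M (Pi\<^sub>M I (\<lambda>_. N)) (\<lambda>\<omega>. \<lambda>i\<in>I. X i \<omega>) (Pi\<^sub>M K (\<lambda>_. N')) (\<lambda>\<omega>. \<lambda>k\<in>K. Y k \<omega>)"
    and \<phi>: "inj_on \<phi> I" "\<phi> ` I \<subseteq> K"
  shows "indep_vars (\<lambda>_. N \<Otimes>\<^sub>M N') (\<lambda>i \<omega>. (X i \<omega>, Y (\<phi> i) \<omega>)) I"
    and "i \<in> I \<Longrightarrow> distr M (N \<Otimes>\<^sub>M N') (\<lambda>\<omega>. (X i \<omega>, Y (\<phi> i) \<omega>)) = distr M N (X i) \<Otimes>\<^sub>M distr M N' (Y (\<phi> i))"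
proof -
  have rX: "X i \<in> M \<rightarrow>\<^sub>M N" if "i \<in> I" for i using X that by (simp add: indep_vars_def)
  have rY: "Y (\<phi> i) \<in> M \<rightarrow>\<^sub>M N'" if "i \<in> I" for i using Y \<phi> that by (auto simp: indep_vars_def)
  have rXY: "(\<lambda>\<omega>. (X i \<omega>, Y (\<phi> i) \<omega>)) \<in> M \<rightarrow>\<^sub>M N \<Otimes>\<^sub>M N'" if "i \<in> I" for i
    using rX[OF that] rY[OF that] by (rule measurable_Pair)
  have split: "prob ((\<Inter>j\<in>J. X j -` A j \<inter> space M) \<inter> (\<Inter>j\<in>J. Y (\<phi> j) -` B j \<inter> space M)) =
      (\<Prod>j\<in>J. prob (X j -` A j \<inter> space M)) * (\<Prod>j\<in>J. prob (Y (\<phi> j) -` B j \<inter> space M))"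
    if J: "finite J" "J \<subseteq> I" "J \<noteq> {}" and A: "\<And>j. j \<in> J \<Longrightarrow> A j \<in> sets N" and B: "\<And>j. j \<in> J \<Longrightarrow> B j \<in> sets N'"
    for J A B
  proof -
    have subK: "\<phi> ` J \<subseteq> K" using J(2) \<phi>(2) by blast
    have inj: "inj_on \<phi> J" using \<phi>(1) J(2) by (rule inj_on_subset)
    \<comment> \<open>Transports the sets \<open>B\<close>, indexed by \<open>J\<close>, to the
      indices in the image of \<open>\<phi>\<close>.\<close>
    define B' where "B' k = B (the_inv_into J \<phi> k)" for k
    have B': "B' (\<phi> j) = B j" if "j \<in> J" for j using inj that by (simp add: B'_def the_inv_into_f_f)
    have sX: "(\<lambda>\<omega>. \<lambda>i\<in>I. X i \<omega>) -` prod_emb I (\<lambda>_. N) J (Pi\<^sub>E J A) \<inter> space M = (\<Inter>j\<in>J. X j -` A j \<inter> space M)"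
      using J by (intro vimage_prod_emb measurable_space[OF rX])
    have sY: "(\<lambda>\<omega>. \<lambda>k\<in>K. Y k \<omega>) -` prod_emb K (\<lambda>_. N') (\<phi> ` J) (Pi\<^sub>E (\<phi> ` J) B') \<inter> space M = (\<Inter>j\<in>J. Y (\<phi> j) -` B j \<inter> space M)"
    proof -
      have rYK: "Y k \<in> M \<rightarrow>\<^sub>M N'" if "k \<in> K" for k using Y that by (simp add: indep_vars_def)
      have "\<phi> ` J \<subseteq> K" "\<phi> ` J \<noteq> {}" using J \<phi> by auto
      then have "(\<lambda>\<omega>. \<lambda>k\<in>K. Y k \<omega>) -` prod_emb K (\<lambda>_. N') (\<phi> ` J) (Pi\<^sub>E (\<phi> ` J) B') \<inter> space M
        = (\<Inter>k\<in>\<phi> ` J. Y k -` B' k \<inter> space M)"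
        by (intro vimage_prod_emb measurable_space[OF rYK])
      then show ?thesis using B' by auto
    qed
    have "indep_set {(\<lambda>\<omega>. \<lambda>i\<in>I. X i \<omega>) -` A \<inter> space M |A. A \<in> sets (Pi\<^sub>M I (\<lambda>_. N))}
      {(\<lambda>\<omega>. \<lambda>k\<in>K. Y k \<omega>) -` A \<inter> space M |A. A \<in> sets (Pi\<^sub>M K (\<lambda>_. N'))}"
      using XY by (simp add: indep_rvs_def)
    then have "prob (((\<lambda>\<omega>. \<lambda>i\<in>I. X i \<omega>) -` prod_emb I (\<lambda>_. N) J (Pi\<^sub>E J A) \<inter> space M) \<inter>
        ((\<lambda>\<omega>. \<lambda>k\<in>K. Y k \<omega>) -` prod_emb K (\<lambda>_. N') (\<phi> ` J) (Pi\<^sub>E (\<phi> ` J) B') \<inter> space M)) =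
        prob ((\<lambda>\<omega>. \<lambda>i\<in>I. X i \<omega>) -` prod_emb I (\<lambda>_. N) J (Pi\<^sub>E J A) \<inter> space M) *
        prob ((\<lambda>\<omega>. \<lambda>k\<in>K. Y k \<omega>) -` prod_emb K (\<lambda>_. N') (\<phi> ` J) (Pi\<^sub>E (\<phi> ` J) B') \<inter> space M)"
    proof (rule indep_setD)
      have "prod_emb I (\<lambda>_. N) J (Pi\<^sub>E J A) \<in> sets (Pi\<^sub>M I (\<lambda>_. N))"
        using J A by (intro sets_PiM_I) auto
      then show "(\<lambda>\<omega>. \<lambda>i\<in>I. X i \<omega>) -` prod_emb I (\<lambda>_. N) J (Pi\<^sub>E J A) \<inter> space M
          \<in> {(\<lambda>\<omega>. \<lambda>i\<in>I. X i \<omega>) -` A \<inter> space M |A. A \<in> sets (Pi\<^sub>M I (\<lambda>_. N))}" by blast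
      have "prod_emb K (\<lambda>_. N') (\<phi> ` J) (Pi\<^sub>E (\<phi> ` J) B') \<in> sets (Pi\<^sub>M K (\<lambda>_. N'))"
        using J B B' subK by (intro sets_PiM_I) auto
      then show "(\<lambda>\<omega>. \<lambda>k\<in>K. Y k \<omega>) -` prod_emb K (\<lambda>_. N') (\<phi> ` J) (Pi\<^sub>E (\<phi> ` J) B') \<inter> space M
          \<in> {(\<lambda>\<omega>. \<lambda>k\<in>K. Y k \<omega>) -` A \<inter> space M |A. A \<in> sets (Pi\<^sub>M K (\<lambda>_. N'))}" by blast
    qed
    moreover have "prob (\<Inter>j\<in>J. X j -` A j \<inter> space M) = (\<Prod>j\<in>J. prob (X j -` A j \<inter> space M))"
      using J A by (intro indep_varsD[OF X]) auto
    moreover have "prob (\<Inter>j\<in>J. Y (\<phi> j) -` B j \<inter> space M) = (\<Prod>j\<in>J. prob (Y (\<phi> j) -` B j \<inter> space M))"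
    proof -
      have "(\<Inter>j\<in>J. Y (\<phi> j) -` B j \<inter> space M) = (\<Inter>k\<in>\<phi> ` J. Y k -` B' k \<inter> space M)"
        using B' by auto
      moreover have "prob (\<Inter>k\<in>\<phi> ` J. Y k -` B' k \<inter> space M) = (\<Prod>k\<in>\<phi> ` J. prob (Y k -` B' k \<inter> space M))"
        using J B B' subK by (intro indep_varsD[OF Y]) auto
      moreover have "\<dots> = (\<Prod>j\<in>J. prob (Y (\<phi> j) -` B j \<inter> space M))"
        using B' by (simp add: prod.reindex[OF inj])
      ultimately show ?thesis by simp
    qed
    ultimately show ?thesis unfolding sX sY by simp
  qed
  have one: "prob ((X j -` A \<inter> space M) \<inter> (Y (\<phi> j) -` B \<inter> space M)) = prob (X j -` A \<inter> space M) * prob (Y (\<phi> j) -` B \<inter> space M)"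
    if "j \<in> I" "A \<in> sets N" "B \<in> sets N'" for j A B
    using split[of "{j}" "\<lambda>_. A" "\<lambda>_. B"] that by simp
  have pre: "(\<lambda>\<omega>. (X j \<omega>, Y (\<phi> j) \<omega>)) -` (A \<times> B) \<inter> space M = (X j -` A \<inter> space M) \<inter> (Y (\<phi> j) -` B \<inter> space M)" for j A B
    by auto
  show "indep_vars (\<lambda>_. N \<Otimes>\<^sub>M N') (\<lambda>i \<omega>. (X i \<omega>, Y (\<phi> i) \<omega>)) I"
  proof (rule indep_vars_of_finite[OF rXY])
    fix J assume J: "finite J" "J \<subseteq> I" "J \<noteq> {}"
    let ?E = "{A \<times> B |A B. A \<in> sets N \<and> B \<in> sets N'}"
    show "indep_vars (\<lambda>_. N \<Otimes>\<^sub>M N') (\<lambda>i \<omega>. (X i \<omega>, Y (\<phi> i) \<omega>)) J"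
    proof (subst indep_vars_finite[where E="\<lambda>_. ?E"])
      show "sets (N \<Otimes>\<^sub>M N') = sigma_sets (space (N \<Otimes>\<^sub>M N')) ?E"
        by (simp add: sets_pair_measure space_pair_measure)
      show "Int_stable ?E" by (rule Int_stable_pair_measure_generator)
      show "space (N \<Otimes>\<^sub>M N') \<in> ?E" by (auto simp: space_pair_measure)
      show "?E \<subseteq> Pow (space (N \<Otimes>\<^sub>M N'))" by (auto simp: space_pair_measure dest: sets.sets_into_space)
      show "\<forall>A\<in>J \<rightarrow> ?E. prob (\<Inter>j\<in>J. (\<lambda>\<omega>. (X j \<omega>, Y (\<phi> j) \<omega>)) -` A j \<inter> space M) =
         (\<Prod>j\<in>J. prob ((\<lambda>\<omega>. (X j \<omega>, Y (\<phi> j) \<omega>)) -` A j \<inter> space M))"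
      proof
        fix C assume C: "C \<in> J \<rightarrow> ?E"
        then have "\<forall>j\<in>J. \<exists>A B. C j = A \<times> B \<and> A \<in> sets N \<and> B \<in> sets N'" by blast
        then obtain A B where AB: "\<And>j. j \<in> J \<Longrightarrow> C j = A j \<times> B j" "\<And>j. j \<in> J \<Longrightarrow> A j \<in> sets N" "\<And>j. j \<in> J \<Longrightarrow> B j \<in> sets N'"
          by metis
        have "(\<Inter>j\<in>J. (\<lambda>\<omega>. (X j \<omega>, Y (\<phi> j) \<omega>)) -` C j \<inter> space M) =
          (\<Inter>j\<in>J. X j -` A j \<inter> space M) \<inter> (\<Inter>j\<in>J. Y (\<phi> j) -` B j \<inter> space M)"
          using AB(1) J(3) by (auto simp: pre)
        then have "prob (\<Inter>j\<in>J. (\<lambda>\<omega>. (X j \<omega>, Y (\<phi> j) \<omega>)) -` C j \<inter> space M) =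
          (\<Prod>j\<in>J. prob (X j -` A j \<inter> space M) * prob (Y (\<phi> j) -` B j \<inter> space M))"
          using split[OF J AB(2,3)] by (simp add: prod.distrib)
        also have "\<dots> = (\<Prod>j\<in>J. prob ((\<lambda>\<omega>. (X j \<omega>, Y (\<phi> j) \<omega>)) -` C j \<inter> space M))"
          using J one AB by (intro prod.cong refl) (auto simp: pre)
        finally show "prob (\<Inter>j\<in>J. (\<lambda>\<omega>. (X j \<omega>, Y (\<phi> j) \<omega>)) -` C j \<inter> space M) =
          (\<Prod>j\<in>J. prob ((\<lambda>\<omega>. (X j \<omega>, Y (\<phi> j) \<omega>)) -` C j \<inter> space M))" .
      qed
    qed (use J rXY in auto)
  qed
  assume i: "i \<in> I"
  interpret PX: prob_space "distr M N (X i)" by (rule prob_space_distr[OF rX[OF i]])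
  interpret PY: prob_space "distr M N' (Y (\<phi> i))" by (rule prob_space_distr[OF rY[OF i]])
  show "distr M (N \<Otimes>\<^sub>M N') (\<lambda>\<omega>. (X i \<omega>, Y (\<phi> i) \<omega>)) = distr M N (X i) \<Otimes>\<^sub>M distr M N' (Y (\<phi> i))"
  proof (rule pair_measure_eqI[symmetric])
    fix A B assume AB: "A \<in> sets (distr M N (X i))" "B \<in> sets (distr M N' (Y (\<phi> i)))"
    then have "emeasure (distr M (N \<Otimes>\<^sub>M N') (\<lambda>\<omega>. (X i \<omega>, Y (\<phi> i) \<omega>))) (A \<times> B) =
      ennreal (prob ((X i -` A \<inter> space M) \<inter> (Y (\<phi> i) -` B \<inter> space M)))"
      using rXY[OF i] by (simp add: emeasure_distr pre emeasure_eq_measure)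
    also have "\<dots> = emeasure (distr M N (X i)) A * emeasure (distr M N' (Y (\<phi> i))) B"
      using AB one[OF i, of A B] rX[OF i] rY[OF i]
      by (simp add: emeasure_distr emeasure_eq_measure ennreal_mult)
    finally show "emeasure (distr M N (X i)) A * emeasure (distr M N' (Y (\<phi> i))) B =
      emeasure (distr M (N \<Otimes>\<^sub>M N') (\<lambda>\<omega>. (X i \<omega>, Y (\<phi> i) \<omega>))) (A \<times> B)" by simp
  qed (auto intro: PX.sigma_finite_measure_axioms PY.sigma_finite_measure_axioms)
qed

end

text \<open>\<open>pair\<close> makes time and path independent, so Fubini allows integrating over
  the path at a fixed time first; \<open>eval_path\<close> supplies the joint measurability. The
  transforms at a fixed time are then averaged against the exponential density.\<close>

lemma (in prob_space) brownian_at_exponential_time: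
  assumes W: "standard_brownian_motion M d W" and d: "d \<ge> 1" and lam: "lam > 0"
    and R: "R \<in> borel_measurable M" and R0: "\<And>\<omega>. \<omega> \<in> space M \<Longrightarrow> 0 \<le> R \<omega>"
    and law: "distr M borel R = density lborel (exponential_density lam)"
    and path: "sample_path W \<in> M \<rightarrow>\<^sub>M path_space"
    and pair: "distr M (borel \<Otimes>\<^sub>M path_space) (\<lambda>\<omega>. (R \<omega>, sample_path W \<omega>)) =
      distr M borel R \<Otimes>\<^sub>M distr M path_space (sample_path W)"
  shows "\<And>\<omega>. \<omega> \<in> space M \<Longrightarrow> W (R \<omega>) \<omega> = eval_path (R \<omega>, sample_path W \<omega>)"
    and "(\<lambda>\<omega>. W (R \<omega>) \<omega>) \<in> borel_measurable M"
    and "exp_gauss (distr M borel (\<lambda>\<omega>. W (R \<omega>) \<omega>)) d lam"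
    and "\<And>F :: (nat \<Rightarrow> real) \<Rightarrow> ennreal. F \<in> borel_measurable borel \<Longrightarrow>
      (\<integral>\<^sup>+\<omega>. F (W (R \<omega>) \<omega>) \<partial>M) = (\<integral>\<^sup>+t. (\<integral>\<^sup>+\<omega>. F (W t \<omega>) \<partial>M) \<partial>density lborel (exponential_density lam))"
proof -
  have ev: "eval_path (t, sample_path W \<omega>) = W t \<omega>" if "t \<ge> 0" "\<omega> \<in> space M" for t \<omega>
    using eval_path_continuous[OF brownian_continuous(1)[OF W that(2)] that(1)] by (simp add: sample_path_def)
  then show Zev: "W (R \<omega>) \<omega> = eval_path (R \<omega>, sample_path W \<omega>)" if "\<omega> \<in> space M" for \<omega>
    using R0[OF that] that by simp
  note [measurable] = R path eval_path_measurable
  let ?Z = "\<lambda>\<omega>. W (R \<omega>) \<omega>"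
  have "(\<lambda>\<omega>. eval_path (R \<omega>, sample_path W \<omega>)) \<in> borel_measurable M" by measurable
  then show Zm [measurable]: "?Z \<in> borel_measurable M"
    by (rule measurable_cong[THEN iffD2, rotated]) (rule Zev)
  let ?R = "distr M borel R" and ?W = "distr M path_space (sample_path W)"
  interpret PR: prob_space ?R by (rule prob_space_distr) measurable
  interpret PW: prob_space ?W by (rule prob_space_distr) measurable
  interpret PP: pair_prob_space ?R ?W ..
  have Rpos: "AE t in ?R. 0 \<le> t" using R0 by (subst AE_distr_iff) auto
  have nn: "(\<integral>\<^sup>+\<omega>. F (?Z \<omega>) \<partial>M) = (\<integral>\<^sup>+t. (\<integral>\<^sup>+\<omega>. F (W t \<omega>) \<partial>M) \<partial>?R)"
    if F [measurable]: "F \<in> borel_measurable borel" for F :: "(nat \<Rightarrow> real) \<Rightarrow> ennreal"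
  proof -
    have "(\<integral>\<^sup>+\<omega>. F (?Z \<omega>) \<partial>M) = (\<integral>\<^sup>+\<omega>. F (eval_path (R \<omega>, sample_path W \<omega>)) \<partial>M)"
      by (intro nn_integral_cong) (simp add: Zev)
    also have "\<dots> = (\<integral>\<^sup>+p. F (eval_path p) \<partial>distr M (borel \<Otimes>\<^sub>M path_space) (\<lambda>\<omega>. (R \<omega>, sample_path W \<omega>)))"
      by (rule nn_integral_distr[symmetric]) measurable
    also have "\<dots> = (\<integral>\<^sup>+t. \<integral>\<^sup>+w. F (eval_path (t, w)) \<partial>?W \<partial>?R)"
      unfolding pair by (rule PW.nn_integral_fst[symmetric]) measurable
    also have "\<dots> = (\<integral>\<^sup>+t. (\<integral>\<^sup>+\<omega>. F (W t \<omega>) \<partial>M) \<partial>?R)"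
    proof (rule nn_integral_cong_AE, use Rpos in eventually_elim)
      fix t :: real assume t: "0 \<le> t"
      have "(\<integral>\<^sup>+w. F (eval_path (t, w)) \<partial>?W) = (\<integral>\<^sup>+\<omega>. F (eval_path (t, sample_path W \<omega>)) \<partial>M)"
        by (rule nn_integral_distr) measurable
      also have "\<dots> = (\<integral>\<^sup>+\<omega>. F (W t \<omega>) \<partial>M)" by (intro nn_integral_cong) (simp add: ev[OF t])
      finally show "(\<integral>\<^sup>+w. F (eval_path (t, w)) \<partial>?W) = (\<integral>\<^sup>+\<omega>. F (W t \<omega>) \<partial>M)" .
    qed
    finally show ?thesis .
  qed
  then show "(\<integral>\<^sup>+\<omega>. F (W (R \<omega>) \<omega>) \<partial>M) = (\<integral>\<^sup>+t. (\<integral>\<^sup>+\<omega>. F (W t \<omega>) \<partial>M) \<partial>density lborel (exponential_density lam))"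
    if "F \<in> borel_measurable borel" for F :: "(nat \<Rightarrow> real) \<Rightarrow> ennreal" using that unfolding law by blast
  \<comment> \<open>The same disintegration for bounded complex integrands, as the characteristic
    function requires.\<close>
  have cl: "(CLINT \<omega>|M. F (?Z \<omega>)) = (CLINT t|?R. G t)"
    if F [measurable]: "F \<in> borel_measurable borel" and b: "\<And>x. norm (F x) \<le> 1"
      and G [measurable]: "G \<in> borel_measurable borel"
      and FG: "\<And>t. 0 \<le> t \<Longrightarrow> (CLINT \<omega>|M. F (W t \<omega>)) = G t" for F :: "(nat \<Rightarrow> real) \<Rightarrow> complex" and G
  proof -
    have "(CLINT \<omega>|M. F (?Z \<omega>)) = (CLINT \<omega>|M. F (eval_path (R \<omega>, sample_path W \<omega>)))"
      by (intro Bochner_Integration.integral_cong) (simp_all add: Zev)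
    also have "\<dots> = (CLINT p|distr M (borel \<Otimes>\<^sub>M path_space) (\<lambda>\<omega>. (R \<omega>, sample_path W \<omega>)). F (eval_path p))"
      by (rule integral_distr[symmetric]) measurable
    also have "\<dots> = (CLINT t|?R. CLINT w|?W. F (eval_path (t, w)))"
    proof -
      have "integrable (?R \<Otimes>\<^sub>M ?W) (\<lambda>p. F (eval_path p))"
        using b by (intro PP.P.integrable_const_bound[of _ 1]) (auto, measurable)
      from PP.integral_fst'[OF this] show ?thesis unfolding pair by simp
    qed
    also have "\<dots> = (CLINT t|?R. G t)"
    proof (rule integral_cong_AE)
      have inner: "(CLINT w|?W. F (eval_path (t, w))) = (CLINT \<omega>|M. F (eval_path (t, sample_path W \<omega>)))" for t
        by (rule integral_distr) measurable
      show "(\<lambda>t. CLINT w|?W. F (eval_path (t, w))) \<in> borel_measurable ?R"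
        by (rule PW.borel_measurable_lebesgue_integral) measurable
      have eq: "(CLINT w|?W. F (eval_path (t, w))) = G t" if t: "0 \<le> t" for t
      proof -
        have "(CLINT w|?W. F (eval_path (t, w))) = (CLINT \<omega>|M. F (W t \<omega>))"
          unfolding inner by (intro Bochner_Integration.integral_cong) (simp_all add: ev[OF t])
        then show ?thesis by (simp only: FG[OF t])
      qed
      show "AE t in ?R. (CLINT w|?W. F (eval_path (t, w))) = G t"
        using Rpos by eventually_elim (rule eq)
    qed measurable
    finally show ?thesis .
  qed
  have char: "(CLINT \<omega>|M. iexp (dotd d \<kappa> (?Z \<omega>))) = complex_of_real (lam / (lam + sqd d \<kappa> / 2))" for \<kappa>
  proof -
    define c where "c = sqd d \<kappa> / 2"
    have c: "0 \<le> c" by (simp add: c_def sqd_def sum_nonneg)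
    have "(CLINT \<omega>|M. iexp (dotd d \<kappa> (?Z \<omega>))) = (CLINT t|?R. complex_of_real (exp (- c * t)))"
    proof (rule cl[of "\<lambda>x. iexp (dotd d \<kappa> x)"])
      show "(CLINT \<omega>|M. iexp (dotd d \<kappa> (W t \<omega>))) = complex_of_real (exp (- c * t))" if "0 \<le> t" for t
        using brownian_iexp[OF W that, of \<kappa>] by (simp only: c_def) (simp add: mult.commute)
      show "norm (iexp (dotd d \<kappa> x)) \<le> 1" for x by simp
    qed measurable
    also have "\<dots> = complex_of_real (\<integral>t. exp (- c * t) \<partial>?R)" by (rule integral_complex_of_real)
    also have "(\<integral>t. exp (- c * t) \<partial>?R) = lam / (lam + c)"
      using nn_integral_exponential_exp[OF lam, of c] lam c
      by (subst integral_eq_nn_integral) (simp_all add: law)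
    finally show ?thesis by (simp only: c_def)
  qed
  have expn: "(\<integral>\<^sup>+\<omega>. ennreal (exp (dotd d \<kappa> (?Z \<omega>))) \<partial>M) = ennreal (lam / (lam - sqd d \<kappa> / 2))"
    if s: "sqd d \<kappa> / 2 < lam" for \<kappa>
  proof -
    have "(\<integral>\<^sup>+\<omega>. ennreal (exp (dotd d \<kappa> (?Z \<omega>))) \<partial>M) = (\<integral>\<^sup>+t. (\<integral>\<^sup>+\<omega>. ennreal (exp (dotd d \<kappa> (W t \<omega>))) \<partial>M) \<partial>?R)"
      by (rule nn) measurable
    \<comment> \<open>The growth exp(t |\<kappa>|^2 / 2) corresponds to the negative parameter c =
      -|\<kappa>|^2 / 2, admissible because of \<open>s\<close>.\<close>
    also have "\<dots> = (\<integral>\<^sup>+t. ennreal (exp (- (- (sqd d \<kappa> / 2)) * t)) \<partial>?R)"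
      by (rule nn_integral_cong_AE, use Rpos in eventually_elim) (simp add: brownian_exp[OF W] mult.commute)
    also have "\<dots> = ennreal (lam / (lam + - (sqd d \<kappa> / 2)))"
      unfolding law by (rule nn_integral_exponential_exp[OF lam]) (use s in simp)
    finally show ?thesis by simp
  qed
  let ?\<nu> = "distr M borel ?Z"
  have iexp_int: "integrable M (\<lambda>\<omega>. iexp (dotd d \<kappa> (?Z \<omega>)))" for \<kappa>
    by (rule integrable_const_bound[of _ 1]) (simp, measurable)
  show "exp_gauss ?\<nu> d lam"
  proof (intro exp_gauss.intro exp_gauss_axioms.intro)
    show "prob_space ?\<nu>" by (rule prob_space_distr) measurable
    show "sets ?\<nu> = sets borel" by simp
    show "0 < lam" "1 \<le> d" using lam d by auto
    fix \<kappa>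
    have "(\<integral>z. cos (dotd d \<kappa> z) \<partial>?\<nu>) = (\<integral>\<omega>. Re (iexp (dotd d \<kappa> (?Z \<omega>))) \<partial>M)"
      by (subst integral_distr) (measurable, simp add: Re_exp)
    also have "\<dots> = Re (CLINT \<omega>|M. iexp (dotd d \<kappa> (?Z \<omega>)))"
      by (rule integral_bounded_linear[OF bounded_linear_Re iexp_int])
    finally show "(\<integral>z. cos (dotd d \<kappa> z) \<partial>?\<nu>) = lam / (lam + sqd d \<kappa> / 2)" unfolding char by simp
    have "(\<integral>z. sin (dotd d \<kappa> z) \<partial>?\<nu>) = (\<integral>\<omega>. Im (iexp (dotd d \<kappa> (?Z \<omega>))) \<partial>M)"
      by (subst integral_distr) (measurable, simp add: Im_exp)
    also have "\<dots> = Im (CLINT \<omega>|M. iexp (dotd d \<kappa> (?Z \<omega>)))"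
      by (rule integral_bounded_linear[OF bounded_linear_Im iexp_int])
    finally show "(\<integral>z. sin (dotd d \<kappa> z) \<partial>?\<nu>) = 0" unfolding char by simp
    assume s: "sqd d \<kappa> / 2 < lam"
    have n: "(\<integral>\<^sup>+z. ennreal (exp (dotd d \<kappa> z)) \<partial>?\<nu>) = ennreal (lam / (lam - sqd d \<kappa> / 2))"
      using expn[OF s] by (subst nn_integral_distr) simp_all
    then show "integrable ?\<nu> (\<lambda>z. exp (dotd d \<kappa> z))"
      by (intro integrableI_nonneg) simp_all
    show "(\<integral>z. exp (dotd d \<kappa> z) \<partial>?\<nu>) = lam / (lam - sqd d \<kappa> / 2)"
      using n s lam by (subst integral_eq_nn_integral) simp_all
  qed
qed

text \<open>A reference law that mentions no Brownian motion: through it the laws for all indices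
  are identified with each other. Coordinates from d on are 0, as in \<open>Rd d\<close>.\<close>

definition gauss_law :: "nat \<Rightarrow> real \<Rightarrow> (nat \<Rightarrow> real) measure" where
  "gauss_law d t = distr (Pi\<^sub>M {..<d} (\<lambda>_. density lborel (normal_density 0 (sqrt t)))) borel
     (\<lambda>p i. if i < d then p i else 0)"

lemma extend_measurable:
  "(\<lambda>p i. if i < (d :: nat) then p i else (0::real)) \<in> Pi\<^sub>M {..<d} (\<lambda>_. borel) \<rightarrow>\<^sub>M borel"
proof (rule measurable_coordinatewise_then_product)
  fix i
  show "(\<lambda>p. if i < d then p i else (0::real)) \<in> borel_measurable (Pi\<^sub>M {..<d} (\<lambda>_. borel))"
    by (cases "i < d") (auto intro: measurable_component_singleton)
qed

text \<open>Independence of the coordinate increments makes their joint law a product; the paths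
  stay in \<open>Rd d\<close>, so extension by 0 recovers the whole vector.\<close>

lemma (in prob_space) brownian_marginal:
  assumes W: "standard_brownian_motion M d W" and d: "d \<ge> 1" and t: "t > 0"
  shows "distr M borel (W t) = gauss_law d t"
proof -
  let ?D = "\<lambda>i \<omega>. W t \<omega> i - W 0 \<omega> i"
  let ?ext = "\<lambda>p i. if i < d then p i else (0::real)"
  have t0: "0 \<le> t" using t by simp
  have Wm [measurable]: "W t \<in> borel_measurable M" by (rule brownian_measurable[OF W t0])
  have rv: "?D i \<in> borel_measurable M" if "i \<in> {..<d}" for i
    using distributed_measurable[OF brownian_increment(2)[OF W t, of i]] that by simp
  have law: "distr M borel (?D i) = density lborel (normal_density 0 (sqrt t))" if "i \<in> {..<d}" for i
  proof -
    have "distr M borel (?D i) = distr M lborel (?D i)" by (rule distr_cong) simp_all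
    then show ?thesis using distributed_distr_eq_density[OF brownian_increment(2)[OF W t, of i]] that by simp
  qed
  have ne: "{..<d} \<noteq> {}" using d by (auto simp: lessThan_empty_iff)
  have tm: "(\<lambda>\<omega>. \<lambda>i\<in>{..<d}. ?D i \<omega>) \<in> M \<rightarrow>\<^sub>M Pi\<^sub>M {..<d} (\<lambda>_. borel)"
    by (intro measurable_restrict rv)
  have "distr M (Pi\<^sub>M {..<d} (\<lambda>_. borel)) (\<lambda>\<omega>. \<lambda>i\<in>{..<d}. ?D i \<omega>) = Pi\<^sub>M {..<d} (\<lambda>i. distr M borel (?D i))"
    using brownian_increment(1)[OF W t] indep_vars_iff_distr_eq_PiM'[OF ne rv] by simp
  also have "\<dots> = Pi\<^sub>M {..<d} (\<lambda>_. density lborel (normal_density 0 (sqrt t)))"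
    by (intro PiM_cong refl law)
  finally have joint: "distr M (Pi\<^sub>M {..<d} (\<lambda>_. borel)) (\<lambda>\<omega>. \<lambda>i\<in>{..<d}. ?D i \<omega>) =
    Pi\<^sub>M {..<d} (\<lambda>_. density lborel (normal_density 0 (sqrt t)))" .
  have em: "(?ext \<circ> (\<lambda>\<omega>. \<lambda>i\<in>{..<d}. ?D i \<omega>)) \<in> borel_measurable M"
    using measurable_compose[OF tm extend_measurable] by (simp add: comp_def)
  have "AE \<omega> in M. W 0 \<omega> = (\<lambda>i. 0)" using W by (simp add: standard_brownian_motion_def)
  then have ae: "AE \<omega> in M. W t \<omega> = (?ext \<circ> (\<lambda>\<omega>. \<lambda>i\<in>{..<d}. ?D i \<omega>)) \<omega>"
  proof (rule AE_mp, intro AE_I2 impI)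
    fix \<omega> assume \<omega>: "\<omega> \<in> space M" and 0: "W 0 \<omega> = (\<lambda>i. 0)"
    have "W t \<omega> \<in> Rd d" by (rule brownian_continuous(2)[OF W \<omega> t0])
    then show "W t \<omega> = (?ext \<circ> (\<lambda>\<omega>. \<lambda>i\<in>{..<d}. ?D i \<omega>)) \<omega>"
      using 0 by (intro ext) (auto simp: Rd_iff not_less)
  qed
  have "distr M borel (W t) = distr M borel (?ext \<circ> (\<lambda>\<omega>. \<lambda>i\<in>{..<d}. ?D i \<omega>))"
    by (rule distr_cong_AE[OF refl refl ae Wm em])
  also have "\<dots> = distr (distr M (Pi\<^sub>M {..<d} (\<lambda>_. borel)) (\<lambda>\<omega>. \<lambda>i\<in>{..<d}. ?D i \<omega>)) borel ?ext"
    by (rule distr_distr[OF extend_measurable tm, symmetric])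
  also have "\<dots> = gauss_law d t" unfolding joint gauss_law_def ..
  finally show ?thesis .
qed

subsection \<open>Square integrable random variables and Monte Carlo averages\<close>

text \<open>Bounding the nonnegative integral also asserts square integrability; the Bochner
  integral would be 0 for a function whose square is not integrable.\<close>

definition L2_le :: "'a measure \<Rightarrow> ('a \<Rightarrow> real) \<Rightarrow> real \<Rightarrow> bool" where
  "L2_le M f c \<longleftrightarrow> f \<in> borel_measurable M \<and> 0 \<le> c \<and> (\<integral>\<^sup>+x. ennreal ((f x)\<^sup>2) \<partial>M) \<le> ennreal (c\<^sup>2)"

lemma L2_leD:
  assumes "L2_le M f c"
  shows "f \<in> borel_measurable M" "0 \<le> c" "integrable M (\<lambda>x. (f x)\<^sup>2)" "(\<integral>x. (f x)\<^sup>2 \<partial>M) \<le> c\<^sup>2"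
proof -
  have m: "f \<in> borel_measurable M" and le: "(\<integral>\<^sup>+x. ennreal ((f x)\<^sup>2) \<partial>M) \<le> ennreal (c\<^sup>2)"
    using assms by (auto simp: L2_le_def)
  show "f \<in> borel_measurable M" "0 \<le> c" using assms by (auto simp: L2_le_def)
  show i: "integrable M (\<lambda>x. (f x)\<^sup>2)"
    using m by (intro integrableI_nonneg) (simp_all add: le_less_trans[OF le ennreal_less_top])
  have "ennreal (\<integral>x. (f x)\<^sup>2 \<partial>M) \<le> ennreal (c\<^sup>2)"
    using le by (subst nn_integral_eq_integral[OF i, symmetric]) auto
  then show "(\<integral>x. (f x)\<^sup>2 \<partial>M) \<le> c\<^sup>2"
    by (simp add: ennreal_le_iff)
qed

lemma L2_leI:
  assumes "f \<in> borel_measurable M" "0 \<le> c" "integrable M (\<lambda>x. (f x)\<^sup>2)" "(\<integral>x. (f x)\<^sup>2 \<partial>M) \<le> c\<^sup>2"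
  shows "L2_le M f c"
  using assms by (simp add: L2_le_def nn_integral_eq_integral ennreal_leI)

lemma L2_le_mono: "L2_le M f c \<Longrightarrow> c \<le> c' \<Longrightarrow> L2_le M f c'"
  unfolding L2_le_def by (auto intro: order_trans ennreal_leI power_mono)

lemma L2_le_dominated:
  assumes g: "L2_le M g c" and f: "f \<in> borel_measurable M" and K: "0 \<le> K"
    and le: "\<And>x. x \<in> space M \<Longrightarrow> \<bar>f x\<bar> \<le> K * \<bar>g x\<bar>"
  shows "L2_le M f (K * c)"
proof -
  have [measurable]: "g \<in> borel_measurable M" using g by (rule L2_leD)
  have "(\<integral>\<^sup>+x. ennreal ((f x)\<^sup>2) \<partial>M) \<le> (\<integral>\<^sup>+x. ennreal (K\<^sup>2) * ennreal ((g x)\<^sup>2) \<partial>M)"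
  proof (rule nn_integral_mono)
    fix x assume "x \<in> space M"
    then have "\<bar>f x\<bar>\<^sup>2 \<le> (K * \<bar>g x\<bar>)\<^sup>2" using le by (intro power_mono) auto
    then show "ennreal ((f x)\<^sup>2) \<le> ennreal (K\<^sup>2) * ennreal ((g x)\<^sup>2)"
      by (simp add: ennreal_mult[symmetric] power_mult_distrib ennreal_leI)
  qed
  also have "\<dots> = ennreal (K\<^sup>2) * (\<integral>\<^sup>+x. ennreal ((g x)\<^sup>2) \<partial>M)" by (rule nn_integral_cmult) simp
  also have "\<dots> \<le> ennreal (K\<^sup>2) * ennreal (c\<^sup>2)" using g by (intro mult_left_mono) (auto simp: L2_le_def)
  finally show ?thesis using f K g
    by (auto simp: L2_le_def ennreal_mult[symmetric] power_mult_distrib)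
qed

lemma L2_le_zero: "L2_le M (\<lambda>_. 0) 0"
  by (simp add: L2_le_def)

text \<open>Minkowski's inequality from 2 f g <= (b/a) f^2 + (a/b) g^2, whose weights fit norms a
  and b. The weights need positive numbers, so both bounds are enlarged by e, and e tends to
  0.\<close>

lemma L2_le_add:
  assumes f: "L2_le M f a" and g: "L2_le M g b"
  shows "L2_le M (\<lambda>x. f x + g x) (a + b)"
proof -
  note F = L2_leD[OF f] and G = L2_leD[OF g]
  have [measurable]: "f \<in> borel_measurable M" "g \<in> borel_measurable M" using F G by auto
  have pos: "(\<integral>\<^sup>+x. ennreal ((f x + g x)\<^sup>2) \<partial>M) \<le> ennreal ((a' + b')\<^sup>2)"
    if a': "a' > 0" "a \<le> a'" and b': "b' > 0" "b \<le> b'" for a' b'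
  proof -
    have "(\<integral>\<^sup>+x. ennreal ((f x + g x)\<^sup>2) \<partial>M) \<le>
        (\<integral>\<^sup>+x. ennreal (1 + b'/a') * ennreal ((f x)\<^sup>2) + ennreal (1 + a'/b') * ennreal ((g x)\<^sup>2) \<partial>M)"
    proof (rule nn_integral_mono)
      fix x
      have "0 \<le> (b' * f x - a' * g x)\<^sup>2 / (a' * b')" using a' b' by simp
      also have "\<dots> = b'/a' * (f x)\<^sup>2 + a'/b' * (g x)\<^sup>2 - 2 * f x * g x"
        using a' b' by (simp add: field_simps power2_eq_square)
      finally have "(f x + g x)\<^sup>2 \<le> (1 + b'/a') * (f x)\<^sup>2 + (1 + a'/b') * (g x)\<^sup>2"
        by (simp add: algebra_simps power2_eq_square)
      then show "ennreal ((f x + g x)\<^sup>2) \<le>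
          ennreal (1 + b'/a') * ennreal ((f x)\<^sup>2) + ennreal (1 + a'/b') * ennreal ((g x)\<^sup>2)"
        using a' b' by (simp add: ennreal_mult[symmetric] ennreal_plus[symmetric] ennreal_leI del: ennreal_plus)
    qed
    also have "\<dots> = ennreal (1 + b'/a') * (\<integral>\<^sup>+x. ennreal ((f x)\<^sup>2) \<partial>M)
        + ennreal (1 + a'/b') * (\<integral>\<^sup>+x. ennreal ((g x)\<^sup>2) \<partial>M)"
      by (simp add: nn_integral_add nn_integral_cmult)
    also have "\<dots> \<le> ennreal (1 + b'/a') * ennreal (a'\<^sup>2) + ennreal (1 + a'/b') * ennreal (b'\<^sup>2)"
      using L2_le_mono[OF f a'(2)] L2_le_mono[OF g b'(2)]
      by (intro add_mono mult_left_mono) (auto simp: L2_le_def)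
    also have "\<dots> = ennreal ((1 + b'/a') * a'\<^sup>2 + (1 + a'/b') * b'\<^sup>2)"
      using a' b' by (simp add: ennreal_mult[symmetric] ennreal_plus[symmetric] del: ennreal_plus)
    also have "(1 + b'/a') * a'\<^sup>2 + (1 + a'/b') * b'\<^sup>2 = (a' + b')\<^sup>2"
      using a' b' by (simp add: field_simps power2_eq_square)
    finally show ?thesis .
  qed
  have i: "integrable M (\<lambda>x. (f x + g x)\<^sup>2)"
    using F G by (intro integrableI_nonneg)
      (simp_all add: le_less_trans[OF pos[of "a + 1" "b + 1"] ennreal_less_top])
  have "(\<integral>x. (f x + g x)\<^sup>2 \<partial>M) \<le> (a + e + (b + e))\<^sup>2" if "e > 0" for e
  proof -
    have "(\<integral>\<^sup>+x. ennreal ((f x + g x)\<^sup>2) \<partial>M) \<le> ennreal ((a + e + (b + e))\<^sup>2)"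
      using F G that by (intro pos) auto
    then show ?thesis by (simp add: nn_integral_eq_integral[OF i] ennreal_le_iff)
  qed
  then have "\<forall>\<^sub>F e in at_right 0. (\<integral>x. (f x + g x)\<^sup>2 \<partial>M) \<le> (a + e + (b + e))\<^sup>2"
    by (simp add: eventually_at_filter)
  moreover have "((\<lambda>e. (a + e + (b + e))\<^sup>2) \<longlongrightarrow> (a + 0 + (b + 0))\<^sup>2) (at_right 0)"
    by (intro tendsto_intros)
  ultimately have "(\<integral>x. (f x + g x)\<^sup>2 \<partial>M) \<le> (a + 0 + (b + 0))\<^sup>2"
    by (intro tendsto_lowerbound) auto
  then show ?thesis using i F G by (intro L2_leI) auto
qed

lemma L2_le_sum:
  assumes "finite I" "\<And>i. i \<in> I \<Longrightarrow> L2_le M (f i) (c i)"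
  shows "L2_le M (\<lambda>x. \<Sum>i\<in>I. f i x) (\<Sum>i\<in>I. c i)"
  using assms by (induction I rule: finite_induct) (auto intro: L2_le_zero L2_le_add)

lemma L2_le_diff:
  assumes "L2_le M f a" "L2_le M g b"
  shows "L2_le M (\<lambda>x. f x - g x) (a + b)"
proof -
  have "L2_le M (\<lambda>x. - g x) (1 * b)"
    using L2_leD(1)[OF assms(2)] by (intro L2_le_dominated[OF assms(2)]) auto
  from L2_le_add[OF assms(1) this] show ?thesis by simp
qed

section \<open>Means, centring and averages on a probability space\<close>

context prob_space begin

lemma L2_le_const: "L2_le M (\<lambda>_. k) \<bar>k\<bar>"
  by (simp add: L2_le_def emeasure_space_1)

lemma L2_le_integrable:
  assumes "L2_le M f c" shows "integrable M f"
  using L2_leD[OF assms] by (auto intro: square_integrable_imp_integrable)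

text \<open>Jensen's inequality, read off from the nonnegativity of the variance.\<close>

lemma L2_le_expectation_abs:
  assumes "L2_le M f c" shows "(\<integral>x. \<bar>f x\<bar> \<partial>M) \<le> c"
proof -
  note F = L2_leD[OF assms]
  have "(\<integral>x. \<bar>f x\<bar> \<partial>M)\<^sup>2 \<le> (\<integral>x. \<bar>f x\<bar>\<^sup>2 \<partial>M)"
  proof -
    have "0 \<le> variance (\<lambda>x. \<bar>f x\<bar>)" by (rule variance_positive)
    also have "\<dots> = (\<integral>x. \<bar>f x\<bar>\<^sup>2 \<partial>M) - (\<integral>x. \<bar>f x\<bar> \<partial>M)\<^sup>2"
      using F L2_le_integrable[OF assms] by (intro variance_eq) auto
    finally show ?thesis by simp
  qed
  also have "\<dots> \<le> c\<^sup>2" using F by simp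
  finally show ?thesis using F(2) by (rule power2_le_imp_le)
qed

lemma L2_le_expectation:
  assumes "L2_le M f c" shows "\<bar>expectation f\<bar> \<le> c"
  using integral_abs_bound[of M f] L2_le_expectation_abs[OF assms] by linarith

lemma L2_le_center:
  assumes "L2_le M f c" shows "L2_le M (\<lambda>x. f x - expectation f) c"
proof -
  note F = L2_leD[OF assms]
  have i: "integrable M f" by (rule L2_le_integrable[OF assms])
  have "expectation (\<lambda>x. (f x - expectation f)\<^sup>2) = expectation (\<lambda>x. (f x)\<^sup>2) - (expectation f)\<^sup>2"
    by (rule variance_eq[OF i F(3)])
  moreover have "integrable M (\<lambda>x. (f x)\<^sup>2 - 2 * expectation f * f x + (expectation f)\<^sup>2)"
    using F i by auto
  then have "integrable M (\<lambda>x. (f x - expectation f)\<^sup>2)"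
    by (simp add: power2_diff algebra_simps)
  moreover have "expectation (\<lambda>x. (f x)\<^sup>2) - (expectation f)\<^sup>2 \<le> c\<^sup>2"
    using F(4) zero_le_power2[of "expectation f"] by linarith
  ultimately show ?thesis using F by (intro L2_leI) auto
qed

text \<open>Pairwise independence makes the mixed terms of the centred square vanish.\<close>

lemma L2_le_monte_carlo:
  fixes X :: "nat \<Rightarrow> 'a \<Rightarrow> real"
  assumes N: "N \<ge> 1" and X: "\<And>m. m \<in> {1..N} \<Longrightarrow> L2_le M (X m) c"
    and mean: "\<And>m. m \<in> {1..N} \<Longrightarrow> expectation (X m) = \<mu>"
    and ind: "\<And>m m'. m \<in> {1..N} \<Longrightarrow> m' \<in> {1..N} \<Longrightarrow> m \<noteq> m' \<Longrightarrow> indep_var borel (X m) borel (X m')"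
  shows "L2_le M (\<lambda>\<omega>. 1 / real N * (\<Sum>m=1..N. X m \<omega>) - \<mu>) (c / sqrt (real N))"
proof -
  have c: "0 \<le> c" using L2_leD(2)[OF X[of 1]] N by simp
  define D where "D m \<omega> = X m \<omega> - \<mu>" for m \<omega>
  have D: "L2_le M (D m) c" if "m \<in> {1..N}" for m
    using L2_le_center[OF X[OF that]] mean[OF that] by (simp add: D_def[abs_def])
  have [measurable]: "D m \<in> borel_measurable M" if "m \<in> {1..N}" for m
    using D[OF that] by (rule L2_leD)
  have Di: "integrable M (D m)" if "m \<in> {1..N}" for m using L2_le_integrable[OF D[OF that]] .
  have D0: "expectation (D m) = 0" if "m \<in> {1..N}" for m
    using L2_le_integrable[OF X[OF that]] mean[OF that] by (simp add: D_def[abs_def] prob_space)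
  have cross: "integrable M (\<lambda>\<omega>. D m \<omega> * D m' \<omega>)"
      "expectation (\<lambda>\<omega>. D m \<omega> * D m' \<omega>) = (if m = m' then expectation (\<lambda>\<omega>. (D m \<omega>)\<^sup>2) else 0)"
    if m: "m \<in> {1..N}" "m' \<in> {1..N}" for m m'
  proof -
    have "integrable M (\<lambda>\<omega>. D m \<omega> * D m' \<omega>) \<and>
      expectation (\<lambda>\<omega>. D m \<omega> * D m' \<omega>) = (if m = m' then expectation (\<lambda>\<omega>. (D m \<omega>)\<^sup>2) else 0)"
    proof (cases "m = m'")
      case True
      then show ?thesis using L2_leD(3)[OF D[OF m(1)]] by (simp add: power2_eq_square)
    next
      case False
      have "indep_var borel ((\<lambda>v. v - \<mu>) \<circ> X m) borel ((\<lambda>v. v - \<mu>) \<circ> X m')"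
        by (intro indep_var_compose[OF ind[OF m False]]) auto
      then have i: "indep_var borel (D m) borel (D m')" by (simp add: comp_def D_def[abs_def])
      show ?thesis
        using indep_var_integrable[OF i Di[OF m(1)] Di[OF m(2)]]
          indep_var_lebesgue_integral[OF i Di[OF m(1)] Di[OF m(2)]] D0 m False by simp
    qed
    then show "integrable M (\<lambda>\<omega>. D m \<omega> * D m' \<omega>)"
      "expectation (\<lambda>\<omega>. D m \<omega> * D m' \<omega>) = (if m = m' then expectation (\<lambda>\<omega>. (D m \<omega>)\<^sup>2) else 0)" by auto
  qed
  have sq: "(\<Sum>m=1..N. D m \<omega>)\<^sup>2 = (\<Sum>m=1..N. \<Sum>m'=1..N. D m \<omega> * D m' \<omega>)" for \<omega>
    by (simp add: power2_eq_square sum_product)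
  have i: "integrable M (\<lambda>\<omega>. (\<Sum>m=1..N. D m \<omega>)\<^sup>2)"
    unfolding sq by (intro Bochner_Integration.integrable_sum cross)
  have "expectation (\<lambda>\<omega>. (\<Sum>m=1..N. D m \<omega>)\<^sup>2) = (\<Sum>m=1..N. \<Sum>m'=1..N. expectation (\<lambda>\<omega>. D m \<omega> * D m' \<omega>))"
    unfolding sq by (subst Bochner_Integration.integral_sum, intro Bochner_Integration.integrable_sum cross, simp_all)
       (intro sum.cong refl Bochner_Integration.integral_sum cross, simp_all)
  also have "\<dots> = (\<Sum>m=1..N. \<Sum>m'=1..N. if m = m' then expectation (\<lambda>\<omega>. (D m \<omega>)\<^sup>2) else 0)"
    by (intro sum.cong refl cross)
  also have "\<dots> = (\<Sum>m=1..N. expectation (\<lambda>\<omega>. (D m \<omega>)\<^sup>2))" by simp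
  also have "\<dots> \<le> (\<Sum>m=1..N. c\<^sup>2)" by (intro sum_mono) (rule L2_leD(4)[OF D])
  also have "\<dots> = (c * sqrt (real N))\<^sup>2" by (simp add: power_mult_distrib)
  finally have S: "L2_le M (\<lambda>\<omega>. \<Sum>m=1..N. D m \<omega>) (c * sqrt (real N))"
    using i c by (intro L2_leI) auto
  have eq: "1 / real N * (\<Sum>m=1..N. X m \<omega>) - \<mu> = 1 / real N * (\<Sum>m=1..N. D m \<omega>)" for \<omega>
    using N by (simp add: D_def sum_subtractf field_simps)
  have "L2_le M (\<lambda>\<omega>. 1 / real N * (\<Sum>m=1..N. D m \<omega>)) (1 / real N * (c * sqrt (real N)))"
    using L2_leD(1)[OF S] by (intro L2_le_dominated[OF S]) (auto simp: abs_mult)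
  moreover have "1 / real N * (c * sqrt (real N)) = c / sqrt (real N)"
    using N by (simp add: field_simps real_sqrt_mult[symmetric])
  ultimately show ?thesis unfolding eq by simp
qed

end

lemma L2_le_distr:
  assumes "T \<in> measurable M N" "f \<in> borel_measurable N"
  shows "L2_le (distr M N T) f c \<longleftrightarrow> L2_le M (\<lambda>x. f (T x)) c"
  using assms by (simp add: L2_le_def nn_integral_distr)

subsection \<open>The multilevel Picard scheme\<close>

text \<open>The noise below the node \<open>\<eta>\<close>, relabelled so that a recursive call
  again receives a family over all of \<open>Theta\<close>. Restriction keeps it extensional, as
  elements of a product space must be.\<close>

definition subtree :: "int list \<Rightarrow> (int list \<Rightarrow> 'z) \<Rightarrow> int list \<Rightarrow> 'z" where
  "subtree \<eta> z = (\<lambda>\<rho>\<in>Theta. z (\<eta> @ \<rho>))"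

lemma append_Theta: "\<rho> \<in> Theta \<Longrightarrow> \<eta> @ \<rho> \<in> Theta" "\<eta> \<in> Theta \<Longrightarrow> \<eta> @ \<rho> \<in> Theta"
  by (auto simp: Theta_def)

lemma pair_Theta [simp]: "[i, j] \<in> Theta" "\<theta> @ [i, j] \<in> Theta"
  by (auto simp: Theta_def)

lemma measurable_subtree:
  assumes "\<And>\<rho>. \<rho> \<in> Theta \<Longrightarrow> \<eta> @ \<rho> \<in> A"
  shows "subtree \<eta> \<in> Pi\<^sub>M A (\<lambda>_. \<nu>) \<rightarrow>\<^sub>M Pi\<^sub>M Theta (\<lambda>_. \<nu>)"
  unfolding subtree_def by (intro measurable_restrict measurable_component_singleton assms)

text \<open>Only the structure of the scheme: \<open>T\<close> is the random step and
  \<open>g\<close> the nonlinearity. Both are measurable jointly in their two arguments because they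
  are applied at random points.\<close>

locale mlp_scheme = nu: prob_space \<nu> for \<nu> :: "'z measure" +
  fixes T :: "'s::topological_space \<Rightarrow> 'z \<Rightarrow> 's" and g :: "'s \<Rightarrow> real \<Rightarrow> real" and M :: nat
  assumes T_measurable: "(\<lambda>(x, z). T x z) \<in> borel \<Otimes>\<^sub>M \<nu> \<rightarrow>\<^sub>M borel"
    and g_measurable: "(\<lambda>(x, v). g x v) \<in> borel_measurable (borel \<Otimes>\<^sub>M borel)"
    and M_pos: "M \<ge> 1"
begin

text \<open>The random point is shared by both terms of a difference, while their inner noises come
  from \<open>m\<close> and \<open>- m\<close> and are independent. The case k = 0 carries the first
  sum of the scheme, and n = 0 gives the empty sum.\<close>

function mlp :: "nat \<Rightarrow> 's \<Rightarrow> (int list \<Rightarrow> 'z) \<Rightarrow> real" where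
  "mlp n x z = (\<Sum>k<n. 1 / real (M ^ (n - k)) * (\<Sum>m=1..M ^ (n - k).
     if k = 0 then g (T x (z [0, int m])) 0
     else g (T x (z [int k, int m])) (mlp k (T x (z [int k, int m])) (subtree [int k, int m] z))
        - g (T x (z [int k, int m])) (mlp (k - 1) (T x (z [int k, int m])) (subtree [int k, - int m] z))))"
  by pat_completeness auto
termination by (relation "Wellfounded.measure fst") auto

declare mlp.simps [simp del]

definition level :: "nat \<Rightarrow> nat \<Rightarrow> 's \<Rightarrow> (int list \<Rightarrow> 'z) \<Rightarrow> real" where
  "level k m x z = (if k = 0 then g (T x (z [0, int m])) 0
     else g (T x (z [int k, int m])) (mlp k (T x (z [int k, int m])) (subtree [int k, int m] z))
        - g (T x (z [int k, int m])) (mlp (k - 1) (T x (z [int k, int m])) (subtree [int k, - int m] z)))"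

lemma mlp_level:
  "mlp n x z = (\<Sum>k<n. 1 / real (M ^ (n - k)) * (\<Sum>m=1..M ^ (n - k). level k m x z))"
  by (subst mlp.simps) (simp only: level_def)

abbreviation noise :: "(int list \<Rightarrow> 'z) measure" where
  "noise \<equiv> Pi\<^sub>M Theta (\<lambda>_. \<nu>)"

sublocale noise: prob_space noise
  by (intro prob_space_PiM nu.prob_space_axioms)

lemma T_comp [measurable]:
  "f \<in> K \<rightarrow>\<^sub>M borel \<Longrightarrow> h \<in> K \<rightarrow>\<^sub>M \<nu> \<Longrightarrow> (\<lambda>\<omega>. T (f \<omega>) (h \<omega>)) \<in> K \<rightarrow>\<^sub>M borel"
  using measurable_compose[OF measurable_Pair T_measurable, of f K h] by simp

lemma g_comp [measurable]:
  "f \<in> K \<rightarrow>\<^sub>M borel \<Longrightarrow> h \<in> borel_measurable K \<Longrightarrow> (\<lambda>\<omega>. g (f \<omega>) (h \<omega>)) \<in> borel_measurable K"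
  using measurable_compose[OF measurable_Pair g_measurable, of f K h] by simp

text \<open>For distinct positive m these sets are disjoint, which is the source of independence
  between samples of a level.\<close>

definition support :: "nat \<Rightarrow> nat \<Rightarrow> int list set" where
  "support k m = {[int k, int m] @ \<rho> | \<rho>. True} \<union> {[int k, - int m] @ \<rho> | \<rho>. True}"

text \<open>\<open>A\<close> is general because it serves twice: as all of \<open>Theta\<close> for
  the measurability of the recursion, and as \<open>support k m\<close> alone for the independence
  of samples.\<close>

lemma level_measurable_aux:
  assumes mlp: "\<And>j. j \<le> k \<Longrightarrow> (\<lambda>(x, z). mlp j x z) \<in> borel_measurable (borel \<Otimes>\<^sub>M noise)"
    and A: "support k m \<subseteq> A"
  shows "(\<lambda>(x, z). level k m x z) \<in> borel_measurable (borel \<Otimes>\<^sub>M Pi\<^sub>M A (\<lambda>_. \<nu>))"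
proof -
  let ?B = "borel \<Otimes>\<^sub>M Pi\<^sub>M A (\<lambda>_. \<nu>) :: ('s \<times> (int list \<Rightarrow> 'z)) measure"
  have inA: "[int k, int m] @ \<rho> \<in> A" "[int k, - int m] @ \<rho> \<in> A" for \<rho>
    using A by (auto simp: support_def)
  have c: "(\<lambda>p. snd p [int k, int m]) \<in> ?B \<rightarrow>\<^sub>M \<nu>"
    using inA(1)[of "[]"] by (intro measurable_compose[OF measurable_snd measurable_component_singleton]) simp
  have s: "(\<lambda>p. subtree [int k, i] (snd p)) \<in> ?B \<rightarrow>\<^sub>M noise" if "i = int m \<or> i = - int m" for i
    using inA that by (intro measurable_compose[OF measurable_snd measurable_subtree]) auto
  have y: "(\<lambda>p. T (fst p) (snd p [int k, int m])) \<in> ?B \<rightarrow>\<^sub>M borel"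
    using c by measurable
  have q: "(\<lambda>p. mlp j (T (fst p) (snd p [int k, int m])) (subtree [int k, i] (snd p))) \<in> borel_measurable ?B"
    if "j \<le> k" "i = int m \<or> i = - int m" for i j
    using measurable_compose[OF measurable_Pair[OF y s[OF that(2)]] mlp[OF that(1)]] by simp
  have "(\<lambda>p. level k m (fst p) (snd p)) \<in> borel_measurable ?B"
  proof (cases "k = 0")
    case True
    then show ?thesis using g_comp[OF y, of "\<lambda>_. 0"] by (simp add: level_def)
  next
    case False
    then show ?thesis
      using borel_measurable_diff[OF g_comp[OF y q[of k "int m"]] g_comp[OF y q[of "k - 1" "- int m"]]]
      by (simp add: level_def)
  qed
  then show ?thesis by (simp add: case_prod_beta')
qed

lemma support_Theta: "support k m \<subseteq> Theta"
  by (auto simp: support_def Theta_def)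

text \<open>Joint measurability in point and noise is the induction claim, since the recursion
  evaluates at random points.\<close>

lemma mlp_measurable: "(\<lambda>(x, z). mlp n x z) \<in> borel_measurable (borel \<Otimes>\<^sub>M noise)"
proof (induction n rule: less_induct)
  case (less n)
  have [measurable]: "(\<lambda>p. level k m (fst p) (snd p)) \<in> borel_measurable (borel \<Otimes>\<^sub>M noise)" if "k < n" for k m
    using level_measurable_aux[OF less.IH support_Theta, of k m] that by (simp add: case_prod_beta')
  have "(\<lambda>p. mlp n (fst p) (snd p)) \<in> borel_measurable (borel \<Otimes>\<^sub>M noise)"
    unfolding mlp_level by measurable
  then show ?case by (simp add: case_prod_beta')
qed

lemma mlp_comp:
  assumes "f \<in> K \<rightarrow>\<^sub>M borel" "h \<in> K \<rightarrow>\<^sub>M noise"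
  shows "(\<lambda>\<omega>. mlp n (f \<omega>) (h \<omega>)) \<in> borel_measurable K"
  using measurable_compose[OF measurable_Pair[OF assms] mlp_measurable[of n]] by simp

lemma level_measurable:
  assumes "support k m \<subseteq> A"
  shows "level k m x \<in> borel_measurable (Pi\<^sub>M A (\<lambda>_. \<nu>))"
proof -
  have "(\<lambda>z. (x, z)) \<in> Pi\<^sub>M A (\<lambda>_. \<nu>) \<rightarrow>\<^sub>M borel \<Otimes>\<^sub>M Pi\<^sub>M A (\<lambda>_. \<nu>)"
    by (rule measurable_Pair1') simp
  from measurable_compose[OF this level_measurable_aux[OF mlp_measurable assms]] show ?thesis by simp
qed

lemma level_restrict: "level k m x (restrict z (support k m)) = level k m x z"
proof -
  have "subtree [int k, i] (restrict z (support k m)) = subtree [int k, i] z" if "i = int m \<or> i = - int m" for i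
    using that by (intro ext) (auto simp: subtree_def support_def restrict_def)
  moreover have "[int k, int m] \<in> support k m" by (auto simp: support_def)
  ultimately show ?thesis unfolding level_def by (cases "k = 0") auto
qed

lemma indep_coordinates: "noise.indep_vars (\<lambda>_. \<nu>) (\<lambda>\<eta> z. z \<eta>) Theta"
proof (subst noise.indep_vars_iff_distr_eq_PiM')
  have "distr noise noise (\<lambda>z. \<lambda>\<eta>\<in>Theta. z \<eta>) = distr noise noise (\<lambda>z. z)"
    by (intro distr_cong) (auto simp: space_PiM)
  also have "\<dots> = noise" by (rule distr_id)
  also have "\<dots> = Pi\<^sub>M Theta (\<lambda>\<eta>. distr noise \<nu> (\<lambda>z. z \<eta>))"
    by (intro PiM_cong refl distr_PiM_component[symmetric] nu.prob_space_axioms)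
  finally show "distr noise noise (\<lambda>z. \<lambda>\<eta>\<in>Theta. z \<eta>) = Pi\<^sub>M Theta (\<lambda>\<eta>. distr noise \<nu> (\<lambda>z. z \<eta>))" .
  show "Theta \<noteq> {}" by (auto simp: Theta_def)
qed (auto intro: measurable_component_singleton)

text \<open>Prefixing indices is injective, and a product of identical laws is invariant under
  injective relabelling: every node sees a copy of the full noise.\<close>

lemma distr_subtree: "distr noise noise (subtree \<eta>) = noise"
  using distr_PiM_reindex[of Theta "\<lambda>_. \<nu>" "\<lambda>\<rho>. \<eta> @ \<rho>" Theta] append_Theta nu.prob_space_axioms
  by (simp add: subtree_def[abs_def] inj_on_def)

text \<open>Proper extensions of \<open>\<eta>'\<close> are longer than \<open>\<eta>'\<close>, so
  the length condition keeps \<open>\<eta>\<close> out of them; disjoint blocks of coordinates are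
  independent.\<close>

lemma distr_coordinate_subtree:
  assumes "\<eta> \<in> Theta" "length \<eta> \<le> length \<eta>'"
  shows "distr noise (\<nu> \<Otimes>\<^sub>M noise) (\<lambda>z. (z \<eta>, subtree \<eta>' z)) = \<nu> \<Otimes>\<^sub>M noise"
proof -
  let ?B = "{\<eta>' @ \<rho> | \<rho>. \<rho> \<in> Theta}"
  have disj: "{\<eta>} \<inter> ?B = {}" using assms(2) by (auto simp: Theta_def)
  have "noise.indep_var (Pi\<^sub>M {\<eta>} (\<lambda>_. \<nu>)) (\<lambda>z. restrict (\<lambda>i. z i) {\<eta>}) (Pi\<^sub>M ?B (\<lambda>_. \<nu>)) (\<lambda>z. restrict (\<lambda>i. z i) ?B)"
    using disj assms(1) append_Theta by (intro noise.indep_var_restrict[OF indep_coordinates]) auto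
  then have ind: "distr noise (Pi\<^sub>M {\<eta>} (\<lambda>_. \<nu>)) (\<lambda>z. restrict z {\<eta>}) \<Otimes>\<^sub>M
        distr noise (Pi\<^sub>M ?B (\<lambda>_. \<nu>)) (\<lambda>z. restrict z ?B) =
      distr noise (Pi\<^sub>M {\<eta>} (\<lambda>_. \<nu>) \<Otimes>\<^sub>M Pi\<^sub>M ?B (\<lambda>_. \<nu>)) (\<lambda>z. (restrict z {\<eta>}, restrict z ?B))"
      (is "?D1 \<Otimes>\<^sub>M ?D2 = _")
    by (simp add: noise.indep_var_distribution_eq)
  have c1: "(\<lambda>z. z \<eta>) \<in> Pi\<^sub>M {\<eta>} (\<lambda>_. \<nu>) \<rightarrow>\<^sub>M \<nu>" by (rule measurable_component_singleton) simp
  have c2: "subtree \<eta>' \<in> Pi\<^sub>M ?B (\<lambda>_. \<nu>) \<rightarrow>\<^sub>M noise" by (rule measurable_subtree) auto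
  have r1: "(\<lambda>z. restrict z {\<eta>}) \<in> noise \<rightarrow>\<^sub>M Pi\<^sub>M {\<eta>} (\<lambda>_. \<nu>)"
    using assms(1) by (intro measurable_restrict measurable_component_singleton) auto
  have r2: "(\<lambda>z. restrict z ?B) \<in> noise \<rightarrow>\<^sub>M Pi\<^sub>M ?B (\<lambda>_. \<nu>)"
    using append_Theta by (intro measurable_restrict measurable_component_singleton) auto
  have sh: "subtree \<eta>' (restrict z ?B) = subtree \<eta>' z" for z :: "int list \<Rightarrow> 'z"
    by (intro ext) (auto simp: subtree_def restrict_def)
  have d1: "distr ?D1 \<nu> (\<lambda>z. z \<eta>) = \<nu>"
    using distr_PiM_component[of Theta "\<lambda>_. \<nu>" \<eta>] assms(1) nu.prob_space_axioms
    by (subst distr_distr[OF c1 r1]) (simp add: comp_def)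
  have d2: "distr ?D2 noise (subtree \<eta>') = noise"
    by (subst distr_distr[OF c2 r2]) (simp add: comp_def sh distr_subtree)
  have "\<nu> \<Otimes>\<^sub>M noise = distr ?D1 \<nu> (\<lambda>z. z \<eta>) \<Otimes>\<^sub>M distr ?D2 noise (subtree \<eta>')"
    by (simp only: d1 d2)
  also have "\<dots> = distr (?D1 \<Otimes>\<^sub>M ?D2) (\<nu> \<Otimes>\<^sub>M noise) (\<lambda>(a, b). (a \<eta>, subtree \<eta>' b))"
    using c1 c2 by (intro pair_measure_distr) (simp_all add: d2 noise.sigma_finite_measure_axioms)
  also have "\<dots> = distr noise (\<nu> \<Otimes>\<^sub>M noise) ((\<lambda>(a, b). (a \<eta>, subtree \<eta>' b)) \<circ> (\<lambda>z. (restrict z {\<eta>}, restrict z ?B)))"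
    unfolding ind
    using measurable_Pair[OF measurable_compose[OF measurable_fst c1] measurable_compose[OF measurable_snd c2]]
    by (intro distr_distr measurable_Pair r1 r2) (simp add: case_prod_beta')
  also have "(\<lambda>(a, b). (a \<eta>, subtree \<eta>' b)) \<circ> (\<lambda>z. (restrict z {\<eta>}, restrict z ?B)) = (\<lambda>z :: int list \<Rightarrow> 'z. (z \<eta>, subtree \<eta>' z))"
    by (simp add: comp_def sh)
  finally show ?thesis ..
qed

lemma indep_levels:
  assumes "m \<ge> 1" "m' \<ge> 1" "m \<noteq> m'"
  shows "noise.indep_var borel (level k m x) borel (level k m' x)"
proof -
  have "support k m \<inter> support k m' = {}" using assms by (auto simp: support_def)
  then have "noise.indep_var (Pi\<^sub>M (support k m) (\<lambda>_. \<nu>)) (\<lambda>z. restrict (\<lambda>i. z i) (support k m))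
      (Pi\<^sub>M (support k m') (\<lambda>_. \<nu>)) (\<lambda>z. restrict (\<lambda>i. z i) (support k m'))"
    using support_Theta by (intro noise.indep_var_restrict[OF indep_coordinates]) auto
  then have "noise.indep_var borel (level k m x \<circ> (\<lambda>z. restrict (\<lambda>i. z i) (support k m)))
      borel (level k m' x \<circ> (\<lambda>z. restrict (\<lambda>i. z i) (support k m')))"
    by (rule noise.indep_var_compose) (auto intro: level_measurable)
  then show ?thesis by (simp add: comp_def level_restrict)
qed

end

text \<open>\<open>a\<close> is the square root of the Lipschitz constant: \<open>weight\<close>
  spends one factor a on the growth of w along a step, and the other survives as contraction.
  \<open>F\<close> and \<open>N\<close> measure the source and the solution in units of w.\<close>

locale mlp_error = mlp_scheme +
  fixes u w :: "'b \<Rightarrow> real" and a F N :: real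
  assumes u_measurable [measurable]: "u \<in> borel_measurable borel"
    and w_measurable [measurable]: "w \<in> borel_measurable borel"
    and a_nonneg: "0 \<le> a" and F_nonneg: "0 \<le> F" and N_nonneg: "0 \<le> N"
    and w_nonneg: "\<And>x. 0 \<le> w x"
    and g_lipschitz: "\<And>x v v'. \<bar>g x v - g x v'\<bar> \<le> a\<^sup>2 * \<bar>v - v'\<bar>"
    and weight: "\<And>x. L2_le \<nu> (\<lambda>z. a * w (T x z)) (w x)"
    and source: "\<And>x. L2_le \<nu> (\<lambda>z. g (T x z) 0) (F * w x)"
    and u_bound: "\<And>x. \<bar>u x\<bar> \<le> N * w x"
    and fixed_point: "\<And>x. u x = (\<integral>z. g (T x z) (u (T x z)) \<partial>\<nu>)"
begin

definition b :: real where "b = 1 / sqrt (real M)"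

text \<open>With a = sqrt(L / \<lambda>) this is the number whose logarithm enters \<alpha>.\<close>

definition \<delta> :: real where "\<delta> = b + a * (1 + b)"

lemma b_pos: "0 < b" using M_pos by (simp add: b_def)

lemma delta_pos: "0 < \<delta>" using b_pos a_nonneg by (simp add: \<delta>_def add_pos_nonneg)

text \<open>\<open>\<delta>\<close> is chosen to make the recursive error bound an exact identity.\<close>

lemma delta_identity:
  "(\<Sum>k=1..<Suc n. b ^ (Suc n - k) * (a * (\<delta> ^ k + \<delta> ^ (k - 1)))) + a * \<delta> ^ n + b ^ Suc n * (1 + a) = \<delta> ^ Suc n"
proof (induction n)
  case 0
  then show ?case by (simp add: \<delta>_def algebra_simps)
next
  case (Suc n)
  have IH: "(\<Sum>k=1..<Suc n. b ^ (Suc n - k) * (a * (\<delta> ^ k + \<delta> ^ (k - 1)))) = \<delta> ^ Suc n - a * \<delta> ^ n - b ^ Suc n * (1 + a)"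
    using Suc.IH by linarith
  have "(\<Sum>k=1..<Suc (Suc n). b ^ (Suc (Suc n) - k) * (a * (\<delta> ^ k + \<delta> ^ (k - 1))))
      = (\<Sum>k=1..<Suc n. b * (b ^ (Suc n - k) * (a * (\<delta> ^ k + \<delta> ^ (k - 1))))) + b * (a * (\<delta> ^ Suc n + \<delta> ^ n))"
    by (simp add: Suc_diff_le mult.assoc)
  also have "\<dots> = b * (\<Sum>k=1..<Suc n. b ^ (Suc n - k) * (a * (\<delta> ^ k + \<delta> ^ (k - 1)))) + b * (a * (\<delta> ^ Suc n + \<delta> ^ n))"
    by (simp only: sum_distrib_left)
  also have "\<dots> = b * (\<delta> ^ Suc n - a * \<delta> ^ n - b ^ Suc n * (1 + a)) + b * (a * (\<delta> ^ Suc n + \<delta> ^ n))"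
    by (simp only: IH)
  finally have "(\<Sum>k=1..<Suc (Suc n). b ^ (Suc (Suc n) - k) * (a * (\<delta> ^ k + \<delta> ^ (k - 1))))
      + a * \<delta> ^ Suc n + b ^ Suc (Suc n) * (1 + a) = (b + a * (1 + b)) * \<delta> ^ Suc n"
    by (simp add: algebra_simps)
  then show ?case by (simp add: \<delta>_def)
qed

text \<open>Given the first step y, the inner noise still has the law \<open>noise\<close>, so
  \<open>err\<close> applies at the random point \<open>T x y\<close>; Fubini then reduces the claim
  to \<open>weight\<close>.\<close>

lemma error_comp:
  assumes err: "\<And>x. L2_le noise (\<lambda>z. mlp k x z - u x) (K * w x)" and K: "0 \<le> K"
    and \<eta>: "\<eta> \<in> Theta" "length \<eta> \<le> length \<eta>'"
  shows "L2_le noise (\<lambda>z. g (T x (z \<eta>)) (mlp k (T x (z \<eta>)) (subtree \<eta>' z)) - g (T x (z \<eta>)) (u (T x (z \<eta>)))) (a * (K * w x))"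
    and "L2_le (\<nu> \<Otimes>\<^sub>M noise) (\<lambda>(y, z). g (T x y) (mlp k (T x y) z) - g (T x y) (u (T x y))) (a * (K * w x))"
proof -
  have c: "(\<lambda>z. (z \<eta>, subtree \<eta>' z)) \<in> noise \<rightarrow>\<^sub>M \<nu> \<Otimes>\<^sub>M noise"
    by (intro measurable_Pair measurable_component_singleton \<eta> measurable_subtree append_Theta)
  have t: "(\<lambda>p. T x (fst p)) \<in> \<nu> \<Otimes>\<^sub>M noise \<rightarrow>\<^sub>M borel" by measurable
  note q [measurable] = mlp_comp[OF t measurable_snd, of k]
  have [measurable]: "mlp k y \<in> borel_measurable noise" for y
    using mlp_comp[of "\<lambda>_. y" noise "\<lambda>z. z"] by simp
  have "L2_le (\<nu> \<Otimes>\<^sub>M noise) (\<lambda>p. a * (mlp k (T x (fst p)) (snd p) - u (T x (fst p)))) (K * w x)"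
    unfolding L2_le_def
  proof (intro conjI)
    show "(\<lambda>p. a * (mlp k (T x (fst p)) (snd p) - u (T x (fst p)))) \<in> borel_measurable (\<nu> \<Otimes>\<^sub>M noise)"
      by measurable
    show "0 \<le> K * w x" using K w_nonneg by simp
    have "(\<integral>\<^sup>+p. ennreal ((a * (mlp k (T x (fst p)) (snd p) - u (T x (fst p))))\<^sup>2) \<partial>(\<nu> \<Otimes>\<^sub>M noise))
        = (\<integral>\<^sup>+y. \<integral>\<^sup>+z. ennreal (a\<^sup>2) * ennreal ((mlp k (T x y) z - u (T x y))\<^sup>2) \<partial>noise \<partial>\<nu>)"
      by (subst noise.nn_integral_fst[symmetric]) (measurable, simp add: power_mult_distrib ennreal_mult)
    also have "\<dots> = (\<integral>\<^sup>+y. ennreal (a\<^sup>2) * (\<integral>\<^sup>+z. ennreal ((mlp k (T x y) z - u (T x y))\<^sup>2) \<partial>noise) \<partial>\<nu>)"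
      by (intro nn_integral_cong nn_integral_cmult) measurable
    also have "\<dots> \<le> (\<integral>\<^sup>+y. ennreal (a\<^sup>2) * ennreal ((K * w (T x y))\<^sup>2) \<partial>\<nu>)"
      using err by (intro nn_integral_mono mult_left_mono) (auto simp: L2_le_def)
    also have "\<dots> = (\<integral>\<^sup>+y. ennreal (K\<^sup>2) * ennreal ((a * w (T x y))\<^sup>2) \<partial>\<nu>)"
      by (intro nn_integral_cong) (simp add: ennreal_mult[symmetric] power_mult_distrib mult.left_commute)
    also have "\<dots> = ennreal (K\<^sup>2) * (\<integral>\<^sup>+y. ennreal ((a * w (T x y))\<^sup>2) \<partial>\<nu>)"
      by (intro nn_integral_cmult) measurable
    also have "\<dots> \<le> ennreal (K\<^sup>2) * ennreal ((w x)\<^sup>2)"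
      using weight[of x] by (intro mult_left_mono) (auto simp: L2_le_def)
    also have "\<dots> = ennreal ((K * w x)\<^sup>2)" by (simp add: ennreal_mult[symmetric] power_mult_distrib)
    finally show "(\<integral>\<^sup>+p. ennreal ((a * (mlp k (T x (fst p)) (snd p) - u (T x (fst p))))\<^sup>2) \<partial>(\<nu> \<Otimes>\<^sub>M noise)) \<le> ennreal ((K * w x)\<^sup>2)" .
  qed
  then have *: "L2_le (\<nu> \<Otimes>\<^sub>M noise) (\<lambda>p. g (T x (fst p)) (mlp k (T x (fst p)) (snd p)) - g (T x (fst p)) (u (T x (fst p)))) (a * (K * w x))"
  proof (rule L2_le_dominated)
    show "(\<lambda>p. g (T x (fst p)) (mlp k (T x (fst p)) (snd p)) - g (T x (fst p)) (u (T x (fst p)))) \<in> borel_measurable (\<nu> \<Otimes>\<^sub>M noise)"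
      by measurable
    show "\<bar>g (T x (fst p)) (mlp k (T x (fst p)) (snd p)) - g (T x (fst p)) (u (T x (fst p)))\<bar>
      \<le> a * \<bar>a * (mlp k (T x (fst p)) (snd p) - u (T x (fst p)))\<bar>" for p
      using g_lipschitz a_nonneg by (simp add: abs_mult power2_eq_square mult.assoc)
  qed (rule a_nonneg)
  then show "L2_le (\<nu> \<Otimes>\<^sub>M noise) (\<lambda>(y, z). g (T x y) (mlp k (T x y) z) - g (T x y) (u (T x y))) (a * (K * w x))"
    by (simp add: case_prod_beta')
  have "L2_le (distr noise (\<nu> \<Otimes>\<^sub>M noise) (\<lambda>z. (z \<eta>, subtree \<eta>' z))) (\<lambda>p. g (T x (fst p)) (mlp k (T x (fst p)) (snd p)) - g (T x (fst p)) (u (T x (fst p)))) (a * (K * w x))"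
    using * by (simp only: distr_coordinate_subtree[OF \<eta>])
  then show "L2_le noise (\<lambda>z. g (T x (z \<eta>)) (mlp k (T x (z \<eta>)) (subtree \<eta>' z)) - g (T x (z \<eta>)) (u (T x (z \<eta>)))) (a * (K * w x))"
    using L2_leD(1)[OF *] by (subst (asm) L2_le_distr[OF c]) auto
qed

lemma coordinate_law: "\<eta> \<in> Theta \<Longrightarrow> distr noise \<nu> (\<lambda>z. z \<eta>) = \<nu>"
  using distr_PiM_component[of Theta "\<lambda>_. \<nu>" \<eta>] nu.prob_space_axioms by simp

lemma source_u: "L2_le \<nu> (\<lambda>z. g (T x z) (u (T x z))) (a * (N * w x) + F * w x)"
proof -
  have "L2_le \<nu> (\<lambda>z. g (T x z) (u (T x z)) - g (T x z) 0) (a * N * w x)"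
    using weight
  proof (rule L2_le_dominated)
    show "(\<lambda>z. g (T x z) (u (T x z)) - g (T x z) 0) \<in> borel_measurable \<nu>" by measurable
    show "\<bar>g (T x z) (u (T x z)) - g (T x z) 0\<bar> \<le> a * N * \<bar>a * w (T x z)\<bar>" for z
    proof -
      have "\<bar>g (T x z) (u (T x z)) - g (T x z) 0\<bar> \<le> a\<^sup>2 * \<bar>u (T x z)\<bar>" using g_lipschitz[of _ _ 0] by simp
      also have "\<dots> \<le> a\<^sup>2 * (N * w (T x z))" using u_bound by (intro mult_left_mono) auto
      also have "\<dots> = a * N * \<bar>a * w (T x z)\<bar>"
        using a_nonneg w_nonneg[of "T x z"] by (simp add: power2_eq_square abs_mult)
      finally show ?thesis .
    qed
  qed (use a_nonneg N_nonneg in simp)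
  from L2_le_add[OF this source[of x]] show ?thesis by (simp add: mult.assoc)
qed

text \<open>The mean of one evaluation of g at the inner approximation. It depends on k and x but
  not on the node, which makes the means of the levels telescope.\<close>

definition G :: "nat \<Rightarrow> 'b \<Rightarrow> real" where
  "G k x = (\<integral>p. (\<lambda>(y, z). g (T x y) (mlp k (T x y) z)) p \<partial>(\<nu> \<Otimes>\<^sub>M noise))"

lemma pair_prob: "prob_space (\<nu> \<Otimes>\<^sub>M noise)"
  by (intro prob_space_pair nu.prob_space_axioms noise.prob_space_axioms)

text \<open>For the bias, \<open>fixed_point\<close> writes u x as a mean over the same step, so the
  difference of the means is at most the norm bounded in \<open>error_comp\<close>.\<close>

lemma integral_composed:
  assumes err: "\<And>x. L2_le noise (\<lambda>z. mlp k x z - u x) (K * w x)" and K: "0 \<le> K"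
    and \<eta>: "\<eta> \<in> Theta" "length \<eta> \<le> length \<eta>'"
  shows "integrable noise (\<lambda>z. g (T x (z \<eta>)) (mlp k (T x (z \<eta>)) (subtree \<eta>' z)))" (is ?i)
    and "noise.expectation (\<lambda>z. g (T x (z \<eta>)) (mlp k (T x (z \<eta>)) (subtree \<eta>' z))) = G k x" (is ?e)
    and "\<bar>G k x - u x\<bar> \<le> a * (K * w x)" (is ?b)
proof -
  interpret pr: prob_space "\<nu> \<Otimes>\<^sub>M noise" by (rule pair_prob)
  have c: "(\<lambda>z. (z \<eta>, subtree \<eta>' z)) \<in> noise \<rightarrow>\<^sub>M \<nu> \<Otimes>\<^sub>M noise"
    by (intro measurable_Pair measurable_component_singleton \<eta> measurable_subtree append_Theta)
  have t: "(\<lambda>p. T x (fst p)) \<in> \<nu> \<Otimes>\<^sub>M noise \<rightarrow>\<^sub>M borel" by measurable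
  note q [measurable] = mlp_comp[OF t measurable_snd, of k]
  let ?h = "\<lambda>p. g (T x (fst p)) (mlp k (T x (fst p)) (snd p))"
  let ?v = "\<lambda>y. g (T x y) (u (T x y))"
  have h: "?h \<in> borel_measurable (\<nu> \<Otimes>\<^sub>M noise)" by measurable
  have d: "L2_le (\<nu> \<Otimes>\<^sub>M noise) (\<lambda>p. ?h p - ?v (fst p)) (a * (K * w x))"
    using error_comp(2)[OF err K \<eta>, of x] by (simp add: case_prod_beta')
  have fstd: "distr (\<nu> \<Otimes>\<^sub>M noise) \<nu> fst = \<nu>"
    by (rule noise.distr_pair_fst)
  have vi: "integrable \<nu> ?v" using nu.L2_le_integrable[OF source_u] .
  have i0: "integrable (\<nu> \<Otimes>\<^sub>M noise) (\<lambda>p. ?v (fst p))"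
    using vi by (subst (asm) fstd[symmetric]) (rule integrable_distr[OF measurable_fst])
  have e0: "pr.expectation (\<lambda>p. ?v (fst p)) = u x"
  proof -
    have "pr.expectation (\<lambda>p. ?v (fst p)) = (\<integral>y. ?v y \<partial>distr (\<nu> \<Otimes>\<^sub>M noise) \<nu> fst)"
      by (subst integral_distr) (auto intro: borel_measurable_integrable vi)
    then show ?thesis by (simp only: fstd fixed_point[of x])
  qed
  have i1: "integrable (\<nu> \<Otimes>\<^sub>M noise) ?h"
    using Bochner_Integration.integrable_add[OF pr.L2_le_integrable[OF d] i0] by simp
  have G: "G k x = pr.expectation ?h" by (simp add: G_def case_prod_beta')
  have "integrable (distr noise (\<nu> \<Otimes>\<^sub>M noise) (\<lambda>z. (z \<eta>, subtree \<eta>' z))) ?h"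
    using i1 by (simp only: distr_coordinate_subtree[OF \<eta>])
  from integrable_distr[OF c this] show ?i by simp
  have "noise.expectation (\<lambda>z. ?h (z \<eta>, subtree \<eta>' z)) = integral\<^sup>L (distr noise (\<nu> \<Otimes>\<^sub>M noise) (\<lambda>z. (z \<eta>, subtree \<eta>' z))) ?h"
    by (rule integral_distr[OF c h, symmetric])
  then show ?e by (simp add: distr_coordinate_subtree[OF \<eta>] G)
  have "pr.expectation (\<lambda>p. ?h p - ?v (fst p)) = G k x - u x"
    using i1 i0 e0 G by (simp only: Bochner_Integration.integral_diff)
  then show ?b using pr.L2_le_expectation[OF d] by simp
qed

text \<open>Bias and variance: the average of a level deviates from its mean by at most b^(n-k)
  times the norm of a sample, and the means telescope to \<open>G (n - 1) x\<close>, whose distance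
  to u x is one contraction of the previous error.\<close>

lemma error_step:
  assumes n: "n \<ge> 1" and K: "\<And>k. k < n \<Longrightarrow> 0 \<le> K k"
    and err: "\<And>k x. k < n \<Longrightarrow> L2_le noise (\<lambda>z. mlp k x z - u x) (K k * w x)"
  shows "L2_le noise (\<lambda>z. mlp n x z - u x)
    ((b ^ n * F + (\<Sum>k=1..<n. b ^ (n - k) * (a * (K k + K (k - 1)))) + a * K (n - 1)) * w x)"
proof -
  \<comment> \<open>Both terms of a level are compared with g along u, so that a sample is bounded
    by the sum of two earlier errors.\<close>
  define c where "c k = (if k = 0 then F * w x else a * (K k * w x) + a * (K (k - 1) * w x))" for k
  define \<mu> where "\<mu> k = (if k = 0 then G 0 x else G k x - G (k - 1) x)" for k
  have lev: "L2_le noise (level k m x) (c k)" "noise.expectation (level k m x) = \<mu> k"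
    if k: "k < n" and m: "m \<ge> 1" for k m
  proof -
    have "L2_le noise (level k m x) (c k) \<and> noise.expectation (level k m x) = \<mu> k"
    proof (cases "k = 0")
      case True
      have co: "(\<lambda>z. z [0, int m]) \<in> noise \<rightarrow>\<^sub>M \<nu>" by (intro measurable_component_singleton) simp
      have "L2_le (distr noise \<nu> (\<lambda>z. z [0, int m])) (\<lambda>z. g (T x z) 0) (F * w x)"
        unfolding coordinate_law[OF pair_Theta(1)] by (rule source)
      then have "L2_le noise (\<lambda>z. g (T x (z [0, int m])) 0) (F * w x)"
        using L2_leD(1)[OF source] by (subst (asm) L2_le_distr[OF co]) auto
      moreover have "mlp 0 y z = 0" for y z by (simp add: mlp.simps)
      ultimately show ?thesis
        using integral_composed(2)[where \<eta>="[0, int m]" and \<eta>'="[0, int m]", OF err K, of 0] True n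
        by (simp add: c_def \<mu>_def level_def[abs_def])
    next
      case False
      let ?\<eta> = "[int k, int m]" and ?\<eta>' = "[int k, - int m]"
      have k1: "k - 1 < n" using k by simp
      have 1: "L2_le noise (\<lambda>z. g (T x (z ?\<eta>)) (mlp k (T x (z ?\<eta>)) (subtree ?\<eta> z)) - g (T x (z ?\<eta>)) (u (T x (z ?\<eta>)))) (a * (K k * w x))"
        by (rule error_comp(1)[OF err[OF k] K[OF k]]) auto
      have 2: "L2_le noise (\<lambda>z. g (T x (z ?\<eta>)) (mlp (k - 1) (T x (z ?\<eta>)) (subtree ?\<eta>' z)) - g (T x (z ?\<eta>)) (u (T x (z ?\<eta>)))) (a * (K (k - 1) * w x))"
        by (rule error_comp(1)[OF err[OF k1] K[OF k1]]) auto
      have "noise.expectation (\<lambda>z. g (T x (z ?\<eta>)) (mlp k (T x (z ?\<eta>)) (subtree ?\<eta> z)) - g (T x (z ?\<eta>)) (mlp (k - 1) (T x (z ?\<eta>)) (subtree ?\<eta>' z))) = G k x - G (k - 1) x"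
        using integral_composed(1,2)[where \<eta>="?\<eta>" and \<eta>'="?\<eta>", OF err[OF k] K[OF k]]
          integral_composed(1,2)[where \<eta>="?\<eta>" and \<eta>'="?\<eta>'", OF err[OF k1] K[OF k1]]
        by (subst Bochner_Integration.integral_diff) auto
      then show ?thesis using L2_le_diff[OF 1 2] False by (simp add: c_def \<mu>_def level_def[abs_def])
    qed
    then show "L2_le noise (level k m x) (c k)" "noise.expectation (level k m x) = \<mu> k" by auto
  qed
  have sq: "sqrt (real (M ^ j)) = 1 / b ^ j" for j
    by (simp add: b_def real_sqrt_power power_one_over divide_simps)
  have mc: "L2_le noise (\<lambda>z. 1 / real (M ^ (n - k)) * (\<Sum>m=1..M ^ (n - k). level k m x z) - \<mu> k) (b ^ (n - k) * c k)"
    if k: "k < n" for k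
  proof -
    have "L2_le noise (\<lambda>z. 1 / real (M ^ (n - k)) * (\<Sum>m=1..M ^ (n - k). level k m x z) - \<mu> k) (c k / sqrt (real (M ^ (n - k))))"
      by (rule noise.L2_le_monte_carlo) (use M_pos lev[OF k] indep_levels in auto)
    then show ?thesis unfolding sq by (simp add: mult.commute)
  qed
  have tel: "(\<Sum>k<Suc j. \<mu> k) = G j x" for j by (induction j) (simp_all add: \<mu>_def)
  have "L2_le noise (\<lambda>z. (\<Sum>k<n. 1 / real (M ^ (n - k)) * (\<Sum>m=1..M ^ (n - k). level k m x z) - \<mu> k) + (G (n - 1) x - u x))
      ((\<Sum>k<n. b ^ (n - k) * c k) + a * (K (n - 1) * w x))"
  proof (intro L2_le_add L2_le_sum mc)
    have "\<bar>G (n - 1) x - u x\<bar> \<le> a * (K (n - 1) * w x)"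
      using n by (intro integral_composed(3)[where \<eta>="[0, 0]" and \<eta>'="[0, 0]", OF err K]) auto
    then show "L2_le noise (\<lambda>z. G (n - 1) x - u x) (a * (K (n - 1) * w x))"
      by (intro L2_le_mono[OF noise.L2_le_const])
  qed auto
  moreover have "(\<Sum>k<n. 1 / real (M ^ (n - k)) * (\<Sum>m=1..M ^ (n - k). level k m x z) - \<mu> k) + (G (n - 1) x - u x) = mlp n x z - u x" for z
    using tel[of "n - 1"] n by (simp add: mlp_level sum_subtractf)
  moreover have "(\<Sum>k<n. b ^ (n - k) * c k) + a * (K (n - 1) * w x) =
     (b ^ n * F + (\<Sum>k=1..<n. b ^ (n - k) * (a * (K k + K (k - 1)))) + a * K (n - 1)) * w x"
  proof -
    have "{..<n} = insert 0 {1..<n}" using n by auto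
    then have "(\<Sum>k<n. b ^ (n - k) * c k) = b ^ n * c 0 + (\<Sum>k=1..<n. b ^ (n - k) * c k)" by simp
    also have "(\<Sum>k=1..<n. b ^ (n - k) * c k) = (\<Sum>k=1..<n. b ^ (n - k) * (a * (K k + K (k - 1)))) * w x"
      unfolding sum_distrib_right by (intro sum.cong refl) (simp add: c_def algebra_simps)
    finally have *: "(\<Sum>k<n. b ^ (n - k) * c k) =
        b ^ n * c 0 + (\<Sum>k=1..<n. b ^ (n - k) * (a * (K k + K (k - 1)))) * w x" .
    have "c 0 = F * w x" by (simp add: c_def)
    then show ?thesis unfolding * by (simp only: distrib_right mult.assoc)
  qed
  ultimately show ?thesis by (simp only:)
qed

text \<open>Strong induction with an error proportional to \<delta>^n: \<open>delta_identity\<close>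
  closes the step, and \<open>N\<close> starts it, since the approximation for n = 0 is 0.\<close>

theorem mlp_error_bound: "L2_le noise (\<lambda>z. mlp n x z - u x) (max F N * \<delta> ^ n * w x)"
proof (induction n arbitrary: x rule: less_induct)
  case (less n)
  let ?C = "max F N"
  have C: "0 \<le> ?C" using F_nonneg by simp
  show ?case
  proof (cases "n = 0")
    case True
    have "\<bar>- u x\<bar> \<le> ?C * w x"
      using u_bound[of x] w_nonneg[of x] mult_right_mono[of N ?C "w x"] by simp
    from L2_le_mono[OF noise.L2_le_const this] True show ?thesis by (simp add: mlp.simps)
  next
    case False
    then obtain j where j: "n = Suc j" by (cases n) auto
    have "L2_le noise (\<lambda>z. mlp n x z - u x)
      ((b ^ n * F + (\<Sum>k=1..<n. b ^ (n - k) * (a * (?C * \<delta> ^ k + ?C * \<delta> ^ (k - 1)))) + a * (?C * \<delta> ^ (n - 1))) * w x)"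
      using False C delta_pos by (intro error_step less.IH) auto
    moreover have "b ^ n * F + (\<Sum>k=1..<n. b ^ (n - k) * (a * (?C * \<delta> ^ k + ?C * \<delta> ^ (k - 1)))) + a * (?C * \<delta> ^ (n - 1)) \<le> ?C * \<delta> ^ n"
    proof -
      have "(\<Sum>k=1..<n. b ^ (n - k) * (a * (?C * \<delta> ^ k + ?C * \<delta> ^ (k - 1)))) = ?C * (\<Sum>k=1..<n. b ^ (n - k) * (a * (\<delta> ^ k + \<delta> ^ (k - 1))))"
        by (simp add: sum_distrib_left algebra_simps)
      \<comment> \<open>The identity carries the initial term with a factor 1 + a, so the source
        term is enlarged to fit.\<close>
      moreover have "b ^ n * F \<le> ?C * (b ^ n * (1 + a))"
      proof -
        have "b ^ n * F \<le> b ^ n * ?C" using b_pos by (intro mult_left_mono) auto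
        also have "\<dots> \<le> b ^ n * (?C * (1 + a))" using b_pos C a_nonneg by (intro mult_left_mono) (auto simp: algebra_simps)
        finally show ?thesis by (simp add: algebra_simps)
      qed
      ultimately have "b ^ n * F + (\<Sum>k=1..<n. b ^ (n - k) * (a * (?C * \<delta> ^ k + ?C * \<delta> ^ (k - 1)))) + a * (?C * \<delta> ^ (n - 1))
         \<le> ?C * ((\<Sum>k=1..<n. b ^ (n - k) * (a * (\<delta> ^ k + \<delta> ^ (k - 1)))) + a * \<delta> ^ (n - 1) + b ^ n * (1 + a))"
        by (simp only: distrib_left) (simp add: algebra_simps)
      also have "\<dots> = ?C * \<delta> ^ n" using delta_identity[of j] by (simp add: j)
      finally show ?thesis .
    qed
    ultimately show ?thesis by (rule L2_le_mono[OF _ mult_right_mono[OF _ w_nonneg]])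
  qed
qed

end

subsection \<open>Weighted norms\<close>

text \<open>Up to the factorial, the left side is one term of the series of exp |x|.\<close>

lemma power_le_cosh: "x ^ (2 * m) \<le> 2 * fact (2 * m) * cosh (x :: real)"
proof -
  have s: "summable (\<lambda>n. \<bar>x\<bar> ^ n /\<^sub>R fact n)" by (rule summable_exp_generic)
  have "x ^ (2 * m) / fact (2 * m) = \<bar>x\<bar> ^ (2 * m) /\<^sub>R fact (2 * m)"
    by (simp add: power_mult divide_inverse)
  also have "\<dots> \<le> (\<Sum>n. \<bar>x\<bar> ^ n /\<^sub>R fact n)"
    using sum_le_suminf[OF s, of "{2 * m}"] by simp
  also have "\<dots> = exp \<bar>x\<bar>" by (simp add: exp_def)
  also have "\<dots> \<le> exp x + exp (- x)" by (simp add: abs_if)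
  also have "\<dots> = 2 * cosh x" by (simp add: cosh_field_def)
  finally show ?thesis by (simp add: divide_le_eq mult_ac)
qed

lemma enorm_pow_le: "enorm d z ^ (2 * m) \<le> real d ^ m * (\<Sum>i<d. z i ^ (2 * m))" if "d \<ge> 1"
proof -
  have ne: "(\<lambda>i. \<bar>z i\<bar>) ` {..<d} \<noteq> {}" "finite ((\<lambda>i. \<bar>z i\<bar>) ` {..<d})"
    using that by (auto simp: lessThan_empty_iff)
  from Max_in[OF ne(2,1)] obtain j where j: "j < d" "Max ((\<lambda>i. \<bar>z i\<bar>) ` {..<d}) = \<bar>z j\<bar>" by auto
  have le: "\<bar>z i\<bar> \<le> \<bar>z j\<bar>" if "i < d" for i using that ne by (subst j(2)[symmetric]) (intro Max_ge, auto)
  have "(enorm d z)\<^sup>2 = (\<Sum>i<d. (z i)\<^sup>2)" by (simp add: L2_set_def sum_nonneg)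
  also have "\<dots> \<le> (\<Sum>i<d. (z j)\<^sup>2)"
    using le by (intro sum_mono) (simp add: abs_le_square_iff)
  finally have "(enorm d z)\<^sup>2 \<le> real d * (z j)\<^sup>2" by simp
  then have "((enorm d z)\<^sup>2) ^ m \<le> (real d * (z j)\<^sup>2) ^ m" by (intro power_mono) auto
  also have "\<dots> = real d ^ m * z j ^ (2 * m)" by (simp add: power_mult_distrib power_mult)
  also have "\<dots> \<le> real d ^ m * (\<Sum>i<d. z i ^ (2 * m))"
    using j(1) by (intro mult_left_mono member_le_sum) auto
  finally show ?thesis by (simp add: power_mult)
qed

text \<open>In c the left side is convex, with values 1 at c = 0 and (1 + y)^n at c = 1. The point
  is the factor c on the right: small c makes the excess over 1 small.\<close>

lemma power_convex_bound:
  assumes c: "0 \<le> c" "c \<le> 1" and y: "0 \<le> (y::real)"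
  shows "(1 + c * y) ^ n \<le> 1 + c * (1 + y) ^ n"
proof (induction n)
  case (Suc n)
  have "(1 + c * y) ^ Suc n = (1 + c * y) * (1 + c * y) ^ n" by simp
  also have "\<dots> = (1 + c * y) ^ n + c * (y * (1 + c * y) ^ n)" by (simp add: algebra_simps)
  also have "\<dots> \<le> (1 + c * (1 + y) ^ n) + c * (y * (1 + y) ^ n)"
  proof -
    have "c * y \<le> 1 * y" by (intro mult_right_mono c y)
    moreover have "0 \<le> c * y" using c y by simp
    ultimately have "(1 + c * y) ^ n \<le> (1 + y) ^ n" by (intro power_mono) linarith+
    from mult_left_mono[OF mult_left_mono[OF this y] c(1)] Suc.IH show ?thesis by linarith
  qed
  also have "\<dots> = 1 + c * (1 + y) ^ Suc n" by (simp add: algebra_simps)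
  finally show ?case .
qed (use c in simp)

lemma one_plus_power_le: "(1 + y) ^ (2 * m) \<le> 4 ^ m * (1 + y ^ (2 * m))" if "0 \<le> (y::real)"
proof -
  have "(1 + y) ^ (2 * m) \<le> (2 * max 1 y) ^ (2 * m)" using that by (intro power_mono) auto
  also have "\<dots> = 4 ^ m * max 1 y ^ (2 * m)" by (simp add: power_mult_distrib power_mult)
  also have "max 1 y ^ (2 * m) \<le> 1 + y ^ (2 * m)" using that by (cases "y \<le> 1") (auto simp: max_def)
  finally show ?thesis by simp
qed

lemma ennreal_affine:
  assumes "0 \<le> a" "0 \<le> b" "0 \<le> c"
  shows "ennreal a * (1 + ennreal b * ennreal c) = ennreal (a * (1 + b * c))"
proof -
  have "1 + ennreal b * ennreal c = ennreal (1 + b * c)"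
    using assms by (subst ennreal_plus) (simp_all add: ennreal_mult)
  then show ?thesis using assms by (simp add: ennreal_mult)
qed

text \<open>Free of d, because norms are measured in units of d. The quotient comes from
  \<open>power_le_cosh\<close> with a cosh of mean 2, and 4^m from splitting the power of a
  sum.\<close>

definition moment_const :: "real \<Rightarrow> nat \<Rightarrow> real" where
  "moment_const lam m = 4 ^ m * (1 + 4 * fact (2 * m) / lam ^ m)"

context exp_gauss begin

lemma enorm_measurable [measurable]: "enorm d \<in> borel_measurable borel"
proof -
  have [measurable]: "(\<lambda>x :: nat \<Rightarrow> real. x i) \<in> borel_measurable borel" for i by (rule measurable_coordinate)
  show ?thesis unfolding L2_set_def by measurable
qed

lemma coordinate_moment:
  assumes i: "i < d"
  shows "(\<integral>\<^sup>+z. ennreal (z i ^ (2 * m)) \<partial>\<nu>) \<le> ennreal (4 * fact (2 * m) / lam ^ m)"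
proof -
  \<comment> \<open>At this rate half of the square is \<open>lam / 2\<close>, so the mean of the
    cosh is exactly 2.\<close>
  define s where "s = sqrt lam"
  have s: "s\<^sup>2 = lam" "s > 0" using lam_pos by (simp_all add: s_def)
  define \<kappa> where "\<kappa> a = (\<lambda>l. a * unitv i l)" for a
  have dk: "dotd d (\<kappa> a) z = a * z i" for a z unfolding \<kappa>_def dotd_scale using i by simp
  have "sqd d (\<kappa> a) = a\<^sup>2" for a
    using i by (simp add: sqd_def \<kappa>_def unitv_def power_mult_distrib if_distrib[of "\<lambda>c. c\<^sup>2"] if_distrib[of "\<lambda>c. _ * c"] cong: if_cong)
  then have l: "sqd d (\<kappa> s) / 2 < lam" "sqd d (\<kappa> (- s)) / 2 < lam"
    and v: "lam / (lam - sqd d (\<kappa> s) / 2) = 2" "lam / (lam - sqd d (\<kappa> (- s)) / 2) = 2"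
    using s lam_pos by (auto simp: field_simps)
  have ch: "cosh (s * z i) = exp (dotd d (\<kappa> s) z) / 2 + exp (dotd d (\<kappa> (- s)) z) / 2" for z
    unfolding dk by (simp add: cosh_field_def add_divide_distrib)
  have i1: "integrable \<nu> (\<lambda>z. cosh (s * z i))"
    unfolding ch by (intro Bochner_Integration.integrable_add integrable_divide expI l)
  have "expectation (\<lambda>z. cosh (s * z i)) = 2"
    unfolding ch by (subst Bochner_Integration.integral_add, (intro integrable_divide expI l)+) (simp add: expE[OF l(1)] expE[OF l(2)] v)
  then have nn: "(\<integral>\<^sup>+z. ennreal (cosh (s * z i)) \<partial>\<nu>) = ennreal 2"
    using i1 by (subst nn_integral_eq_integral) (auto intro: order_trans[OF zero_le_one cosh_real_ge_1])
  have le: "z i ^ (2 * m) \<le> 2 * fact (2 * m) / lam ^ m * cosh (s * z i)" for z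
  proof -
    have "lam ^ m * z i ^ (2 * m) = (s * z i) ^ (2 * m)"
      using s(1) by (simp add: power_mult_distrib power_mult)
    also have "\<dots> \<le> 2 * fact (2 * m) * cosh (s * z i)" by (rule power_le_cosh)
    finally show ?thesis using lam_pos by (simp add: field_simps)
  qed
  have "(\<integral>\<^sup>+z. ennreal (z i ^ (2 * m)) \<partial>\<nu>) \<le> (\<integral>\<^sup>+z. ennreal (2 * fact (2 * m) / lam ^ m) * ennreal (cosh (s * z i)) \<partial>\<nu>)"
    using le lam_pos by (intro nn_integral_mono) (simp add: ennreal_mult'[symmetric] ennreal_leI)
  also have "\<dots> = ennreal (2 * fact (2 * m) / lam ^ m) * ennreal 2"
    using i1 by (subst nn_integral_cmult) (auto simp: nn)
  also have "\<dots> = ennreal (4 * fact (2 * m) / lam ^ m)" by (subst ennreal_mult'[symmetric]) (use lam_pos in simp_all)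
  finally show ?thesis .
qed

text \<open>|z|^(2m) is at most d^m times a sum of d powers; division by d^(2m) leaves d^(-m) <= 1 /
  d, which compensates the number of summands. This is where m >= 1 enters.\<close>

lemma norm_moment:
  assumes m: "m \<ge> 1"
  shows "(\<integral>\<^sup>+z. ennreal ((1 + enorm d z / real d) ^ (2 * m)) \<partial>\<nu>) \<le> ennreal (moment_const lam m)"
proof -
  let ?C = "4 * fact (2 * m) / lam ^ m"
  have C: "0 \<le> ?C" using lam_pos by simp
  have dd: "real d > 0" using d_pos by simp
  have le: "(1 + enorm d z / real d) ^ (2 * m) \<le> 4 ^ m * (1 + (\<Sum>i<d. z i ^ (2 * m)) / real d)" for z
  proof -
    have "(enorm d z / real d) ^ (2 * m) \<le> real d ^ m * (\<Sum>i<d. z i ^ (2 * m)) / real d ^ (2 * m)"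
      using enorm_pow_le[OF d_pos, of z m] by (simp add: power_divide divide_right_mono)
    also have "\<dots> = (\<Sum>i<d. z i ^ (2 * m)) / real d ^ m"
    proof -
      have "real d ^ (2 * m) = real d ^ m * real d ^ m" by (simp add: mult_2 power_add)
      then show ?thesis using dd by simp
    qed
    also have "\<dots> \<le> (\<Sum>i<d. z i ^ (2 * m)) / real d"
      using d_pos m by (intro divide_left_mono self_le_power sum_nonneg) auto
    finally have "1 + (enorm d z / real d) ^ (2 * m) \<le> 1 + (\<Sum>i<d. z i ^ (2 * m)) / real d" by simp
    then have 2: "4 ^ m * (1 + (enorm d z / real d) ^ (2 * m)) \<le> 4 ^ m * (1 + (\<Sum>i<d. z i ^ (2 * m)) / real d)"
      by (intro mult_left_mono) auto
    have "0 \<le> enorm d z / real d" by (simp add: L2_set_nonneg)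
    from order_trans[OF one_plus_power_le[OF this] 2] show ?thesis .
  qed
  have [measurable]: "(\<lambda>z. z i ^ (2 * m)) \<in> borel_measurable \<nu>" for i
    using measurable_coordinate[of i] by (simp add: measurable_cong_sets[OF sets_nu refl])
  have "(\<integral>\<^sup>+z. ennreal ((1 + enorm d z / real d) ^ (2 * m)) \<partial>\<nu>) \<le>
      (\<integral>\<^sup>+z. ennreal (4 ^ m) * (1 + ennreal (1 / real d) * (\<Sum>i<d. ennreal (z i ^ (2 * m)))) \<partial>\<nu>)"
  proof (rule nn_integral_mono)
    fix z
    have "ennreal (4 ^ m) * (1 + ennreal (1 / real d) * (\<Sum>i<d. ennreal (z i ^ (2 * m)))) =
        ennreal (4 ^ m * (1 + (\<Sum>i<d. z i ^ (2 * m)) / real d))"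
      using ennreal_affine[of "4 ^ m" "1 / real d" "\<Sum>i<d. z i ^ (2 * m)"] by (simp add: sum_ennreal sum_nonneg)
    then show "ennreal ((1 + enorm d z / real d) ^ (2 * m)) \<le> ennreal (4 ^ m) * (1 + ennreal (1 / real d) * (\<Sum>i<d. ennreal (z i ^ (2 * m))))"
      using le[of z] by (simp only: ennreal_leI)
  qed
  also have "\<dots> = ennreal (4 ^ m) * (1 + ennreal (1 / real d) * (\<Sum>i<d. (\<integral>\<^sup>+z. ennreal (z i ^ (2 * m)) \<partial>\<nu>)))"
    by (simp add: nn_integral_cmult nn_integral_add nn_integral_sum emeasure_space_1 del: sum_ennreal)
  also have "\<dots> \<le> ennreal (4 ^ m) * (1 + ennreal (1 / real d) * (\<Sum>i<d. ennreal ?C))"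
    by (intro mult_left_mono add_left_mono sum_mono coordinate_moment) auto
  also have "(\<Sum>i<d. ennreal ?C) = ennreal (\<Sum>i<d. ?C)" by (rule sum_ennreal) (rule C)
  also have "(\<Sum>i<d. ?C) = real d * ?C" by simp
  also have "ennreal (4 ^ m) * (1 + ennreal (1 / real d) * ennreal (real d * ?C)) = ennreal (moment_const lam m)"
    using ennreal_affine[of "4 ^ m" "1 / real d" "real d * ?C", OF _ _ mult_nonneg_nonneg[OF of_nat_0_le_iff C]] dd
    by (simp add: moment_const_def)
  finally show ?thesis .
qed

text \<open>A large K makes a random step a small relative change of K + |x|, even at x = 0.\<close>

definition weight :: "real \<Rightarrow> real \<Rightarrow> (nat \<Rightarrow> real) \<Rightarrow> real" where
  "weight K p x = (K + enorm d x) powr p"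

lemma weight_measurable [measurable]: "weight K p \<in> borel_measurable borel"
  unfolding weight_def[abs_def] by measurable

lemma weight_ge_1: "K \<ge> 1 \<Longrightarrow> 0 \<le> p \<Longrightarrow> 1 \<le> weight K p x"
proof -
  assume "K \<ge> 1" "0 \<le> p"
  moreover from this have "1 \<le> K + enorm d x" using L2_set_nonneg[of x "{..<d}"] by linarith
  ultimately show ?thesis unfolding weight_def by (intro ge_one_powr_ge_zero)
qed

text \<open>The step changes K + |x| at most by the factor 1 + c |z| / d, since \<beta> |z| =
  (\<beta> d) |z| / d <= c K |z| / d. The exponent p is raised to the integer m, and
  \<open>power_convex_bound\<close> keeps the growth of the second moment below 1 + c
  \<open>moment_const lam m\<close>.\<close>

lemma weight_move:
  assumes p: "0 \<le> p" "p \<le> real m" and m: "m \<ge> 1" and c: "0 \<le> c" "c \<le> 1"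
    and \<rho>: "1 + c * moment_const lam m \<le> \<rho>" and K: "K > 0"
    and B: "\<And>z. enorm d (mat_vec d B z) \<le> \<beta> * enorm d z" and \<beta>: "\<beta> * real d \<le> c * K" "0 \<le> \<beta>"
  shows "L2_le \<nu> (\<lambda>z. weight K p (move d B x z)) (sqrt \<rho> * weight K p x)"
  unfolding L2_le_def
proof (intro conjI)
  let ?y = "\<lambda>z. enorm d z / real d"
  have dd: "real d > 0" using d_pos by simp
  have mc: "0 \<le> moment_const lam m" using lam_pos by (simp add: moment_const_def)
  have \<rho>1: "1 \<le> \<rho>" using \<rho> mult_nonneg_nonneg[OF c(1) mc] by linarith
  show "(\<lambda>z. weight K p (move d B x z)) \<in> borel_measurable \<nu>" by measurable
  show "0 \<le> sqrt \<rho> * weight K p x" using \<rho>1 by (simp add: weight_def)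
  have y: "0 \<le> ?y z" for z by (simp add: L2_set_nonneg)
  have le: "(weight K p (move d B x z))\<^sup>2 \<le> (weight K p x)\<^sup>2 * (1 + c * (1 + ?y z) ^ (2 * m))" for z
  proof -
    let ?n = "enorm d x"
    have n: "0 \<le> ?n" by (rule L2_set_nonneg)
    have tri: "enorm d (move d B x z) \<le> ?n + enorm d (mat_vec d B z)"
      unfolding move_def by (rule L2_set_triangle_ineq)
    have bz: "enorm d (mat_vec d B z) \<le> c * ?y z * (K + ?n)"
    proof -
      have "\<beta> * enorm d z = (\<beta> * real d) * ?y z" using dd by simp
      also have "\<dots> \<le> (c * K) * ?y z" by (intro mult_right_mono \<beta> y)
      also have "\<dots> = c * ?y z * K" by simp
      also have "\<dots> \<le> c * ?y z * (K + ?n)" using c y n by (intro mult_left_mono) auto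
      finally show ?thesis using B[of z] by linarith
    qed
    have "K + enorm d (move d B x z) \<le> (K + ?n) * (1 + c * ?y z)"
      using tri bz by (simp add: distrib_left mult.commute)
    then have "weight K p (move d B x z) \<le> ((K + ?n) * (1 + c * ?y z)) powr p"
      unfolding weight_def using K p by (intro powr_mono2) (auto simp: L2_set_nonneg)
    also have "\<dots> = weight K p x * (1 + c * ?y z) powr p"
      using K n c y[of z] by (simp add: weight_def powr_mult)
    also have "\<dots> \<le> weight K p x * (1 + c * ?y z) ^ m"
    proof (intro mult_left_mono)
      have "(1 + c * ?y z) powr p \<le> (1 + c * ?y z) powr real m"
        using c y[of z] p by (intro powr_mono) auto
      also have "\<dots> = (1 + c * ?y z) ^ m" using mult_nonneg_nonneg[OF c(1) y[of z]] by (intro powr_realpow) linarith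
      finally show "(1 + c * ?y z) powr p \<le> (1 + c * ?y z) ^ m" .
    qed (simp add: weight_def)
    finally have "(weight K p (move d B x z))\<^sup>2 \<le> (weight K p x * (1 + c * ?y z) ^ m)\<^sup>2"
      by (rule power_mono) (simp add: weight_def)
    also have "\<dots> = (weight K p x)\<^sup>2 * (1 + c * ?y z) ^ (2 * m)"
      by (simp add: power_mult_distrib power_mult[symmetric] mult.commute)
    also have "\<dots> \<le> (weight K p x)\<^sup>2 * (1 + c * (1 + ?y z) ^ (2 * m))"
      by (intro mult_left_mono power_convex_bound c y) auto
    finally show ?thesis .
  qed
  have [measurable]: "(\<lambda>z. enorm d z) \<in> borel_measurable \<nu>"
    using enorm_measurable by (simp add: measurable_cong_sets[OF sets_nu refl])
  have "(\<integral>\<^sup>+z. ennreal ((weight K p (move d B x z))\<^sup>2) \<partial>\<nu>) \<le>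
     (\<integral>\<^sup>+z. ennreal ((weight K p x)\<^sup>2) * (1 + ennreal c * ennreal ((1 + ?y z) ^ (2 * m))) \<partial>\<nu>)"
  proof (rule nn_integral_mono)
    fix z
    have "ennreal ((weight K p x)\<^sup>2) * (1 + ennreal c * ennreal ((1 + ?y z) ^ (2 * m))) =
      ennreal ((weight K p x)\<^sup>2 * (1 + c * (1 + ?y z) ^ (2 * m)))"
      using y[of z] c by (intro ennreal_affine) auto
    then show "ennreal ((weight K p (move d B x z))\<^sup>2) \<le> ennreal ((weight K p x)\<^sup>2) * (1 + ennreal c * ennreal ((1 + ?y z) ^ (2 * m)))"
      using le[of z] by (simp only: ennreal_leI)
  qed
  also have "\<dots> = ennreal ((weight K p x)\<^sup>2) * (1 + ennreal c * (\<integral>\<^sup>+z. ennreal ((1 + ?y z) ^ (2 * m)) \<partial>\<nu>))"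
    by (simp add: nn_integral_cmult nn_integral_add emeasure_space_1)
  also have "\<dots> \<le> ennreal ((weight K p x)\<^sup>2) * (1 + ennreal c * ennreal (moment_const lam m))"
    by (intro mult_left_mono add_left_mono norm_moment m) auto
  also have "\<dots> = ennreal ((weight K p x)\<^sup>2 * (1 + c * moment_const lam m))"
    using c mc by (intro ennreal_affine) auto
  also have "\<dots> \<le> ennreal ((sqrt \<rho> * weight K p x)\<^sup>2)"
  proof (rule ennreal_leI)
    have "(weight K p x)\<^sup>2 * (1 + c * moment_const lam m) \<le> (weight K p x)\<^sup>2 * \<rho>" by (intro mult_left_mono \<rho>) simp
    then show "(weight K p x)\<^sup>2 * (1 + c * moment_const lam m) \<le> (sqrt \<rho> * weight K p x)\<^sup>2"
      using \<rho>1 by (simp add: power_mult_distrib mult.commute)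
  qed
  finally show "(\<integral>\<^sup>+z. ennreal ((weight K p (move d B x z))\<^sup>2) \<partial>\<nu>) \<le> ennreal ((sqrt \<rho> * weight K p x)\<^sup>2)" .
qed

end

section \<open>An explicit bound for the solution of the fixed point equation\<close>

context exp_gauss begin

text \<open>A subexponential solution of the fixed point equation is finite in the weighted supremum norm
  with weight \<open>w + \<eta> \<psi>\<close>, in which the equation is a strict contraction up to the source term.\<close>

lemma fixed_point_bound:
  assumes u: "subexp d u" and w: "\<And>x. 1 \<le> w x" and a: "0 \<le> a" "a < 1" and \<rho>: "1 < \<rho>" "a\<^sup>2 * \<rho> \<le> 1"
    and wE: "\<And>x. integrable \<nu> (\<lambda>z. w (move d B x z))" "\<And>x. expectation (\<lambda>z. w (move d B x z)) \<le> sqrt \<rho> * w x"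
    and G: "0 \<le> G" and g: "\<And>y. y \<in> Rd d \<Longrightarrow> \<bar>g y (u y)\<bar> \<le> a\<^sup>2 * \<bar>u y\<bar> + G * w y"
    and fp: "\<And>x. x \<in> Rd d \<Longrightarrow> u x = expectation (\<lambda>z. g (move d B x z) (u (move d B x z)))"
    and x: "x \<in> Rd d"
  shows "\<bar>u x\<bar> \<le> G * sqrt \<rho> / (1 - a) * w x"
proof -
  define s where "s = sqrt \<rho>"
  have s: "1 < s" "s\<^sup>2 = \<rho>" using \<rho> by (simp_all add: s_def)
  \<comment> \<open>Averaging the weight costs s = sqrt \<rho>; because a s <= 1, the Lipschitz
    constant a^2 still leaves the contraction a.\<close>
  have as: "a\<^sup>2 * s \<le> a"
  proof -
    have "(a * s)\<^sup>2 \<le> 1\<^sup>2" using \<rho>(2) s(2) by (simp add: power_mult_distrib)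
    then have "a * s \<le> 1" by (rule power2_le_imp_le) simp
    from mult_left_mono[OF this a(1)] show ?thesis by (simp add: power2_eq_square mult.assoc)
  qed
  have ls: "0 < lam / s" "lam / s < lam" using lam_pos s by (simp_all add: divide_less_eq)
  then have "0 < 2 * (lam - lam / s)" by simp
  have half: "X / 2 < lam" "t \<le> lam - X / 2" if "X \<le> 2 * (lam - t)" "0 < t" for X t :: real
    using that by (simp_all add: field_simps)
  \<comment> \<open>So small that averaging \<open>psi\<close> costs at most the same factor s as
    averaging w.\<close>
  obtain c where c: "c > 0" "\<And>i. i < d \<Longrightarrow> c\<^sup>2 * qform d B (unitv i) \<le> 2 * (lam - lam / s)"
    using small_c[OF \<open>0 < 2 * (lam - lam / s)\<close>] by metis
  have q: "c\<^sup>2 * qform d B (unitv i) / 2 < lam" if "i < d" for i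
    using half(1)[OF c(2)[OF that] ls(1)] .
  have qs: "lam / (lam - c\<^sup>2 * qform d B (unitv i) / 2) \<le> s" if "i < d" for i
  proof -
    have "lam / s \<le> lam - c\<^sup>2 * qform d B (unitv i) / 2" using half(2)[OF c(2)[OF that] ls(1)] .
    with ls(1) have "lam / (lam - c\<^sup>2 * qform d B (unitv i) / 2) \<le> lam / (lam / s)"
      using lam_pos by (intro frac_le) auto
    then show ?thesis using lam_pos by simp
  qed
  note psi_int = psi_move_integrable[OF q] and psi_E = psi_move[OF q qs]
  let ?N = "G * s / (1 - a)"
  have N: "0 \<le> ?N" using G s a by simp
  have bound: "\<bar>u x\<bar> \<le> ?N * (w x + \<eta> * psi d c x)" if \<eta>: "\<eta> > 0" and x: "x \<in> Rd d" for \<eta> x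
  proof -
    let ?w = "\<lambda>y. w y + \<eta> * psi d c y"
    have w1: "1 \<le> ?w y" for y
      using w[of y] mult_nonneg_nonneg[of \<eta> "psi d c y"] psi_ge_1[OF d_pos, of c y] \<eta> by linarith
    \<comment> \<open>The best constant in the perturbed norm; the multiple of \<open>psi\<close>
      makes it finite before u is known to be bounded by a multiple of w.\<close>
    define S where "S = (SUP y\<in>Rd d. \<bar>u y\<bar> / ?w y)"
    have bdd: "bdd_above ((\<lambda>y. \<bar>u y\<bar> / ?w y) ` Rd d)"
    proof -
      obtain N0 where N0: "N0 > 0" "\<And>x. x \<in> Rd d \<Longrightarrow> N0 < enorm d x \<Longrightarrow> \<bar>u x\<bar> + 0 \<le> \<eta> * psi d c x"
        using subexp_psi[OF u d_pos c(1) \<eta>, of 0] by metis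
      obtain C where C: "\<And>x. x \<in> Rd d \<Longrightarrow> \<bar>u x\<bar> \<le> C * exp (1 * enorm d x)"
        using u unfolding subexp_def by (meson zero_less_one)
      have "\<bar>u y\<bar> / ?w y \<le> max 1 (\<bar>C\<bar> * exp N0)" if y: "y \<in> Rd d" for y
      proof (cases "N0 < enorm d y")
        case True
        then have "\<bar>u y\<bar> \<le> ?w y" using N0(2)[OF y] w[of y] by simp
        then have "\<bar>u y\<bar> / ?w y \<le> 1" using w1[of y] by (subst divide_le_eq_1_pos) auto
        then show ?thesis by simp
      next
        case False
        have "\<bar>u y\<bar> / ?w y \<le> \<bar>u y\<bar> / 1" using w1[of y] by (intro divide_left_mono) auto
        also have "\<dots> \<le> C * exp (enorm d y)" using C[OF y] by simp
        also have "\<dots> \<le> \<bar>C\<bar> * exp N0" using False by (intro mult_mono) auto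
        finally show ?thesis by simp
      qed
      then show ?thesis by (rule bdd_aboveI2)
    qed
    have uS: "\<bar>u y\<bar> \<le> S * ?w y" if "y \<in> Rd d" for y
    proof -
      have "\<bar>u y\<bar> / ?w y \<le> S" unfolding S_def by (rule cSUP_upper[OF that bdd])
      then show ?thesis using w1[of y] by (subst (asm) pos_divide_le_eq) auto
    qed
    have S0: "0 \<le> S"
    proof -
      have "0 \<le> \<bar>u x\<bar> / ?w x" using w1[of x] by simp
      also have "\<dots> \<le> S" unfolding S_def by (rule cSUP_upper[OF x bdd])
      finally show ?thesis .
    qed
    have step: "\<bar>u y\<bar> \<le> (a * S + G * s) * ?w y" if y: "y \<in> Rd d" for y
    proof -
      let ?m = "\<lambda>z. move d B y z"
      have wi: "integrable \<nu> (\<lambda>z. ?w (?m z))" using wE(1) psi_int by simp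
      have pw: "0 \<le> \<eta> * psi d c v" for v using \<eta> psi_ge_1[OF d_pos, of c v] by simp
      have le: "\<bar>g (?m z) (u (?m z))\<bar> \<le> (a\<^sup>2 * S + G) * ?w (?m z)" for z
      proof -
        have m: "?m z \<in> Rd d" by (rule move_Rd[OF y])
        have "a\<^sup>2 * \<bar>u (?m z)\<bar> \<le> a\<^sup>2 * (S * ?w (?m z))" by (intro mult_left_mono uS m) simp
        moreover have "G * w (?m z) \<le> G * ?w (?m z)" using pw G by (intro mult_left_mono) auto
        ultimately show ?thesis using g[OF m] by (simp add: distrib_right mult.assoc)
      qed
      have "\<bar>u y\<bar> \<le> expectation (\<lambda>z. \<bar>g (?m z) (u (?m z))\<bar>)" unfolding fp[OF y] by (rule integral_abs_bound)
      also have "\<dots> \<le> expectation (\<lambda>z. (a\<^sup>2 * S + G) * ?w (?m z))"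
      proof (rule integral_mono')
        show "integrable \<nu> (\<lambda>z. (a\<^sup>2 * S + G) * ?w (?m z))" using wi by simp
        show "\<bar>g (?m z) (u (?m z))\<bar> \<le> (a\<^sup>2 * S + G) * ?w (?m z)" for z by (rule le)
        show "0 \<le> (a\<^sup>2 * S + G) * ?w (?m z)" for z by (rule order_trans[OF abs_ge_zero le])
      qed
      also have "\<dots> = (a\<^sup>2 * S + G) * (expectation (\<lambda>z. w (?m z)) + \<eta> * expectation (\<lambda>z. psi d c (?m z)))"
        using wE(1)[of y] psi_int[of y] by simp
      also have "\<dots> \<le> (a\<^sup>2 * S + G) * (s * w y + \<eta> * (s * psi d c y))"
        using wE(2)[of y] psi_E[of y] S0 G \<eta> unfolding s_def
        by (intro mult_left_mono add_mono) auto
      also have "\<dots> = (a\<^sup>2 * s * S + G * s) * ?w y" by (simp add: algebra_simps)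
      also have "\<dots> \<le> (a * S + G * s) * ?w y"
        using as S0 w1[of y] by (intro mult_right_mono add_right_mono) auto
      finally show ?thesis .
    qed
    \<comment> \<open>As \<open>S\<close> is finite, this inequality can be solved for it, and the
      result does not depend on \<eta>.\<close>
    have "S \<le> a * S + G * s"
      unfolding S_def
    proof (rule cSUP_least)
      show "Rd d \<noteq> {}" using x by auto
      fix y assume "y \<in> Rd d"
      from step[OF this] show "\<bar>u y\<bar> / ?w y \<le> a * (SUP y\<in>Rd d. \<bar>u y\<bar> / ?w y) + G * s"
        unfolding S_def[symmetric] using w1[of y] by (subst pos_divide_le_eq) auto
    qed
    then have "S * (1 - a) \<le> G * s" by (simp add: algebra_simps)
    then have "S \<le> ?N" using a by (simp add: pos_le_divide_eq)
    then have "S * ?w x \<le> ?N * ?w x" using w1[of x] by (intro mult_right_mono) auto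
    then show ?thesis using uS[OF x] by linarith
  qed
  have lim: "((\<lambda>\<eta>. ?N * (w x + \<eta> * psi d c x)) \<longlongrightarrow> ?N * (w x + 0 * psi d c x)) (at_right 0)"
    by (intro tendsto_intros)
  have ev: "\<forall>\<^sub>F \<eta> in at_right 0. \<bar>u x\<bar> \<le> ?N * (w x + \<eta> * psi d c x)"
    using bound[OF _ x] by (simp add: eventually_at_filter)
  from tendsto_lowerbound[OF lim ev trivial_limit_at_right_real] show ?thesis by (simp add: s_def)
qed

end

subsection \<open>Complexity of the scheme\<close>

text \<open>The bound D (3 M)^n is inductive because the terms 1 + 3^k + 3^(k-1) are at most 2 times
  3^k, so that, together with 1, those with 1 <= k < n sum to at most 3^n.\<close>

lemma cost_bound:
  fixes C :: "nat \<Rightarrow> real"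
  assumes M: "M \<ge> 1" and D: "0 \<le> D"
    and C: "\<And>n. C n \<le> D * real M ^ n + (\<Sum>k=1..<n. real M ^ (n - k) * (D + C k + C (k - 1)))"
  shows "C n \<le> D * (3 * real M) ^ n"
proof (induction n rule: less_induct)
  case (less n)
  have T: "1 + (\<Sum>k=1..<j. 1 + 3 ^ k + 3 ^ (k - 1)) \<le> (3::real) ^ j" for j
  proof (induction j)
    case (Suc j)
    show ?case
    proof (cases j)
      case (Suc i)
      have "(\<Sum>k=1..<Suc j. 1 + 3 ^ k + 3 ^ (k - 1)) = (\<Sum>k=1..<j. 1 + 3 ^ k + 3 ^ (k - 1)) + (1 + 3 ^ j + 3 ^ (j - 1) :: real)"
        using Suc by simp
      moreover have "1 \<le> (3::real) ^ (j - 1)" "(3::real) ^ j = 3 * 3 ^ (j - 1)" using Suc by simp_all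
      ultimately have "1 + (\<Sum>k=1..<Suc j. 1 + 3 ^ k + 3 ^ (k - 1)) \<le> 3 * (3::real) ^ j"
        using \<open>1 + (\<Sum>k=1..<j. 1 + 3 ^ k + 3 ^ (k - 1)) \<le> (3::real) ^ j\<close> by linarith
      then show ?thesis by (simp only: power_Suc)
    qed simp
  qed simp
  have "C n \<le> D * real M ^ n + (\<Sum>k=1..<n. real M ^ (n - k) * (D + C k + C (k - 1)))" by (rule C)
  also have "\<dots> \<le> D * real M ^ n + (\<Sum>k=1..<n. D * real M ^ n * (1 + 3 ^ k + 3 ^ (k - 1)))"
  proof (intro add_left_mono sum_mono)
    fix k assume k: "k \<in> {1..<n}"
    have M1: "1 \<le> real M" using M by simp
    have "real M ^ (n - k) * (D + C k + C (k - 1)) \<le> real M ^ (n - k) * (D + D * (3 * real M) ^ k + D * (3 * real M) ^ (k - 1))"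
      using k M by (intro mult_left_mono add_mono less.IH) auto
    also have "\<dots> = D * (real M ^ (n - k) + 3 ^ k * (real M ^ (n - k) * real M ^ k) + 3 ^ (k - 1) * (real M ^ (n - k) * real M ^ (k - 1)))"
      by (simp add: power_mult_distrib algebra_simps)
    also have "\<dots> \<le> D * (real M ^ n + 3 ^ k * real M ^ n + 3 ^ (k - 1) * real M ^ n)"
    proof (intro mult_left_mono add_mono D)
      show "real M ^ (n - k) \<le> real M ^ n" using M1 by (intro power_increasing) auto
      show "real M ^ (n - k) * real M ^ k \<le> real M ^ n" using k by (simp add: power_add[symmetric])
      show "real M ^ (n - k) * real M ^ (k - 1) \<le> real M ^ n"
        using M1 k by (simp add: power_add[symmetric] power_increasing)
    qed auto
    also have "\<dots> = D * real M ^ n * (1 + 3 ^ k + 3 ^ (k - 1))" by (simp add: algebra_simps)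
    finally show "real M ^ (n - k) * (D + C k + C (k - 1)) \<le> D * real M ^ n * (1 + 3 ^ k + 3 ^ (k - 1))" .
  qed
  also have "\<dots> = D * real M ^ n * (1 + (\<Sum>k=1..<n. 1 + 3 ^ k + 3 ^ (k - 1)))"
    by (simp add: distrib_left sum_distrib_left)
  also have "\<dots> \<le> D * real M ^ n * 3 ^ n" using D by (intro mult_left_mono T) auto
  finally show ?case by (simp add: power_mult_distrib mult_ac)
qed

text \<open>The level is n0 + k with k the rounded up solution of y \<delta>^k = 1, for which b^k
  would be y^\<alpha>. Rounding costs one factor b, and the lower bound n0 costs b^n0.\<close>

lemma exists_level:
  fixes \<delta> b y :: real
  assumes \<delta>: "0 < \<delta>" "\<delta> < 1" and b: "b > 1" and \<alpha>: "\<alpha> = - ln b / ln \<delta>" and y: "1 \<le> y"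
  shows "\<exists>n\<ge>n0. y * \<delta> ^ n \<le> 1 \<and> b ^ n \<le> b ^ (n0 + 1) * y powr \<alpha>"
proof -
  define x where "x = ln y / (- ln \<delta>)"
  have l: "ln \<delta> < 0" using \<delta> by simp
  have x: "0 \<le> x" using y l by (simp add: x_def divide_nonneg_neg)
  define k where "k = nat \<lceil>x\<rceil>"
  have k: "x \<le> real k" "real k \<le> x + 1" using x by (simp_all add: k_def)
  have "ln y + real k * ln \<delta> \<le> 0"
  proof -
    have "x * (- ln \<delta>) \<le> real k * (- ln \<delta>)" using k l by (intro mult_right_mono) auto
    then show ?thesis using l by (simp add: x_def)
  qed
  then have "y * \<delta> ^ k \<le> 1"
  proof -
    assume *: "ln y + real k * ln \<delta> \<le> 0"
    have "y * \<delta> ^ k = exp (ln y + real k * ln \<delta>)" using y \<delta> by (simp add: exp_add exp_of_nat_mult)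
    then show ?thesis using * by simp
  qed
  then have "y * \<delta> ^ (n0 + k) \<le> 1"
  proof -
    assume *: "y * \<delta> ^ k \<le> 1"
    have "\<delta> ^ n0 * (y * \<delta> ^ k) \<le> 1 * 1" using \<delta> y * by (intro mult_mono power_le_one) auto
    then show ?thesis by (simp add: power_add mult_ac)
  qed
  moreover have "b ^ (n0 + k) \<le> b ^ (n0 + 1) * y powr \<alpha>"
  proof -
    have "b ^ k = exp (real k * ln b)" using b by (simp add: exp_of_nat_mult)
    also have "\<dots> \<le> exp ((x + 1) * ln b)" using k b by simp
    also have "\<dots> = b * exp (x * ln b)" using b by (simp add: distrib_right exp_add)
    also have "x * ln b = \<alpha> * ln y" by (simp add: x_def \<alpha>)
    also have "exp (\<alpha> * ln y) = y powr \<alpha>" using y by (simp add: powr_def)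
    finally have "b ^ n0 * b ^ k \<le> b ^ n0 * (b * y powr \<alpha>)" using b by (intro mult_left_mono) auto
    then show ?thesis by (simp add: power_add mult_ac)
  qed
  ultimately show ?thesis by (intro exI[of _ "n0 + k"]) auto
qed

section \<open>Subexponential functions and extension from \<open>Rd d\<close>\<close>

lemma rpow_subexp: "0 \<le> p \<Longrightarrow> subexp d (\<lambda>x. rpow (enorm d x) p)"
  unfolding subexp_def
proof (intro allI impI)
  fix \<eta> :: real assume p: "0 \<le> p" and \<eta>: "\<eta> > 0"
  show "\<exists>C. \<forall>x\<in>Rd d. \<bar>rpow (enorm d x) p\<bar> \<le> C * exp (\<eta> * enorm d x)"
  proof (cases "p = 0")
    case True
    then show ?thesis using \<eta> by (auto simp: rpow_def L2_set_nonneg intro!: exI[of _ 1])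
  next
    case False
    then have p0: "p > 0" using p by simp
    have "\<bar>rpow (enorm d x) p\<bar> \<le> (p / \<eta>) powr p * exp (\<eta> * enorm d x)" for x
    proof -
      \<comment> \<open>The inequality t <= exp t at this point, raised to the power p, recombines
        to the exponent \<eta> |x|.\<close>
      let ?t = "\<eta> * enorm d x / p"
      have t: "0 \<le> ?t" using \<eta> p0 by (simp add: L2_set_nonneg)
      have "enorm d x = (p / \<eta>) * ?t" using \<eta> p0 by simp
      then have "enorm d x powr p = ((p / \<eta>) * ?t) powr p" by simp
      also have "\<dots> = (p / \<eta>) powr p * ?t powr p" by (rule powr_mult)
      also have "?t powr p \<le> exp ?t powr p"
      proof (intro powr_mono2)
        show "?t \<le> exp ?t" using exp_ge_add_one_self[of ?t] by linarith
      qed (use t p0 in auto)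
      also have "exp ?t powr p = exp (\<eta> * enorm d x)" using p0 by (simp add: powr_def)
      finally show ?thesis using False by (simp add: rpow_def mult_left_mono)
    qed
    then show ?thesis by blast
  qed
qed

lemma subexp_const: "subexp d (\<lambda>_. c)"
  unfolding subexp_def
proof (intro allI impI exI ballI)
  fix \<eta> :: real and x :: "nat \<Rightarrow> real" assume "\<eta> > 0"
  then have "1 \<le> exp (\<eta> * enorm d x)" by (simp add: L2_set_nonneg)
  from mult_left_mono[OF this, of "\<bar>c\<bar>"] show "\<bar>c\<bar> \<le> \<bar>c\<bar> * exp (\<eta> * enorm d x)" by simp
qed

lemma subexp_dominated:
  assumes "subexp d f" "subexp d g" "\<And>x. x \<in> Rd d \<Longrightarrow> \<bar>h x\<bar> \<le> a * \<bar>f x\<bar> + b * \<bar>g x\<bar>" "0 \<le> a" "0 \<le> b"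
  shows "subexp d h"
  unfolding subexp_def
proof (intro allI impI)
  fix \<eta> :: real assume "\<eta> > 0"
  then obtain C D where C: "\<And>x. x \<in> Rd d \<Longrightarrow> \<bar>f x\<bar> \<le> C * exp (\<eta> * enorm d x)"
    and D: "\<And>x. x \<in> Rd d \<Longrightarrow> \<bar>g x\<bar> \<le> D * exp (\<eta> * enorm d x)"
    using assms(1,2) unfolding subexp_def by meson
  have "\<bar>h x\<bar> \<le> (a * C + b * D) * exp (\<eta> * enorm d x)" if x: "x \<in> Rd d" for x
  proof -
    have "\<bar>h x\<bar> \<le> a * \<bar>f x\<bar> + b * \<bar>g x\<bar>" by (rule assms(3)[OF x])
    also have "\<dots> \<le> a * (C * exp (\<eta> * enorm d x)) + b * (D * exp (\<eta> * enorm d x))"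
      by (intro add_mono mult_left_mono C D x assms)
    finally show ?thesis by (simp add: algebra_simps)
  qed
  then show "\<exists>C. \<forall>x\<in>Rd d. \<bar>h x\<bar> \<le> C * exp (\<eta> * enorm d x)" by blast
qed

text \<open>The abstract scheme lives on the whole type \<open>nat \<Rightarrow> real\<close>,
  whereas the assumptions on f and u speak of \<open>Rd d\<close>. Composition with
  \<open>proj\<close> extends both with continuity and bounds intact.\<close>

definition proj :: "nat \<Rightarrow> (nat \<Rightarrow> real) \<Rightarrow> nat \<Rightarrow> real" where
  "proj d x = (\<lambda>i. if i < d then x i else 0)"

lemma proj_Rd: "proj d x \<in> Rd d" by (simp add: proj_def Rd_iff)

lemma proj_id: "x \<in> Rd d \<Longrightarrow> proj d x = x"
  by (rule ext) (simp add: proj_def Rd_iff)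

lemma proj_move: "proj d (move d B x z) = move d B (proj d x) z"
  by (rule ext) (simp add: proj_def move_def mat_vec_def)

lemma mat_vec_proj: "mat_vec d B (proj d z) = mat_vec d B z"
  by (rule ext) (simp add: proj_def mat_vec_def)

lemma enorm_proj: "enorm d (proj d z) = enorm d z"
  by (rule L2_set_cong) (simp_all add: proj_def)

lemma continuous_map_proj: "continuous_map euclidean (Euclidean_space d) (\<lambda>x. proj d x)"
  unfolding proj_def continuous_map_componentwise_Euclidean_space
  by (simp add: continuous_on_coordinate)

lemma continuous_proj:
  assumes "continuous_map (Euclidean_space d) euclideanreal u"
  shows "continuous_on UNIV (\<lambda>x. u (proj d x))"
  using continuous_map_compose[OF continuous_map_proj assms] by (simp add: comp_def)

lemma continuous_proj_pair:
  assumes "continuous_map (prod_topology (Euclidean_space d) euclideanreal) euclideanreal (\<lambda>(x, v). f x v)"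
  shows "continuous_on UNIV (\<lambda>(x, v :: real). f (proj d x) v)"
proof -
  have "continuous_map euclidean (prod_topology (Euclidean_space d) euclideanreal) (\<lambda>p :: (nat \<Rightarrow> real) \<times> real. (proj d (fst p), snd p))"
  proof (rule continuous_map_pairedI)
    have "continuous_map euclidean euclidean (\<lambda>p :: (nat \<Rightarrow> real) \<times> real. fst p)" by (simp add: continuous_on_fst)
    from continuous_map_compose[OF this continuous_map_proj]
    show "continuous_map euclidean (Euclidean_space d) (\<lambda>p :: (nat \<Rightarrow> real) \<times> real. proj d (fst p))" by (simp add: comp_def)
    show "continuous_map euclidean euclideanreal (\<lambda>p :: (nat \<Rightarrow> real) \<times> real. snd p)" by (simp add: continuous_on_snd)
  qed
  from continuous_map_compose[OF this assms] show ?thesis by (simp add: comp_def case_prod_beta')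
qed

text \<open>The recursion is a pathwise identity: for a fixed realisation \<open>Z\<close>, the
  approximation at a node is the functional \<open>mlp\<close> of the noise below it.
  \<open>S\<close> is where the recursion is known, and steps do not leave it.\<close>

lemma (in mlp_scheme) mlp_representation:
  fixes U :: "int list \<Rightarrow> nat \<Rightarrow> 's \<Rightarrow> real" and Z :: "int list \<Rightarrow> 'z" and S :: "'s set"
  assumes U0: "\<And>\<theta> x. \<theta> \<in> Theta \<Longrightarrow> x \<in> S \<Longrightarrow> U \<theta> 0 x = 0"
    and U: "\<And>n \<theta> x. 1 \<le> n \<Longrightarrow> \<theta> \<in> Theta \<Longrightarrow> x \<in> S \<Longrightarrow> U \<theta> n x =
      1 / real (M ^ n) * (\<Sum>m=1..M ^ n. g (T x (Z (\<theta> @ [0, int m]))) 0) +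
      (\<Sum>k=1..<n. 1 / real (M ^ (n - k)) * (\<Sum>m=1..M ^ (n - k).
         g (T x (Z (\<theta> @ [int k, int m]))) (U (\<theta> @ [int k, int m]) k (T x (Z (\<theta> @ [int k, int m]))))
         - g (T x (Z (\<theta> @ [int k, int m]))) (U (\<theta> @ [int k, - int m]) (k - 1) (T x (Z (\<theta> @ [int k, int m]))))))"
    and S: "\<And>x z. x \<in> S \<Longrightarrow> T x z \<in> S"
    and "\<theta> \<in> Theta" "x \<in> S"
  shows "U \<theta> n x = mlp n x (\<lambda>\<rho>\<in>Theta. Z (\<theta> @ \<rho>))"
  using assms(4,5)
proof (induction n arbitrary: \<theta> x rule: less_induct)
  case (less n)
  let ?z = "\<lambda>\<theta>. \<lambda>\<rho>\<in>Theta. Z (\<theta> @ \<rho>)"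
  show ?case
  proof (cases "n = 0")
    case True
    then show ?thesis using U0 less.prems by (simp add: mlp_level)
  next
    case False
    then have n: "1 \<le> n" by simp
    have sh: "subtree \<eta> (?z \<theta>) = ?z (\<theta> @ \<eta>)" for \<eta>
      by (rule ext) (simp add: subtree_def append_Theta)
    have "mlp n x (?z \<theta>) = (\<Sum>k\<in>insert 0 {1..<n}. 1 / real (M ^ (n - k)) * (\<Sum>m=1..M ^ (n - k). level k m x (?z \<theta>)))"
      unfolding mlp_level by (rule sum.cong) (use n in auto)
    also have "\<dots> = 1 / real (M ^ n) * (\<Sum>m=1..M ^ n. level 0 m x (?z \<theta>)) +
        (\<Sum>k=1..<n. 1 / real (M ^ (n - k)) * (\<Sum>m=1..M ^ (n - k). level k m x (?z \<theta>)))"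
      by simp
    also have "\<dots> = U \<theta> n x"
      unfolding U[OF n less.prems]
    proof (intro arg_cong2[where f="(+)"] sum.cong refl arg_cong2[where f="(*)"])
      show "level 0 m x (?z \<theta>) = g (T x (Z (\<theta> @ [0, int m]))) 0" for m by (simp add: level_def)
      fix k m assume k: "k \<in> {1..<n}" and m: "m \<in> {1..M ^ (n - k)}"
      have T: "T x (Z (\<theta> @ [int k, int m])) \<in> S" by (rule S[OF less.prems(2)])
      have 1: "U (\<theta> @ [int k, int m]) k (T x (Z (\<theta> @ [int k, int m]))) = mlp k (T x (Z (\<theta> @ [int k, int m]))) (?z (\<theta> @ [int k, int m]))"
        by (rule less.IH[OF _ pair_Theta(2) T]) (use k in simp)
      have 2: "U (\<theta> @ [int k, - int m]) (k - 1) (T x (Z (\<theta> @ [int k, int m]))) = mlp (k - 1) (T x (Z (\<theta> @ [int k, int m]))) (?z (\<theta> @ [int k, - int m]))"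
        by (rule less.IH[OF _ pair_Theta(2) T]) (use k in auto)
      show "level k m x (?z \<theta>) = g (T x (Z (\<theta> @ [int k, int m]))) (U (\<theta> @ [int k, int m]) k (T x (Z (\<theta> @ [int k, int m]))))
         - g (T x (Z (\<theta> @ [int k, int m]))) (U (\<theta> @ [int k, - int m]) (k - 1) (T x (Z (\<theta> @ [int k, int m]))))"
        unfolding 1 2 level_def sh using k by simp
    qed
    finally show ?thesis ..
  qed
qed

text \<open>Combines the stochastic representation, the bound for u and the error recursion. The
  weight costs sqrt \<rho> per step, and a sqrt \<rho> <= 1 is what \<open>mlp_error\<close>
  asks.\<close>

lemma (in exp_gauss) mlp_error_weighted:
  fixes f :: "(nat \<Rightarrow> real) \<Rightarrow> real \<Rightarrow> real" and u :: "(nat \<Rightarrow> real) \<Rightarrow> real"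
  assumes L: "0 \<le> L" "L < lam" and Mb: "1 \<le> Mb" and p: "0 \<le> p" and s: "0 \<le> C0"
    and fc: "continuous_map (prod_topology (Euclidean_space d) euclideanreal) euclideanreal (\<lambda>(x, v). f x v)"
    and visc: "viscosity_solution d B f u" and u: "subexp d u"
    and f0: "\<And>x. x \<in> Rd d \<Longrightarrow> \<bar>f x 0\<bar> \<le> C0 * (1 + rpow (enorm d x) p)"
    and fL: "\<And>x v w. x \<in> Rd d \<Longrightarrow> \<bar>f x v - f x w - lam * (v - w)\<bar> \<le> L * \<bar>v - w\<bar>"
    and \<rho>: "1 < \<rho>" "L / lam * \<rho> \<le> 1" and K: "1 \<le> K"
    and wE: "\<And>x. L2_le \<nu> (\<lambda>z. weight K p (move d B x z)) (sqrt \<rho> * weight K p x)"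
    and x: "x \<in> Rd d"
  defines "g \<equiv> \<lambda>x v. v - f (proj d x) v / lam" and "a \<equiv> sqrt (L / lam)"
  shows "mlp_scheme \<nu> (move d B) g Mb"
    and "L2_le (Pi\<^sub>M Theta (\<lambda>_. \<nu>)) (\<lambda>z. mlp_scheme.mlp (move d B) g Mb n x z - u x)
      (2 * C0 / lam * sqrt \<rho> / (1 - a) * (1 / sqrt (real Mb) + a * (1 + 1 / sqrt (real Mb))) ^ n * weight K p x)"
proof -
  have a: "0 \<le> a" "a < 1" "a\<^sup>2 = L / lam" using L lam_pos by (simp_all add: a_def)
  let ?w = "weight K p"
  let ?u = "\<lambda>x. u (proj d x)"
  define G where "G = 2 * C0 / lam"
  note G_eq = G_def
  have G: "0 \<le> G" using s lam_pos by (simp add: G_def)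
  have w1: "1 \<le> ?w x" for x by (rule weight_ge_1[OF K p])
  have a\<rho>: "a * sqrt \<rho> \<le> 1"
  proof -
    have "(a * sqrt \<rho>)\<^sup>2 \<le> 1\<^sup>2" using \<rho> a by (simp add: power_mult_distrib)
    then show ?thesis by (rule power2_le_imp_le) simp
  qed
  have fcont: "continuous_on UNIV (\<lambda>(x, v). f (proj d x) v)" by (rule continuous_proj_pair[OF fc])
  have ucont: "continuous_on UNIV ?u"
    using visc by (intro continuous_proj) (simp add: viscosity_solution_def)
  have gm: "(\<lambda>(x, v). g x v) \<in> borel_measurable (borel \<Otimes>\<^sub>M borel)"
  proof -
    have "continuous_on UNIV (\<lambda>p. snd p - (\<lambda>(x, v). f (proj d x) v) p / lam)"
      using lam_pos by (intro continuous_intros fcont) auto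
    from borel_measurable_continuous_onI[OF this] show ?thesis
      by (simp add: borel_prod g_def case_prod_beta')
  qed
  have Tm: "(\<lambda>(x, z). move d B x z) \<in> borel \<Otimes>\<^sub>M \<nu> \<rightarrow>\<^sub>M borel"
    using move_measurable by (simp add: measurable_cong_sets[OF sets_pair_measure_cong[OF refl sets_nu] refl])
  show scheme: "mlp_scheme \<nu> (move d B) g Mb"
    by (intro mlp_scheme.intro mlp_scheme_axioms.intro prob_space_axioms Tm gm Mb)
  interpret mlp_scheme \<nu> "move d B" g Mb by (rule scheme)
  have g0: "\<bar>g y 0\<bar> \<le> G * ?w y" for y
  proof -
    have "\<bar>f (proj d y) 0\<bar> \<le> C0 * (1 + rpow (enorm d y) p)" using f0[OF proj_Rd[of d y]] by (simp add: enorm_proj)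
    also have "\<dots> \<le> C0 * (2 * ?w y)"
    proof -
      have "rpow (enorm d y) p \<le> ?w y"
      proof (cases "p = 0")
        case True
        then show ?thesis using w1[of y] by (simp add: rpow_def)
      next
        case False
        then show ?thesis using p K unfolding rpow_def weight_def
          by (simp add: powr_mono2 L2_set_nonneg)
      qed
      then show ?thesis using w1[of y] s by (intro mult_left_mono) auto
    qed
    finally have "\<bar>f (proj d y) 0\<bar> / lam \<le> C0 * (2 * ?w y) / lam" using lam_pos by (intro divide_right_mono) auto
    then show ?thesis using lam_pos by (simp add: g_def G_def mult_ac)
  qed
  have gL: "\<bar>g y v - g y v'\<bar> \<le> a\<^sup>2 * \<bar>v - v'\<bar>" for y v v'
  proof -
    have "g y v - g y v' = - (f (proj d y) v - f (proj d y) v' - lam * (v - v')) / lam"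
      using lam_pos by (simp add: g_def field_simps)
    then have "\<bar>g y v - g y v'\<bar> = \<bar>f (proj d y) v - f (proj d y) v' - lam * (v - v')\<bar> / lam"
      using lam_pos by (simp add: abs_minus_commute)
    also have "\<dots> \<le> L * \<bar>v - v'\<bar> / lam" using lam_pos by (intro divide_right_mono fL proj_Rd) auto
    finally show ?thesis by (simp add: a)
  qed
  define h where "h y = lam * ?u y - f (proj d y) (?u y)" for y
  have hg: "h y = lam * g y (?u y)" for y using lam_pos by (simp add: h_def g_def field_simps)
  have hc: "continuous_on UNIV h"
  proof -
    have "continuous_on UNIV (\<lambda>y. (\<lambda>(x, v). f (proj d x) v) (y, ?u y))"
      by (rule continuous_on_compose2[OF fcont _ subset_UNIV]) (intro continuous_intros ucont)
    then show ?thesis unfolding h_def by (intro continuous_intros ucont) simp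
  qed
  have f0s: "subexp d (\<lambda>x. C0 * (1 + rpow (enorm d x) p))"
  proof (rule subexp_dominated[where a=C0 and b=C0, OF subexp_const[of d 1] rpow_subexp[OF p, of d]])
    show "\<bar>C0 * (1 + rpow (enorm d x) p)\<bar> \<le> C0 * \<bar>1\<bar> + C0 * \<bar>rpow (enorm d x) p\<bar>" for x
    proof -
      have r: "0 \<le> rpow (enorm d x) p" by (simp add: rpow_def)
      then have "0 \<le> C0 * (1 + rpow (enorm d x) p)" using s by simp
      then show ?thesis using r by (simp add: abs_of_nonneg distrib_left)
    qed
  qed (use s in auto)
  have hs: "subexp d h"
  proof (rule subexp_dominated[where a=L and b=1, OF u f0s])
    fix y assume y: "y \<in> Rd d"
    have "\<bar>h y\<bar> = \<bar>(f y (u y) - f y 0 - lam * (u y - 0)) + f y 0\<bar>"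
      using y by (simp add: h_def proj_id abs_minus_commute algebra_simps)
    also have "\<dots> \<le> L * \<bar>u y - 0\<bar> + \<bar>f y 0\<bar>" using fL[OF y, of "u y" 0] by linarith
    also have "\<bar>f y 0\<bar> \<le> \<bar>C0 * (1 + rpow (enorm d y) p)\<bar>" using f0[OF y] by linarith
    finally show "\<bar>h y\<bar> \<le> L * \<bar>u y\<bar> + 1 * \<bar>C0 * (1 + rpow (enorm d y) p)\<bar>" by simp
  qed (use L in auto)
  have fp: "u y = expectation (\<lambda>z. g (move d B y z) (?u (move d B y z)))" if y: "y \<in> Rd d" for y
  proof -
    have "lam * u y = expectation (\<lambda>z. h (move d B y z))"
    proof (rule feynman_kac(2)[OF u visc _ hs _ _ y])
      show "continuous_on (Rd d) h" by (rule continuous_on_subset[OF hc]) simp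
      show "h \<in> borel_measurable borel" by (rule borel_measurable_continuous_onI[OF hc])
      show "f v (u v) = lam * u v - h v" if "v \<in> Rd d" for v using that by (simp add: h_def proj_id)
    qed
    also have "\<dots> = lam * expectation (\<lambda>z. g (move d B y z) (?u (move d B y z)))" unfolding hg by simp
    finally show ?thesis using lam_pos by simp
  qed
  have wi: "integrable \<nu> (\<lambda>z. ?w (move d B y z))" for y by (rule L2_le_integrable[OF wE])
  have wexp: "expectation (\<lambda>z. ?w (move d B y z)) \<le> sqrt \<rho> * ?w y" for y
    using L2_le_expectation[OF wE[of y]] by linarith
  have ub: "\<bar>u y\<bar> \<le> G * sqrt \<rho> / (1 - a) * ?w y" if y: "y \<in> Rd d" for y
  proof (rule fixed_point_bound[OF u w1 a(1,2) \<rho>(1) _ wi wexp G _ _ y, of g])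
    show "a\<^sup>2 * \<rho> \<le> 1" using \<rho>(2) a(3) by simp
    show "\<bar>g v (u v)\<bar> \<le> a\<^sup>2 * \<bar>u v\<bar> + G * ?w v" if "v \<in> Rd d" for v
      using gL[of v "u v" 0] g0[of v] by simp
    show "u v = expectation (\<lambda>z. g (move d B v z) (u (move d B v z)))" if "v \<in> Rd d" for v
      using fp[OF that] by (simp add: proj_id move_Rd[OF that])
  qed
  let ?N = "G * sqrt \<rho> / (1 - a)" and ?F = "G * sqrt \<rho>"
  have F: "0 \<le> ?F" using G \<rho> by simp
  \<comment> \<open>Since 0 < 1 - a <= 1, the bound for u also covers the source, and the maximum in
    \<open>mlp_error_bound\<close> is \<open>?N\<close>.\<close>
  have FN: "?F \<le> ?N"
  proof -
    have "?F / 1 \<le> ?F / (1 - a)" using a F by (intro divide_left_mono) auto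
    then show ?thesis by simp
  qed
  interpret mlp_error \<nu> "move d B" g Mb ?u ?w a ?F ?N
  proof unfold_locales
    show "?u \<in> borel_measurable borel" by (rule borel_measurable_continuous_onI[OF ucont])
    show "?w \<in> borel_measurable borel" by (rule weight_measurable)
    show "0 \<le> a" "0 \<le> ?F" "0 \<le> ?N" using a F FN by auto
    show "0 \<le> ?w y" for y using w1[of y] by linarith
    show "\<bar>g y v - g y v'\<bar> \<le> a\<^sup>2 * \<bar>v - v'\<bar>" for y v v' by (rule gL)
    show "L2_le \<nu> (\<lambda>z. a * ?w (move d B y z)) (?w y)" for y
    proof (rule L2_le_mono)
      show "L2_le \<nu> (\<lambda>z. a * ?w (move d B y z)) (a * (sqrt \<rho> * ?w y))"
        using L2_leD(1)[OF wE[of y]] a by (intro L2_le_dominated[OF wE]) (auto simp: abs_mult)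
      show "a * (sqrt \<rho> * ?w y) \<le> ?w y"
        using mult_right_mono[OF a\<rho>, of "?w y"] w1[of y] by (simp add: mult.assoc)
    qed
    show "L2_le \<nu> (\<lambda>z. g (move d B y z) 0) (?F * ?w y)" for y
    proof -
      have "L2_le \<nu> (\<lambda>z. g (move d B y z) 0) (G * (sqrt \<rho> * ?w y))"
      proof (rule L2_le_dominated[OF wE _ G])
        have m: "move d B y \<in> \<nu> \<rightarrow>\<^sub>M borel" by (rule move_meas)
        show "(\<lambda>z. g (move d B y z) 0) \<in> borel_measurable \<nu>" by (rule g_comp[OF m]) simp
        show "\<bar>g (move d B y z) 0\<bar> \<le> G * \<bar>?w (move d B y z)\<bar>" for z
          using g0[of "move d B y z"] w1[of "move d B y z"] by simp
      qed
      then show ?thesis by (simp add: mult.assoc)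
    qed
    show "\<bar>?u y\<bar> \<le> ?N * ?w y" for y
      using ub[OF proj_Rd[of d y]] by (simp add: weight_def enorm_proj)
    show "?u y = expectation (\<lambda>z. g (move d B y z) (?u (move d B y z)))" for y
    proof -
      have "g (move d B (proj d y) z) (?u (move d B (proj d y) z)) = g (move d B y z) (?u (move d B y z))" for z
        unfolding proj_move[symmetric] g_def by (simp add: proj_id[OF proj_Rd])
      then show ?thesis using fp[OF proj_Rd[of d y]] by simp
    qed
  qed
  have "max ?F ?N = ?N" using FN by simp
  then have "L2_le noise (\<lambda>z. mlp n x z - ?u x) (?N * \<delta> ^ n * ?w x)"
    using mlp_error_bound[of n x] by (simp only:)
  then show "L2_le noise (\<lambda>z. mlp n x z - u x)
      (2 * C0 / lam * sqrt \<rho> / (1 - a) * (1 / sqrt (real Mb) + a * (1 + 1 / sqrt (real Mb))) ^ n * weight K p x)"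
    by (simp only: \<delta>_def b_def G_eq proj_id[OF x])
qed

text \<open>The Brownian value at the random time has, for every index, the mixture of
  \<open>gauss_law\<close> over the exponential time as its law. With independence the family has a
  product law, which prefixing the indices preserves.\<close>

lemma (in prob_space) noise_law:
  fixes W :: "nat \<Rightarrow> int list \<Rightarrow> real \<Rightarrow> 'a \<Rightarrow> nat \<Rightarrow> real"
  assumes d: "d \<ge> 1" and lam: "lam > 0"
    and W: "\<And>\<theta>. \<theta> \<in> Theta \<Longrightarrow> standard_brownian_motion M d (W d \<theta>)"
    and Wi: "indep_vars (\<lambda>_. path_space) (\<lambda>(d, \<theta>). sample_path (W d \<theta>)) ({1..} \<times> Theta)"
    and R0: "\<And>\<theta> \<omega>. \<theta> \<in> Theta \<Longrightarrow> \<omega> \<in> space M \<Longrightarrow> R \<theta> \<omega> \<ge> 0"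
    and Ri: "indep_vars (\<lambda>_. borel) R Theta"
    and Rd: "\<And>\<theta> \<theta>'. \<theta> \<in> Theta \<Longrightarrow> \<theta>' \<in> Theta \<Longrightarrow> distr M borel (R \<theta>) = distr M borel (R \<theta>')"
    and RW: "indep_rvs M (Pi\<^sub>M Theta (\<lambda>_. borel)) (\<lambda>\<omega>. \<lambda>\<theta>\<in>Theta. R \<theta> \<omega>)
       (Pi\<^sub>M ({1..} \<times> Theta) (\<lambda>_. path_space)) (\<lambda>\<omega>. \<lambda>(d, \<theta>)\<in>{1..} \<times> Theta. sample_path (W d \<theta>) \<omega>)"
    and tail: "\<And>\<epsilon>. \<epsilon> > 0 \<Longrightarrow> prob {\<omega> \<in> space M. R [0] \<omega> \<ge> \<epsilon>} = exp (- lam * \<epsilon>)"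
  obtains \<nu> where "exp_gauss \<nu> d lam"
    "(\<lambda>\<omega>. \<lambda>\<rho>\<in>Theta. W d (\<theta> @ \<rho>) (R (\<theta> @ \<rho>) \<omega>) \<omega>) \<in> M \<rightarrow>\<^sub>M Pi\<^sub>M Theta (\<lambda>_. \<nu>)"
    "distr M (Pi\<^sub>M Theta (\<lambda>_. \<nu>)) (\<lambda>\<omega>. \<lambda>\<rho>\<in>Theta. W d (\<theta> @ \<rho>) (R (\<theta> @ \<rho>) \<omega>) \<omega>) = Pi\<^sub>M Theta (\<lambda>_. \<nu>)"
proof -
  let ?Z = "\<lambda>\<theta> \<omega>. W d \<theta> (R \<theta> \<omega>) \<omega>"
  let ?P = "\<lambda>\<theta> \<omega>. (R \<theta> \<omega>, sample_path (W d \<theta>) \<omega>)"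
  have T0: "[0] \<in> Theta" by (simp add: Theta_def)
  have Rm: "R \<theta> \<in> borel_measurable M" if "\<theta> \<in> Theta" for \<theta>
    using Ri that by (simp add: indep_vars_def)
  have Rlaw: "distr M borel (R \<theta>) = density lborel (exponential_density lam)" if "\<theta> \<in> Theta" for \<theta>
    using Rd[OF that T0] exponential_law[OF Rm[OF T0] lam R0[OF T0] tail] by simp
  have pm: "sample_path (W d \<theta>) \<in> M \<rightarrow>\<^sub>M path_space" if "\<theta> \<in> Theta" for \<theta>
  proof -
    have "(d, \<theta>) \<in> {1..} \<times> Theta" using d that by simp
    then show ?thesis using Wi unfolding indep_vars_def by fastforce
  qed
  let ?Y = "\<lambda>k. case k of (d, \<theta>) \<Rightarrow> sample_path (W d \<theta>)"
  have RW': "indep_rvs M (Pi\<^sub>M Theta (\<lambda>_. borel)) (\<lambda>\<omega>. \<lambda>\<theta>\<in>Theta. R \<theta> \<omega>)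
      (Pi\<^sub>M ({1..} \<times> Theta) (\<lambda>_. path_space)) (\<lambda>\<omega>. \<lambda>k\<in>{1..} \<times> Theta. ?Y k \<omega>)"
    using RW by (simp add: case_prod_beta')
  have inj: "inj_on (\<lambda>\<theta>. (d, \<theta>)) Theta" "(\<lambda>\<theta>. (d, \<theta>)) ` Theta \<subseteq> {1..} \<times> Theta"
    using d by (auto simp: inj_on_def)
  have ind: "indep_vars (\<lambda>_. borel \<Otimes>\<^sub>M path_space) ?P Theta"
    using indep_vars_pair(1)[OF Ri Wi RW' inj] by simp
  have pair: "distr M (borel \<Otimes>\<^sub>M path_space) (?P \<theta>) = distr M borel (R \<theta>) \<Otimes>\<^sub>M distr M path_space (sample_path (W d \<theta>))"
    if "\<theta> \<in> Theta" for \<theta>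
    using indep_vars_pair(2)[OF Ri Wi RW' inj that] by simp
  note Z = brownian_at_exponential_time[OF W d lam Rm R0 Rlaw pm pair]
  define \<nu> where "\<nu> = distr M borel (?Z [0])"
  have Zm: "?Z \<theta> \<in> borel_measurable M" if "\<theta> \<in> Theta" for \<theta> by (rule Z(2)) (simp_all add: that)
  \<comment> \<open>Time 0 is excluded almost surely, since \<open>brownian_marginal\<close> speaks
    of positive times only.\<close>
  have aeR: "AE t in density lborel (exponential_density lam). 0 < t"
  proof -
    have "AE t in lborel. t \<noteq> (0::real)" by (rule AE_lborel_singleton)
    then show ?thesis by (subst AE_density) (auto elim!: eventually_mono simp: exponential_density_def split: if_splits)
  qed
  have law: "distr M borel (?Z \<theta>) = \<nu>" if \<theta>: "\<theta> \<in> Theta" for \<theta>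
  proof (rule measure_eqI)
    fix A assume "A \<in> sets (distr M borel (?Z \<theta>))"
    then have A: "A \<in> sets borel" by simp
    have em: "emeasure (distr M borel (?Z \<theta>')) A = (\<integral>\<^sup>+t. emeasure (gauss_law d t) A \<partial>density lborel (exponential_density lam))"
      if \<theta>': "\<theta>' \<in> Theta" for \<theta>'
    proof -
      have "emeasure (distr M borel (?Z \<theta>')) A = (\<integral>\<^sup>+x. indicator A x \<partial>distr M borel (?Z \<theta>'))"
        using A by simp
      also have "\<dots> = (\<integral>\<^sup>+\<omega>. indicator A (?Z \<theta>' \<omega>) \<partial>M)"
        by (rule nn_integral_distr[OF Zm[OF \<theta>']]) (use A in simp)
      also have "\<dots> = (\<integral>\<^sup>+t. (\<integral>\<^sup>+\<omega>. indicator A (W d \<theta>' t \<omega>) \<partial>M) \<partial>density lborel (exponential_density lam))"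
        by (rule Z(4)) (use A \<theta>' in simp_all)
      also have "\<dots> = (\<integral>\<^sup>+t. emeasure (gauss_law d t) A \<partial>density lborel (exponential_density lam))"
      proof (rule nn_integral_cong_AE, use aeR in eventually_elim)
        fix t :: real assume t: "0 < t"
        have m: "W d \<theta>' t \<in> borel_measurable M" using brownian_measurable[OF W[OF \<theta>']] t by simp
        have "(\<integral>\<^sup>+\<omega>. indicator A (W d \<theta>' t \<omega>) \<partial>M) = (\<integral>\<^sup>+x. indicator A x \<partial>distr M borel (W d \<theta>' t))"
          by (rule nn_integral_distr[OF m, symmetric]) (use A in simp)
        also have "\<dots> = emeasure (gauss_law d t) A"
          using A unfolding brownian_marginal[OF W[OF \<theta>'] d t] by (simp add: gauss_law_def)
        finally show "(\<integral>\<^sup>+\<omega>. indicator A (W d \<theta>' t \<omega>) \<partial>M) = emeasure (gauss_law d t) A" .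
      qed
      finally show ?thesis .
    qed
    show "emeasure (distr M borel (?Z \<theta>)) A = emeasure \<nu> A" unfolding \<nu>_def em[OF \<theta>] em[OF T0] ..
  qed (simp add: \<nu>_def)
  have eg: "exp_gauss \<nu> d lam" unfolding \<nu>_def by (rule Z(3)) (simp_all add: T0)
  have sets: "sets \<nu> = sets borel" by (simp add: \<nu>_def)
  have spi: "sets (Pi\<^sub>M Theta (\<lambda>_. \<nu>)) = sets (Pi\<^sub>M Theta (\<lambda>_. borel))" by (intro sets_PiM_cong refl sets)
  \<comment> \<open>On the sample space this equals the Brownian value; as a measurable function of
    the pair of time and path it inherits independence.\<close>
  let ?E = "\<lambda>\<theta> \<omega>. eval_path (?P \<theta> \<omega>)"
  have Ev: "?Z \<theta> \<omega> = ?E \<theta> \<omega>" if "\<theta> \<in> Theta" "\<omega> \<in> space M" for \<theta> \<omega>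
    by (rule Z(1)) (use that in simp_all)
  have indE: "indep_vars (\<lambda>_. borel) ?E Theta"
    by (rule indep_vars_compose2[OF ind]) (rule eval_path_measurable)
  have Em: "?E \<theta> \<in> borel_measurable M" if "\<theta> \<in> Theta" for \<theta> using indE that by (simp add: indep_vars_def)
  have Elaw: "distr M borel (?E \<theta>) = \<nu>" if "\<theta> \<in> Theta" for \<theta>
    unfolding law[OF that, symmetric] by (rule distr_cong) (simp_all add: Ev[OF that])
  have "distr M (Pi\<^sub>M Theta (\<lambda>_. borel)) (\<lambda>\<omega>. \<lambda>\<theta>\<in>Theta. ?E \<theta> \<omega>) = Pi\<^sub>M Theta (\<lambda>\<theta>. distr M borel (?E \<theta>))"
  proof (rule iffD1[OF indep_vars_iff_distr_eq_PiM'])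
    show "Theta \<noteq> {}" using T0 by blast
  qed (rule Em, assumption, rule indE)
  also have "\<dots> = Pi\<^sub>M Theta (\<lambda>_. \<nu>)" by (intro PiM_cong refl Elaw)
  finally have joint: "distr M (Pi\<^sub>M Theta (\<lambda>_. borel)) (\<lambda>\<omega>. \<lambda>\<theta>\<in>Theta. ?E \<theta> \<omega>) = Pi\<^sub>M Theta (\<lambda>_. \<nu>)" .
  have jm: "(\<lambda>\<omega>. \<lambda>\<theta>\<in>Theta. ?E \<theta> \<omega>) \<in> M \<rightarrow>\<^sub>M Pi\<^sub>M Theta (\<lambda>_. borel)" by (intro measurable_restrict Em)
  have jm': "(\<lambda>\<omega>. \<lambda>\<theta>\<in>Theta. ?E \<theta> \<omega>) \<in> M \<rightarrow>\<^sub>M Pi\<^sub>M Theta (\<lambda>_. \<nu>)" using jm by (simp add: measurable_cong_sets[OF refl spi])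
  have sm: "subtree \<theta> \<in> Pi\<^sub>M Theta (\<lambda>_. \<nu>) \<rightarrow>\<^sub>M Pi\<^sub>M Theta (\<lambda>_. \<nu>)" by (rule measurable_subtree) (rule append_Theta)
  have eq: "(\<lambda>\<rho>\<in>Theta. ?Z (\<theta> @ \<rho>) \<omega>) = subtree \<theta> (\<lambda>\<theta>\<in>Theta. ?E \<theta> \<omega>)" if "\<omega> \<in> space M" for \<omega>
    by (rule ext) (simp add: subtree_def append_Theta Ev that)
  interpret nu: prob_space \<nu> using eg by (simp add: exp_gauss_def)
  have sd: "distr (Pi\<^sub>M Theta (\<lambda>_. \<nu>)) (Pi\<^sub>M Theta (\<lambda>_. \<nu>)) (subtree \<theta>) = Pi\<^sub>M Theta (\<lambda>_. \<nu>)"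
    using distr_PiM_reindex[of Theta "\<lambda>_. \<nu>" "\<lambda>\<rho>. \<theta> @ \<rho>" Theta] append_Theta nu.prob_space_axioms
    by (simp add: subtree_def[abs_def] inj_on_def)
  have m: "(\<lambda>\<omega>. subtree \<theta> (\<lambda>\<theta>\<in>Theta. ?E \<theta> \<omega>)) \<in> M \<rightarrow>\<^sub>M Pi\<^sub>M Theta (\<lambda>_. \<nu>)"
    by (rule measurable_compose[OF jm' sm])
  have "distr M (Pi\<^sub>M Theta (\<lambda>_. \<nu>)) (\<lambda>\<omega>. \<lambda>\<rho>\<in>Theta. ?Z (\<theta> @ \<rho>) \<omega>) =
      distr M (Pi\<^sub>M Theta (\<lambda>_. \<nu>)) (subtree \<theta> \<circ> (\<lambda>\<omega>. \<lambda>\<theta>\<in>Theta. ?E \<theta> \<omega>))"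
    by (rule distr_cong) (simp_all add: eq)
  also have "\<dots> = distr (distr M (Pi\<^sub>M Theta (\<lambda>_. \<nu>)) (\<lambda>\<omega>. \<lambda>\<theta>\<in>Theta. ?E \<theta> \<omega>)) (Pi\<^sub>M Theta (\<lambda>_. \<nu>)) (subtree \<theta>)"
    by (rule distr_distr[OF sm jm', symmetric])
  also have "distr M (Pi\<^sub>M Theta (\<lambda>_. \<nu>)) (\<lambda>\<omega>. \<lambda>\<theta>\<in>Theta. ?E \<theta> \<omega>) = Pi\<^sub>M Theta (\<lambda>_. \<nu>)"
    using joint distr_cong[OF refl spi, of M "\<lambda>\<omega>. \<lambda>\<theta>\<in>Theta. ?E \<theta> \<omega>"] by simp
  finally have "distr M (Pi\<^sub>M Theta (\<lambda>_. \<nu>)) (\<lambda>\<omega>. \<lambda>\<rho>\<in>Theta. ?Z (\<theta> @ \<rho>) \<omega>) = Pi\<^sub>M Theta (\<lambda>_. \<nu>)"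
    unfolding sd .
  moreover have "(\<lambda>\<omega>. \<lambda>\<rho>\<in>Theta. ?Z (\<theta> @ \<rho>) \<omega>) \<in> M \<rightarrow>\<^sub>M Pi\<^sub>M Theta (\<lambda>_. \<nu>)"
    using m by (rule measurable_cong[THEN iffD2, rotated]) (simp add: eq)
  ultimately show ?thesis using that eg by blast
qed

lemma L2_le_cong: "(\<And>x. x \<in> space M \<Longrightarrow> f x = g x) \<Longrightarrow> L2_le M f c \<longleftrightarrow> L2_le M g c"
  unfolding L2_le_def by (intro conj_cong arg_cong2[where f="(\<le>)"] refl nn_integral_cong measurable_cong) auto

text \<open>A second moment depends only on the law of the noise, so the bound is transported along
  \<open>?Zs\<close> from the product space to the given probability space.\<close>

lemma (in prob_space) mlp_error_in_dimension:
  fixes W :: "nat \<Rightarrow> int list \<Rightarrow> real \<Rightarrow> 'a \<Rightarrow> nat \<Rightarrow> real" and u :: "(nat \<Rightarrow> real) \<Rightarrow> real"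
    and f :: "(nat \<Rightarrow> real) \<Rightarrow> real \<Rightarrow> real" and U :: "int list \<Rightarrow> nat \<Rightarrow> (nat \<Rightarrow> real) \<Rightarrow> 'a \<Rightarrow> real"
  assumes d: "d \<ge> 1"
    and W: "\<And>\<theta>. \<theta> \<in> Theta \<Longrightarrow> standard_brownian_motion M d (W d \<theta>)"
    and Wi: "indep_vars (\<lambda>_. path_space) (\<lambda>(d, \<theta>). sample_path (W d \<theta>)) ({1..} \<times> Theta)"
    and R0: "\<And>\<theta> \<omega>. \<theta> \<in> Theta \<Longrightarrow> \<omega> \<in> space M \<Longrightarrow> R \<theta> \<omega> \<ge> 0"
    and Ri: "indep_vars (\<lambda>_. borel) R Theta"
    and Rd: "\<And>\<theta> \<theta>'. \<theta> \<in> Theta \<Longrightarrow> \<theta>' \<in> Theta \<Longrightarrow> distr M borel (R \<theta>) = distr M borel (R \<theta>')"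
    and RW: "indep_rvs M (Pi\<^sub>M Theta (\<lambda>_. borel)) (\<lambda>\<omega>. \<lambda>\<theta>\<in>Theta. R \<theta> \<omega>)
       (Pi\<^sub>M ({1..} \<times> Theta) (\<lambda>_. path_space)) (\<lambda>\<omega>. \<lambda>(d, \<theta>)\<in>{1..} \<times> Theta. sample_path (W d \<theta>) \<omega>)"
    and tail: "\<And>\<epsilon>. \<epsilon> > 0 \<Longrightarrow> prob {\<omega> \<in> space M. R [0] \<omega> \<ge> \<epsilon>} = exp (- lam * \<epsilon>)"
    and L: "0 \<le> L" "L < lam" and Mb: "1 \<le> Mb" and p: "0 \<le> p" and C0: "0 \<le> C0"
    and fc: "continuous_map (prod_topology (Euclidean_space d) euclideanreal) euclideanreal (\<lambda>(x, v). f x v)"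
    and visc: "viscosity_solution d B f u" and u: "subexp d u"
    and f0: "\<And>x. x \<in> Rd d \<Longrightarrow> \<bar>f x 0\<bar> \<le> C0 * (1 + rpow (enorm d x) p)"
    and fL: "\<And>x v w. x \<in> Rd d \<Longrightarrow> \<bar>f x v - f x w - lam * (v - w)\<bar> \<le> L * \<bar>v - w\<bar>"
    and \<rho>: "1 < \<rho>" "L / lam * \<rho> \<le> 1" and K: "1 \<le> K"
    and m: "p \<le> real m" "m \<ge> 1" and c: "0 \<le> c" "c \<le> 1" "1 + c * moment_const lam m \<le> \<rho>"
    and B: "\<And>x. x \<in> Rd d \<Longrightarrow> enorm d (mat_vec d B x) \<le> \<beta> * enorm d x" and \<beta>: "\<beta> * real d \<le> c * K" "0 \<le> \<beta>"
    and U0: "\<And>\<theta> x \<omega>. \<theta> \<in> Theta \<Longrightarrow> x \<in> Rd d \<Longrightarrow> \<omega> \<in> space M \<Longrightarrow> U \<theta> 0 x \<omega> = 0"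
    and U: "\<And>n \<theta> x \<omega>. n \<ge> 1 \<Longrightarrow> \<theta> \<in> Theta \<Longrightarrow> x \<in> Rd d \<Longrightarrow> \<omega> \<in> space M \<Longrightarrow>
           U \<theta> n x \<omega> =
             - 1 / (lam * real Mb ^ n) *
               (\<Sum>m = 1..Mb ^ n.
                  let \<eta> = \<theta> @ [0, int m];
                      y = shift_pt d B (W d \<eta>) (R \<eta>) x \<omega>
                  in f y 0)
             + (\<Sum>k = 1..<n. 1 / (lam * real Mb ^ (n - k)) *
                 (\<Sum>m = 1..Mb ^ (n - k).
                    let \<eta> = \<theta> @ [int k, int m];
                        \<eta>' = \<theta> @ [int k, - int m];
                        y = shift_pt d B (W d \<eta>) (R \<eta>) x \<omega>
                    in lam * (U \<eta> k y \<omega> - U \<eta>' (k - 1) y \<omega>)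
                       - (f y (U \<eta> k y \<omega>) - f y (U \<eta>' (k - 1) y \<omega>))))"
    and x: "x \<in> Rd d"
  shows "L2_le M (\<lambda>\<omega>. U [0] n x \<omega> - u x)
    (2 * C0 / lam * sqrt \<rho> / (1 - sqrt (L / lam)) *
      (1 / sqrt (real Mb) + (1 + 1 / sqrt (real Mb)) * sqrt (L / lam)) ^ n * (K + enorm d x) powr p)"
proof -
  have lam: "lam > 0" using L by simp
  let ?Zs = "\<lambda>\<omega>. \<lambda>\<rho>\<in>Theta. W d ([0] @ \<rho>) (R ([0] @ \<rho>) \<omega>) \<omega>"
  obtain \<nu> where \<nu>: "exp_gauss \<nu> d lam" and Zm: "?Zs \<in> M \<rightarrow>\<^sub>M Pi\<^sub>M Theta (\<lambda>_. \<nu>)"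
    and Zlaw: "distr M (Pi\<^sub>M Theta (\<lambda>_. \<nu>)) ?Zs = Pi\<^sub>M Theta (\<lambda>_. \<nu>)"
    by (rule noise_law[OF d lam W Wi R0 Ri Rd RW tail])
  interpret eg: exp_gauss \<nu> d lam by (rule \<nu>)
  let ?g = "\<lambda>x v. v - f (proj d x) v / lam"
  have B': "enorm d (mat_vec d B z) \<le> \<beta> * enorm d z" for z
    using B[OF proj_Rd[of d z]] by (simp add: mat_vec_proj enorm_proj)
  have wE: "L2_le \<nu> (\<lambda>z. eg.weight K p (move d B y z)) (sqrt \<rho> * eg.weight K p y)" for y
    by (rule eg.weight_move[OF p m c _ B' \<beta>]) (use K in simp)
  note main = eg.mlp_error_weighted[OF L Mb p C0 fc visc u f0 fL \<rho> K wE x]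
  interpret mlp_scheme \<nu> "move d B" ?g Mb by (rule main(1))
  have rep: "U [0] n x \<omega> = mlp n x (?Zs \<omega>)" if \<omega>: "\<omega> \<in> space M" for \<omega>
  proof (rule mlp_representation[where S="Rd d" and U="\<lambda>\<theta> n x. U \<theta> n x \<omega>" and Z="\<lambda>\<theta>. W d \<theta> (R \<theta> \<omega>) \<omega>"])
    show "U \<theta> 0 x \<omega> = 0" if "\<theta> \<in> Theta" "x \<in> Rd d" for \<theta> x by (rule U0[OF that \<omega>])
    show "move d B x z \<in> Rd d" if "x \<in> Rd d" for x z by (rule move_Rd[OF that])
    show "[0] \<in> Theta" by (simp add: Theta_def)
    show "x \<in> Rd d" by (rule x)
    fix n :: nat and \<theta> y assume n: "1 \<le> n" and \<theta>: "\<theta> \<in> Theta" and y: "y \<in> Rd d"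
    have sh: "shift_pt d B (W d \<eta>) (R \<eta>) y \<omega> = move d B y (W d \<eta> (R \<eta> \<omega>) \<omega>)" for \<eta>
      by (simp add: shift_pt_def move_def)
    have pr: "proj d (move d B y z) = move d B y z" for z by (rule proj_id[OF move_Rd[OF y]])
    show "U \<theta> n y \<omega> = 1 / real (Mb ^ n) * (\<Sum>m=1..Mb ^ n. ?g (move d B y (W d (\<theta> @ [0, int m]) (R (\<theta> @ [0, int m]) \<omega>) \<omega>)) 0) +
      (\<Sum>k=1..<n. 1 / real (Mb ^ (n - k)) * (\<Sum>m=1..Mb ^ (n - k).
         ?g (move d B y (W d (\<theta> @ [int k, int m]) (R (\<theta> @ [int k, int m]) \<omega>) \<omega>))
           (U (\<theta> @ [int k, int m]) k (move d B y (W d (\<theta> @ [int k, int m]) (R (\<theta> @ [int k, int m]) \<omega>) \<omega>)) \<omega>)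
         - ?g (move d B y (W d (\<theta> @ [int k, int m]) (R (\<theta> @ [int k, int m]) \<omega>) \<omega>))
           (U (\<theta> @ [int k, - int m]) (k - 1) (move d B y (W d (\<theta> @ [int k, int m]) (R (\<theta> @ [int k, int m]) \<omega>) \<omega>)) \<omega>)))"
      unfolding U[OF n \<theta> y \<omega>] Let_def sh pr sum_distrib_left
    proof (intro arg_cong2[where f="(+)"] sum.cong refl)
      have M0: "real Mb ^ j > 0" for j using Mb by simp
      \<comment> \<open>The summands of the scheme, divided by \<open>lam\<close>, are values and
        differences of g.\<close>
      show "- 1 / (lam * real Mb ^ n) * v = 1 / real (Mb ^ n) * (0 - v / lam)" for v
        using lam by simp
      show "1 / (lam * real Mb ^ j) * (lam * (v - v') - (w - w')) = 1 / real (Mb ^ j) * (v - w / lam - (v' - w' / lam))" for j v v' w w'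
        using lam M0[of j] by (simp add: field_simps)
    qed
  qed
  have "L2_le (distr M noise ?Zs) (\<lambda>z. mlp n x z - u x)
    (2 * C0 / lam * sqrt \<rho> / (1 - sqrt (L / lam)) *
      (1 / sqrt (real Mb) + sqrt (L / lam) * (1 + 1 / sqrt (real Mb))) ^ n * eg.weight K p x)"
    unfolding Zlaw by (rule main(2))
  then have "L2_le M (\<lambda>\<omega>. mlp n x (?Zs \<omega>) - u x)
    (2 * C0 / lam * sqrt \<rho> / (1 - sqrt (L / lam)) *
      (1 / sqrt (real Mb) + sqrt (L / lam) * (1 + 1 / sqrt (real Mb))) ^ n * eg.weight K p x)"
    using L2_leD(1)[OF main(2)] by (subst (asm) L2_le_distr[OF Zm]) auto
  then show ?thesis
    using L2_le_cong[of M "\<lambda>\<omega>. U [0] n x \<omega> - u x" "\<lambda>\<omega>. mlp n x (?Zs \<omega>) - u x"] rep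
    by (simp add: eg.weight_def mult.commute[of "sqrt (L / lam)"])
qed

text \<open>Taking roots turns the condition on M into sqrt M (sqrt \<lambda> - sqrt L) > sqrt
  \<lambda> + sqrt L; division by sqrt M sqrt \<lambda> gives the second claim.\<close>

lemma contraction_factor:
  fixes lam L :: real
  assumes L: "0 \<le> L" "L < lam" and M: "1 \<le> M"
    and big: "real M > (sqrt lam + sqrt L)\<^sup>2 / (sqrt lam - sqrt L)\<^sup>2"
  shows "0 < 1 / sqrt (real M) + (1 + 1 / sqrt (real M)) * sqrt (L / lam)"
    "1 / sqrt (real M) + (1 + 1 / sqrt (real M)) * sqrt (L / lam) < 1"
proof -
  let ?x = "sqrt lam" and ?y = "sqrt L" and ?m = "sqrt (real M)"
  have xy: "0 \<le> ?y" "?y < ?x" "0 < ?m" using L M by auto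
  show "0 < 1 / ?m + (1 + 1 / ?m) * sqrt (L / lam)" using xy L by (intro add_pos_nonneg) auto
  have "((?x + ?y) / (?x - ?y))\<^sup>2 < ?m\<^sup>2" using big by (simp add: power_divide)
  then have "(?x + ?y) / (?x - ?y) < ?m" by (rule power_less_imp_less_base) (use xy in simp)
  then have "?x + ?y < ?m * (?x - ?y)" using xy by (simp add: pos_divide_less_eq)
  then have "?x + (?m + 1) * ?y < ?m * ?x" by (simp add: algebra_simps)
  then have "(?x + (?m + 1) * ?y) / (?m * ?x) < 1" using xy by (subst divide_less_eq_1_pos) auto
  moreover have "1 / ?m + (1 + 1 / ?m) * (?y / ?x) = (?x + (?m + 1) * ?y) / (?m * ?x)"
    using xy by (simp add: field_simps)
  ultimately show "1 / ?m + (1 + 1 / ?m) * sqrt (L / lam) < 1" by (simp only: real_sqrt_divide)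
qed

theorem theorem3p16:
  fixes \<kappa> L \<nn> p q r s lam \<alpha> :: real
    and M :: nat
    and u :: "nat \<Rightarrow> (nat \<Rightarrow> real) \<Rightarrow> real"
    and B :: "nat \<Rightarrow> nat \<Rightarrow> nat \<Rightarrow> real"
    and f :: "nat \<Rightarrow> (nat \<Rightarrow> real) \<Rightarrow> real \<Rightarrow> real"
    and P :: "'w measure"
    and W :: "nat \<Rightarrow> int list \<Rightarrow> real \<Rightarrow> 'w \<Rightarrow> nat \<Rightarrow> real"
    and R :: "int list \<Rightarrow> 'w \<Rightarrow> real"
    and U :: "nat \<Rightarrow> int list \<Rightarrow> nat \<Rightarrow> (nat \<Rightarrow> real) \<Rightarrow> 'w \<Rightarrow> real"
    and \<CC> :: "nat \<Rightarrow> nat \<Rightarrow> real"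
  assumes "\<kappa> \<ge> 0" "L \<ge> 0" "\<nn> \<ge> 0" "p \<ge> 0" "q \<ge> 0" "r \<ge> 0" "s \<ge> 0" "lam > L"
    and "M \<ge> 1"
    and "real M > (sqrt lam + sqrt L)\<^sup>2 / (sqrt lam - sqrt L)\<^sup>2"
    and "\<alpha> = - ln (3 * real M) /
           ln (1 / sqrt (real M) + (1 + 1 / sqrt (real M)) * sqrt (L / lam))"
    and "\<And>d. d \<ge> 1 \<Longrightarrow> continuous_map (Euclidean_space d) euclideanreal (u d)"
    and "\<And>d. d \<ge> 1 \<Longrightarrow>
           continuous_map (prod_topology (Euclidean_space d) euclideanreal) euclideanreal
             (\<lambda>(x, v). f d x v)"
    and "\<And>d. d \<ge> 1 \<Longrightarrow> viscosity_solution d (B d) (f d) (u d)"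
    and "prob_space P"
    and "\<And>d \<theta>. d \<ge> 1 \<Longrightarrow> \<theta> \<in> Theta \<Longrightarrow> standard_brownian_motion P d (W d \<theta>)"
    and "prob_space.indep_vars P (\<lambda>_. path_space) (\<lambda>(d, \<theta>). sample_path (W d \<theta>)) ({1..} \<times> Theta)"
    and "\<And>\<theta> \<omega>. \<theta> \<in> Theta \<Longrightarrow> \<omega> \<in> space P \<Longrightarrow> R \<theta> \<omega> \<ge> 0"
    and "prob_space.indep_vars P (\<lambda>_. borel) R Theta"
    and "\<And>\<theta> \<theta>'. \<theta> \<in> Theta \<Longrightarrow> \<theta>' \<in> Theta \<Longrightarrow> distr P borel (R \<theta>) = distr P borel (R \<theta>')"
    and "indep_rvs P
           (Pi\<^sub>M Theta (\<lambda>_. borel)) (\<lambda>\<omega>. \<lambda>\<theta>\<in>Theta. R \<theta> \<omega>)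
           (Pi\<^sub>M ({1..} \<times> Theta) (\<lambda>_. path_space))
             (\<lambda>\<omega>. \<lambda>(d, \<theta>)\<in>{1..} \<times> Theta. sample_path (W d \<theta>) \<omega>)"
    and "\<And>d x. d \<ge> 1 \<Longrightarrow> x \<in> Rd d \<Longrightarrow>
           enorm d (mat_vec d (B d) x) \<le> \<kappa> * real d powr r * enorm d x"
    and "\<And>d x. d \<ge> 1 \<Longrightarrow> x \<in> Rd d \<Longrightarrow>
           \<bar>f d x 0\<bar> \<le> \<kappa> * real d powr s * (1 + rpow (enorm d x) p)"
    and "\<And>d x v w. d \<ge> 1 \<Longrightarrow> x \<in> Rd d \<Longrightarrow>
           \<bar>f d x v - f d x w - lam * (v - w)\<bar> \<le> L * \<bar>v - w\<bar>"
    and "\<And>d \<epsilon>. d \<ge> 1 \<Longrightarrow> \<epsilon> > 0 \<Longrightarrow>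
           bdd_above ((\<lambda>y. \<bar>u d y\<bar> * exp (- \<epsilon> * enorm d y)) ` Rd d)"
    and "\<And>\<epsilon>. \<epsilon> > 0 \<Longrightarrow>
           measure P {\<omega> \<in> space P. R [0] \<omega> \<ge> \<epsilon>} = exp (- lam * \<epsilon>)"
    and "\<And>d \<theta> x \<omega>. d \<ge> 1 \<Longrightarrow> \<theta> \<in> Theta \<Longrightarrow> x \<in> Rd d \<Longrightarrow> \<omega> \<in> space P \<Longrightarrow> U d \<theta> 0 x \<omega> = 0"
    and "\<And>d n \<theta> x \<omega>. d \<ge> 1 \<Longrightarrow> n \<ge> 1 \<Longrightarrow> \<theta> \<in> Theta \<Longrightarrow> x \<in> Rd d \<Longrightarrow> \<omega> \<in> space P \<Longrightarrow>
           U d \<theta> n x \<omega> =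
             - 1 / (lam * real M ^ n) *
               (\<Sum>m = 1..M ^ n.
                  let \<eta> = \<theta> @ [0, int m];
                      y = shift_pt d (B d) (W d \<eta>) (R \<eta>) x \<omega>
                  in f d y 0)
             + (\<Sum>k = 1..<n. 1 / (lam * real M ^ (n - k)) *
                 (\<Sum>m = 1..M ^ (n - k).
                    let \<eta> = \<theta> @ [int k, int m];
                        \<eta>' = \<theta> @ [int k, - int m];
                        y = shift_pt d (B d) (W d \<eta>) (R \<eta>) x \<omega>
                    in lam * (U d \<eta> k y \<omega> - U d \<eta>' (k - 1) y \<omega>)
                       - (f d y (U d \<eta> k y \<omega>) - f d y (U d \<eta>' (k - 1) y \<omega>))))"
    and "\<And>d n. \<CC> d n \<le> (real d + 1) * real M ^ n
           + (\<Sum>k = 1..<n. real M ^ (n - k) * (real d + 1 + \<CC> d k + \<CC> d (k - 1)))"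
  shows "\<exists>(c :: real) (\<NN> :: real \<Rightarrow> nat \<Rightarrow> nat).
           \<forall>\<epsilon>\<in>{0<..1}. \<forall>d\<ge>1.
             real (\<NN> \<epsilon> d) \<ge> \<nn> \<and>
             \<CC> d (\<NN> \<epsilon> d) \<le>
               c * real d powr (1 + \<alpha> * (s + p * max q (2 * r + 1))) * \<epsilon> powr (- \<alpha>) \<and>
             (\<forall>x\<in>Rd d. enorm d x \<le> \<kappa> * real d powr q \<longrightarrow>
                integrable P (\<lambda>\<omega>. \<bar>u d x - U d [0] (\<NN> \<epsilon> d) x \<omega>\<bar>\<^sup>2)) \<and>
             (SUP x\<in>{x \<in> Rd d. enorm d x \<le> \<kappa> * real d powr q}.
                ereal (sqrt (prob_space.expectation P
                  (\<lambda>\<omega>. \<bar>u d x - U d [0] (\<NN> \<epsilon> d) x \<omega>\<bar>\<^sup>2)))) \<le> ereal \<epsilon>"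
proof -
  interpret prob_space P by fact
  note L = \<open>L \<ge> 0\<close> \<open>lam > L\<close>
  have lam: "lam > 0" using L by simp
  define b where "b = 3 * real M"
  define \<delta> where "\<delta> = 1 / sqrt (real M) + (1 + 1 / sqrt (real M)) * sqrt (L / lam)"
  have \<delta>: "0 < \<delta>" "\<delta> < 1"
    unfolding \<delta>_def by (rule contraction_factor[OF L assms(9,10)])+
  have b: "b > 1" using \<open>M \<ge> 1\<close> by (simp add: b_def)
  have \<alpha>: "\<alpha> = - ln b / ln \<delta>" using assms(11) by (simp only: b_def \<delta>_def)
  \<comment> \<open>The largest growth of the squared weight that L / \<lambda> compensates. For L =
    0 every value above 1 is admissible, whereas the quotient would default to 0.\<close>
  define \<rho> where "\<rho> = (if L = 0 then 2 else lam / L)"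
  have \<rho>: "1 < \<rho>" "L / lam * \<rho> \<le> 1" using L by (auto simp: \<rho>_def)
  \<comment> \<open>The summand 1 ensures m >= 1 also for p = 0.\<close>
  define m where "m = nat \<lceil>p\<rceil> + 1"
  have m: "p \<le> real m" "m \<ge> 1" unfolding m_def by linarith+
  have A: "0 < moment_const lam m" using lam by (auto simp: moment_const_def intro!: mult_pos_pos add_pos_nonneg)
  \<comment> \<open>The relative step size at which the squared weight grows at most by \<rho>; it
    does not depend on d.\<close>
  define c where "c = min 1 ((\<rho> - 1) / moment_const lam m)"
  have c: "0 < c" "c \<le> 1" using \<rho> A by (auto simp: c_def)
  have cA: "1 + c * moment_const lam m \<le> \<rho>"
  proof -
    have "c \<le> (\<rho> - 1) / moment_const lam m" by (simp add: c_def)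
    then show ?thesis using A by (simp add: pos_le_divide_eq)
  qed
  \<comment> \<open>In \<open>K\<close> below, c K must dominate \<kappa> d^r times d, the extra d
    coming from noise measured in units of d. The maximum with 1 makes K at least 1.\<close>
  define \<kappa>1 where "\<kappa>1 = max \<kappa> 1"
  define K where "K d = \<kappa>1 / c * real d powr (r + 1)" for d :: nat
  have \<kappa>c: "1 \<le> \<kappa>1 / c" "\<kappa> \<le> \<kappa>1"
  proof -
    have "1 \<le> \<kappa>1" by (simp add: \<kappa>1_def)
    then have "c \<le> \<kappa>1" using c by simp
    then show "1 \<le> \<kappa>1 / c" using c by (simp add: pos_le_divide_eq)
  qed (simp add: \<kappa>1_def)
  have K: "1 \<le> K d" if "d \<ge> 1" for d
  proof -
    have "1 \<le> real d powr (r + 1)" using that \<open>r \<ge> 0\<close> by (intro ge_one_powr_ge_zero) auto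
    then have "1 * 1 \<le> \<kappa>1 / c * real d powr (r + 1)" using \<kappa>c by (intro mult_mono) auto
    then show ?thesis by (simp add: K_def)
  qed
  define C1 where "C1 = 2 * \<kappa> / lam * sqrt \<rho> / (1 - sqrt (L / lam))"
  have C1: "0 \<le> C1"
  proof -
    have "sqrt (L / lam) < 1" using L lam by simp
    then show ?thesis using \<open>\<kappa> \<ge> 0\<close> lam \<rho> by (simp add: C1_def)
  qed
  have error: "L2_le P (\<lambda>\<omega>. U d [0] n x \<omega> - u d x) (C1 * real d powr s * \<delta> ^ n * (K d + enorm d x) powr p)"
    if d: "d \<ge> 1" and x: "x \<in> Rd d" for d n x
  proof -
    have "L2_le P (\<lambda>\<omega>. U d [0] n x \<omega> - u d x)
      (2 * (\<kappa> * real d powr s) / lam * sqrt \<rho> / (1 - sqrt (L / lam)) *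
        (1 / sqrt (real M) + (1 + 1 / sqrt (real M)) * sqrt (L / lam)) ^ n * (K d + enorm d x) powr p)"
    proof (rule mlp_error_in_dimension[where W=W and R=R and U="U d" and \<beta>="\<kappa> * real d powr r" and m=m and c=c and B="B d" and f="f d" and \<rho>=\<rho>])
      show "subexp d (u d)" unfolding subexp_def
      proof (intro allI impI)
        fix \<eta> :: real assume "\<eta> > 0"
        from assms(25)[OF d this] obtain C where C: "\<And>y. y \<in> Rd d \<Longrightarrow> \<bar>u d y\<bar> * exp (- \<eta> * enorm d y) \<le> C"
          unfolding bdd_above_def by blast
        have "\<bar>u d y\<bar> \<le> C * exp (\<eta> * enorm d y)" if "y \<in> Rd d" for y
        proof -
          have "\<bar>u d y\<bar> = \<bar>u d y\<bar> * exp (- \<eta> * enorm d y) * exp (\<eta> * enorm d y)"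
            by (simp add: mult.assoc exp_add[symmetric])
          also have "\<dots> \<le> C * exp (\<eta> * enorm d y)" by (intro mult_right_mono C that) simp
          finally show ?thesis .
        qed
        then show "\<exists>C. \<forall>x\<in>Rd d. \<bar>u d x\<bar> \<le> C * exp (\<eta> * enorm d x)" by blast
      qed
      show "\<kappa> * real d powr r * real d \<le> c * K d"
      proof -
        have "\<kappa> * real d powr r * real d = \<kappa> * real d powr (r + 1)" using d by (simp add: powr_add)
        also have "\<dots> \<le> \<kappa>1 * real d powr (r + 1)" using \<kappa>c by (intro mult_right_mono) auto
        also have "\<dots> = c * K d" using c by (simp add: K_def)
        finally show ?thesis .
      qed
      show "0 \<le> \<kappa> * real d powr s" "0 \<le> \<kappa> * real d powr r" "0 \<le> c" using \<open>\<kappa> \<ge> 0\<close> c by auto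
    qed (rule d x L \<rho> m c(2) cA K[OF d] assms(9) assms(4) assms(16)[OF d] assms(17-21) assms(26) assms(13)[OF d]
      assms(14)[OF d] assms(22-24)[OF d] assms(27)[OF d] assms(28)[OF d]; assumption)+
    then show ?thesis by (simp only: \<delta>_def[symmetric]) (simp add: C1_def mult_ac)
  qed
  \<comment> \<open>An upper bound for the order of K + |x| on the ball: K has order d^(r + 1) with
    r + 1 <= 2 r + 1, and |x| has order d^q.\<close>
  define \<mu> where "\<mu> = max q (2 * r + 1)"
  define \<beta> where "\<beta> = s + p * \<mu>"
  have \<mu>: "r + 1 \<le> \<mu>" "q \<le> \<mu>" using \<open>r \<ge> 0\<close> by (auto simp: \<mu>_def)
  have \<beta>0: "0 \<le> \<beta>" using assms(4-7) by (auto simp: \<beta>_def \<mu>_def)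
  define C2 where "C2 = (\<kappa>1 / c + \<kappa>) powr p"
  \<comment> \<open>At least 1, so that \<open>exists_level\<close> can be applied with y >=
    1.\<close>
  define C4 where "C4 = max 1 (C1 * C2)"
  have wbound: "(K d + enorm d x) powr p \<le> C2 * real d powr (p * \<mu>)"
    if d: "d \<ge> 1" and x: "enorm d x \<le> \<kappa> * real d powr q" for d and x :: "nat \<Rightarrow> real"
  proof -
    have d1: "1 \<le> real d" using d by simp
    have "K d \<le> \<kappa>1 / c * real d powr \<mu>"
      unfolding K_def using \<kappa>c \<mu> d1 by (intro mult_left_mono powr_mono) auto
    moreover have "enorm d x \<le> \<kappa> * real d powr \<mu>"
      using \<mu> d1 \<open>\<kappa> \<ge> 0\<close> by (intro order_trans[OF x] mult_left_mono powr_mono) auto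
    ultimately have "K d + enorm d x \<le> (\<kappa>1 / c + \<kappa>) * real d powr \<mu>" by (simp add: distrib_right)
    then have "(K d + enorm d x) powr p \<le> ((\<kappa>1 / c + \<kappa>) * real d powr \<mu>) powr p"
      using K[OF d] \<open>p \<ge> 0\<close> L2_set_nonneg[of x "{..<d}"] by (intro powr_mono2) auto
    also have "\<dots> = C2 * real d powr (p * \<mu>)" by (simp add: C2_def powr_mult powr_powr mult.commute)
    finally show ?thesis .
  qed
  define n0 where "n0 = nat \<lceil>\<nn>\<rceil>"
  \<comment> \<open>A bound for the ratio of the initial error on the ball to \<epsilon>; the level
    must make y \<delta>^n at most 1.\<close>
  define y where "y \<epsilon> d = C4 * real d powr \<beta> / \<epsilon>" for \<epsilon> :: real and d :: nat
  have y1: "1 \<le> y \<epsilon> d" if "\<epsilon> \<in> {0<..1}" "d \<ge> 1" for \<epsilon> d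
  proof -
    have "1 \<le> real d powr \<beta>" using that(2) \<beta>0 by (intro ge_one_powr_ge_zero) auto
    then have "1 * 1 \<le> C4 * real d powr \<beta>" by (intro mult_mono) (auto simp: C4_def)
    then have "\<epsilon> \<le> C4 * real d powr \<beta>" using that(1) by auto
    then show ?thesis using that(1) by (simp add: y_def pos_le_divide_eq)
  qed
  have "\<exists>n\<ge>n0. y \<epsilon> d * \<delta> ^ n \<le> 1 \<and> b ^ n \<le> b ^ (n0 + 1) * y \<epsilon> d powr \<alpha>"
    if "\<epsilon> \<in> {0<..1}" "d \<ge> 1" for \<epsilon> d
    by (rule exists_level[OF \<delta> b \<alpha> y1[OF that]])
  then obtain \<NN> where \<NN>: "\<And>\<epsilon> d. \<epsilon> \<in> {0<..1} \<Longrightarrow> d \<ge> 1 \<Longrightarrow>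
      n0 \<le> \<NN> \<epsilon> d \<and> y \<epsilon> d * \<delta> ^ \<NN> \<epsilon> d \<le> 1 \<and> b ^ \<NN> \<epsilon> d \<le> b ^ (n0 + 1) * y \<epsilon> d powr \<alpha>"
    by metis
  \<comment> \<open>The 2 comes from d + 1 <= 2 d, the power of b from rounding and from the lower
    bound n0 on the level.\<close>
  define C where "C = 2 * b ^ (n0 + 1) * C4 powr \<alpha>"
  show ?thesis
  proof (intro exI[of _ C] exI[of _ \<NN>] ballI allI impI conjI)
    fix \<epsilon> :: real and d :: nat assume \<epsilon>: "\<epsilon> \<in> {0<..1}" and d: "1 \<le> d"
    let ?N = "\<NN> \<epsilon> d"
    have N: "n0 \<le> ?N" "y \<epsilon> d * \<delta> ^ ?N \<le> 1" "b ^ ?N \<le> b ^ (n0 + 1) * y \<epsilon> d powr \<alpha>" using \<NN>[OF \<epsilon> d] by auto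
    have \<epsilon>0: "0 < \<epsilon>" using \<epsilon> by simp
    have d0: "0 < real d" using d by simp
    show "\<nn> \<le> real ?N" using N(1) unfolding n0_def by linarith
    show "\<CC> d ?N \<le> C * real d powr (1 + \<alpha> * (s + p * max q (2 * r + 1))) * \<epsilon> powr - \<alpha>"
    proof -
      have "\<CC> d ?N \<le> (real d + 1) * b ^ ?N"
        unfolding b_def by (rule cost_bound[OF \<open>M \<ge> 1\<close> _ assms(29)]) simp
      also have "\<dots> \<le> (2 * real d) * (b ^ (n0 + 1) * y \<epsilon> d powr \<alpha>)"
        using d b by (intro mult_mono N(3)) auto
      also have "y \<epsilon> d powr \<alpha> = C4 powr \<alpha> * real d powr (\<alpha> * \<beta>) * \<epsilon> powr - \<alpha>"
        by (simp add: y_def powr_divide powr_mult powr_powr powr_minus_divide mult.commute[of \<beta>])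
      also have "(2 * real d) * (b ^ (n0 + 1) * (C4 powr \<alpha> * real d powr (\<alpha> * \<beta>) * \<epsilon> powr - \<alpha>))
          = C * real d powr (1 + \<alpha> * \<beta>) * \<epsilon> powr - \<alpha>"
        using d0 by (simp add: C_def powr_add)
      finally show ?thesis by (simp only: \<beta>_def \<mu>_def)
    qed
    have bound: "L2_le P (\<lambda>\<omega>. U d [0] ?N x \<omega> - u d x) \<epsilon>"
      if x: "x \<in> Rd d" "enorm d x \<le> \<kappa> * real d powr q" for x
    proof (rule L2_le_mono[OF error[OF d x(1)]])
      have "C1 * real d powr s * \<delta> ^ ?N * (K d + enorm d x) powr p \<le> C1 * real d powr s * \<delta> ^ ?N * (C2 * real d powr (p * \<mu>))"
        using C1 \<delta> by (intro mult_left_mono wbound[OF d x(2)]) auto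
      also have "\<dots> = (C1 * C2) * real d powr \<beta> * \<delta> ^ ?N" by (simp add: \<beta>_def powr_add)
      also have "\<dots> \<le> C4 * real d powr \<beta> * \<delta> ^ ?N"
        using \<delta> by (intro mult_right_mono) (auto simp: C4_def)
      also have "\<dots> = \<epsilon> * (y \<epsilon> d * \<delta> ^ ?N)" using \<epsilon>0 by (simp add: y_def)
      also have "\<dots> \<le> \<epsilon> * 1" using \<epsilon>0 N(2) by (intro mult_left_mono) auto
      finally show "C1 * real d powr s * \<delta> ^ ?N * (K d + enorm d x) powr p \<le> \<epsilon>" by simp
    qed
    have sq: "\<bar>u d x - U d [0] ?N x \<omega>\<bar>\<^sup>2 = (U d [0] ?N x \<omega> - u d x)\<^sup>2" for x \<omega>
      by (simp add: power2_commute)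
    show "integrable P (\<lambda>\<omega>. \<bar>u d x - U d [0] ?N x \<omega>\<bar>\<^sup>2)"
      if "x \<in> Rd d" "enorm d x \<le> \<kappa> * real d powr q" for x
      unfolding sq by (rule L2_leD(3)[OF bound[OF that]])
    show "(SUP x\<in>{x \<in> Rd d. enorm d x \<le> \<kappa> * real d powr q}.
        ereal (sqrt (expectation (\<lambda>\<omega>. \<bar>u d x - U d [0] ?N x \<omega>\<bar>\<^sup>2)))) \<le> ereal \<epsilon>"
    proof (rule SUP_least)
      fix x assume "x \<in> {x \<in> Rd d. enorm d x \<le> \<kappa> * real d powr q}"
      then have "expectation (\<lambda>\<omega>. \<bar>u d x - U d [0] ?N x \<omega>\<bar>\<^sup>2) \<le> \<epsilon>\<^sup>2"
        unfolding sq using L2_leD(4)[OF bound[of x]] by simp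
      then have "sqrt (expectation (\<lambda>\<omega>. \<bar>u d x - U d [0] ?N x \<omega>\<bar>\<^sup>2)) \<le> \<epsilon>"
        using \<epsilon>0 by (intro real_le_lsqrt) auto
      then show "ereal (sqrt (expectation (\<lambda>\<omega>. \<bar>u d x - U d [0] ?N x \<omega>\<bar>\<^sup>2))) \<le> ereal \<epsilon>" by simp
    qed
  qed
qed

end
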